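(* Let $(\mu,\nu,q,f,F)\in\widetilde{\mathcal S}$, let $\{\lambda_n,\gamma_n\}_{n\ge 0}$ be the spectral data of the problem $\mathscr P(q,f,F)$, let $(\widetilde q,\widetilde f,\widetilde F)=\widetilde{\mathbf T}(\mu,\nu,q,f,F)$, and put $$I:=\operatorname{ind}\widetilde f-\operatorname{ind} f,\qquad J:=\frac{\operatorname{ind}\widetilde f+\operatorname{ind}\widetilde F}{2}-\frac{\operatorname{ind} f+\operatorname{ind} F}{2}.$$ Set $\lambda_{-1}:=\mu$, and let $\Lambda$ be the number used in the definition of $\widetilde{\mathbf T}$ ($\Lambda=\mu$ if $\mu<\mathring\lambda(q,f,F)$ and $\Lambda=\mu-2$ if $\mu=\mathring\lambda(q,f,F)$). Then the spectral data of the problem $\mathscr P(\widetilde q,\widetilde f,\widetilde F)$ is $$\{\lambda_n,\widetilde\gamma_n\}_{n\ge -J},\qquad\text{where } \widetilde\gamma_n=\gamma_n(\lambda_n-\Lambda)^I\ \text{ for } n\ge 0,\quad\text{and } \widetilde\gamma_{-1}=\nu .$$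
   Context: $\mathscr R$ is the set consisting of the symbol $\infty$ together with all rational functions $f(\lambda)=h_0\lambda+h+\sum_{k=1}^d\frac{\delta_k}{h_k-\lambda}$ ($d\ge 0$) with real coefficients, $h_0\ge 0$, $\delta_k>0$, $h_1<\dots<h_d$. The index is $\operatorname{ind} f=2d+1$ if $h_0>0$, $\operatorname{ind} f=2d$ if $h_0=0$, and $\operatorname{ind}\infty=-1$; $\mathscr R_n=\{f\in\mathscr R:\operatorname{ind} f=n\}$ (so $\mathscr R_0$ is the set of real constants). For $f\neq\infty$ put $f_\downarrow(\lambda)=h_0'\prod_{k=1}^d(h_k-\lambda)$ with $h_0'=1/h_0$ if $h_0>0$ and $h_0'=1$ if $h_0=0$, and $f_\uparrow=f\cdot f_\downarrow$ (a polynomial); for $f=\infty$ put $f_\uparrow=-1$, $f_\downarrow=0$. $\mathring{\pi}(f)$ denotes the smallest pole of $f$, and $\mathring\pi(f)=+\infty$ if $\operatorname{ind} f\le 1$. All potentials $q\in L_1(0,\pi)$ are real-valued. $\mathscr P(q,f,F)$ is the boundary value problem $-y''+q(x)y=\lambda y$ on $(0,\pi)$, $\frac{y'(0)}{y(0)}=-f(\lambda)$, $\frac{y'(\pi)}{y(\pi)}=F(\lambda)$, i.e. $f_\downarrow(\lambda)y'(0)+f_\uparrow(\lambda)y(0)=0$ and $F_\downarrow(\lambda)y'(\pi)-F_\uparrow(\lambda)y(\pi)=0$ (so $\infty$ means a Dirichlet condition). $\varphi(x,\lambda)$, $\psi(x,\lambda)$ are the solutions of the equation with $\varphi(0,\lambda)=f_\downarrow(\lambda)$,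 $\varphi'(0,\lambda)=-f_\uparrow(\lambda)$, $\psi(\pi,\lambda)=F_\downarrow(\lambda)$, $\psi'(\pi,\lambda)=F_\uparrow(\lambda)$. The eigenvalues are real and simple, numbered $\lambda_0<\lambda_1<\dots$, and for each there is a unique $\beta_n\ne0$ with $\psi(x,\lambda_n)=\beta_n\varphi(x,\lambda_n)$. The norming constants are $\gamma_n=\int_0^\pi\varphi^2(x,\lambda_n)\,dx+f'(\lambda_n)f_\downarrow^2(\lambda_n)+\frac{1}{\beta_n^2}F'(\lambda_n)F_\downarrow^2(\lambda_n)$, where $f'f_\downarrow^2$ means the polynomial $f_\uparrow'f_\downarrow-f_\uparrow f_\downarrow'$ (so it is $0$ if $f$ is constant or $\infty$), and similarly for $F$. The spectral data of the problem is $\{\lambda_n,\gamma_n\}_{n\ge0}$ (eigenvalues in increasing order with the corresponding norming constants). $\mathring\lambda(q,f,F)=\lambda_0$ and $\mathring\gamma(q,f,F)=\gamma_0$ denote the smallest eigenvalue and the corresponding norming constant. Transformation $\boldsymbol\Theta$: for $\mu,\tau\in\mathbb R$ and $f\in\mathscr R$ with $\mu<\mathring\pi(f)$ and $\tau\ge f(\mu)$ if $f\neq\infty$, $\boldsymbol\Theta(\mu,\tau,f)(\lambda):=\frac{\mu-\lambda}{f(\lambda)-\tau}-\tau$; if $f\equiv\tau$ this means $\infty$, and if $f=\infty$ it means the constant $-\tau$. Transformation $\widetilde{\mathbf T}$: its domain is $\widetilde{\mathcal S}=\widetilde{\mathcal S}_1\cup\widetilde{\mathcal S}_2\cup\widetilde{\mathcal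 S}_3$, consisting of tuples $(\mu,\nu,q,f,F)$ with $q\in L_1(0,\pi)$, $f,F\in\mathscr R$ and, respectively: ($\widetilde{\mathcal S}_1$) $\mu<\mathring\lambda(q,f,F)$, $\nu>0$; ($\widetilde{\mathcal S}_2$) $f\in\mathscr R_0$, $\mu=\mathring\lambda(q,f,F)$, $\nu=\mathring\gamma(q,f,F)/2$; ($\widetilde{\mathcal S}_3$) $F\in\mathscr R_0$, $\mu=\mathring\lambda(q,f,F)$, $\nu=2\mathring\gamma(q,f,F)$. A number $\Lambda$ and a zero-free function $u$ on $[0,\pi]$ are chosen as follows. On $\widetilde{\mathcal S}_1$: $\Lambda=\mu$; let $C,S$ be the solutions of $-y''+qy=\mu y$ with $C(0)=S'(0)=1$, $S(0)=C'(0)=0$, and $\varkappa=\frac{C'(\pi)-C(\pi)F(\mu)}{S'(\pi)-S(\pi)F(\mu)}$ (if $F=\infty$, $\varkappa=C(\pi)/S(\pi)$). The function $\gamma(t)=\left(f_\uparrow(\mu)-\varkappa f_\downarrow(\mu)\right)\frac{f_\uparrow(\mu)+tf_\downarrow(\mu)}{\varkappa+t}$ decreases strictly from $+\infty$ to $0$ on $(-\varkappa,-f(\mu))$ (with $-f(\mu)$ read as $+\infty$ if $f=\infty$), so there is a unique $\tau$ in this interval with $\gamma(\tau)=\nu$; $u$ is the solution of $-y''+qy=\mu y$ with $u(0)=1$, $u'(0)=\tau$. On $\widetilde{\mathcal S}_2$: $\Lambda=\mu-2$, $u(x)=\varphi(x,\mu-2)$. On $\widetilde{\mathcal S}_3$: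 $\Lambda=\mu-2$, $u(x)=\psi(x,\mu-2)$ (with $\varphi,\psi$ those of $\mathscr P(q,f,F)$). Finally $\widetilde{\mathbf T}(\mu,\nu,q,f,F)=(\widetilde q,\widetilde f,\widetilde F)$ with $\widetilde q=q-2\left(\frac{u'}{u}\right)'$, $\widetilde f=\boldsymbol\Theta\left(\Lambda,-\frac{u'(0)}{u(0)},f\right)$, $\widetilde F=\boldsymbol\Theta\left(\Lambda,\frac{u'(\pi)}{u(\pi)},F\right)$. *)

theory Defs
  imports
    "HOL-Analysis.Analysis"
    "HOL-Computational_Algebra.Fraction_Field"
    "HOL-Computational_Algebra.Polynomial"
begin

section \<open>Rational Herglotz--Nevanlinna functions\<close>

text \<open>
  \<^term>\<open>None\<close> is the symbol \<open>\<infinity>\<close>. Rational functions are elements of the fraction field of the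
  polynomial ring, so algebra on them has no exceptional points.
\<close>

type_synonym ratfun = "real poly fract option"

abbreviation pfract :: "real poly \<Rightarrow> real poly fract" where
  "pfract p \<equiv> Fraction_Field.Fract p 1"

text \<open>
  The set \<open>H\<close> consists of the poles \<open>h\<^sub>1 < \<dots> < h\<^sub>d\<close>, and \<open>\<delta> a\<close> is the coefficient belonging to the
  pole \<open>a\<close>.
\<close>

definition herglotz_expansion ::
    "real poly fract \<Rightarrow> real \<Rightarrow> real \<Rightarrow> real set \<Rightarrow> (real \<Rightarrow> real) \<Rightarrow> bool" where
  "herglotz_expansion r h0 h H \<delta> \<longleftrightarrow>
     0 \<le> h0 \<and> finite H \<and> (\<forall>a\<in>H. 0 < \<delta> a) \<and>
     r = pfract [:h, h0:] + (\<Sum>a\<in>H. Fraction_Field.Fract [:\<delta> a:] [:a, -1:])"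

definition herglotz :: "ratfun set" where
  "herglotz = {None} \<union> {Some r | r. \<exists>h0 h H \<delta>. herglotz_expansion r h0 h H \<delta>}"

definition lead_coefficient :: "real poly fract \<Rightarrow> real" where
  "lead_coefficient r = (THE h0. \<exists>h H \<delta>. herglotz_expansion r h0 h H \<delta>)"

definition poles :: "real poly fract \<Rightarrow> real set" where
  "poles r = (THE H. \<exists>h0 h \<delta>. herglotz_expansion r h0 h H \<delta>)"

fun ind :: "ratfun \<Rightarrow> int" where
  "ind None = -1"
| "ind (Some r) =
     (if lead_coefficient r > 0 then 2 * int (card (poles r)) + 1 else 2 * int (card (poles r)))"

definition herglotz_of_index :: "int \<Rightarrow> ratfun set" where
  "herglotz_of_index n = {f \<in> herglotz. ind f = n}"

fun down :: "ratfun \<Rightarrow> real poly" where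
  "down None = 0"
| "down (Some r) =
     smult (if lead_coefficient r > 0 then 1 / lead_coefficient r else 1) (\<Prod>a\<in>poles r. [:a, -1:])"

fun up :: "ratfun \<Rightarrow> real poly" where
  "up None = -1"
| "up (Some r) = (THE p. pfract p = r * pfract (down (Some r)))"

text \<open>Meaningful for finite \<open>f\<close> at points \<open>x\<close> which are not poles of \<open>f\<close>.\<close>

definition rf_value :: "ratfun \<Rightarrow> real \<Rightarrow> real" where
  "rf_value f x = poly (up f) x / poly (down f) x"

text \<open>The polynomial denoted by \<open>f' f\<^sub>\<down>\<^sup>2\<close>.\<close>

definition deriv_down_sq :: "ratfun \<Rightarrow> real poly" where
  "deriv_down_sq f = pderiv (up f) * down f - up f * pderiv (down f)"

fun Theta :: "real \<Rightarrow> real \<Rightarrow> ratfun \<Rightarrow> ratfun" where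
  "Theta \<mu> \<tau> None = Some (pfract [:- \<tau>:])"
| "Theta \<mu> \<tau> (Some r) =
     (if r = pfract [:\<tau>:] then None
      else Some (pfract [:\<mu>, -1:] / (r - pfract [:\<tau>:]) - pfract [:\<tau>:]))"


section \<open>The boundary value problem\<close>

text \<open>
  \<open>g\<close> is absolutely continuous on \<open>[0, \<pi>]\<close> with almost everywhere derivative \<open>g'\<close>, i.e. it is the
  indefinite integral of the Lebesgue integrable function \<open>g'\<close>.
\<close>

definition abs_cont_deriv :: "(real \<Rightarrow> 'a::euclidean_space) \<Rightarrow> (real \<Rightarrow> 'a) \<Rightarrow> bool" where
  "abs_cont_deriv g g' \<longleftrightarrow>
     g' absolutely_integrable_on {0..pi} \<and> (\<forall>x\<in>{0..pi}. g x = g 0 + integral {0..x} g')"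

text \<open>
  \<open>y\<close> is a solution of \<open>- y'' + q y = l y\<close> with derivative \<open>y'\<close>: as usual for an integrable potential,
  \<open>y'\<close> is absolutely continuous and the equation holds almost everywhere. Real solutions and
  (for non-real \<open>l\<close>) complex solutions are both needed, hence the polymorphism.
\<close>

definition solution ::
    "(real \<Rightarrow> real) \<Rightarrow> 'a::{real_normed_field,euclidean_space} \<Rightarrow> (real \<Rightarrow> 'a) \<Rightarrow> (real \<Rightarrow> 'a) \<Rightarrow> bool"
  where
  "solution q l y y' \<longleftrightarrow>
     (\<forall>x\<in>{0..pi}. (y has_vector_derivative y' x) (at x within {0..pi})) \<and>
     abs_cont_deriv y' (\<lambda>x. (of_real (q x) - l) * y x)"

text \<open>
  The solution with prescribed values of \<open>y\<close> and \<open>y'\<close> at \<open>x\<^sub>0\<close>, together with its derivative;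
  it is determined on \<open>[0, \<pi>]\<close> only.
\<close>

definition cauchy_solution ::
    "(real \<Rightarrow> real) \<Rightarrow> real \<Rightarrow> real \<Rightarrow> real \<Rightarrow> real \<Rightarrow> (real \<Rightarrow> real) \<times> (real \<Rightarrow> real)" where
  "cauchy_solution q l x0 a b =
     (SOME (y, y'). solution q l y y' \<and> y x0 = a \<and> y' x0 = b)"

definition phi :: "(real \<Rightarrow> real) \<Rightarrow> ratfun \<Rightarrow> real \<Rightarrow> (real \<Rightarrow> real) \<times> (real \<Rightarrow> real)" where
  "phi q f l = cauchy_solution q l 0 (poly (down f) l) (- poly (up f) l)"

definition psi :: "(real \<Rightarrow> real) \<Rightarrow> ratfun \<Rightarrow> real \<Rightarrow> (real \<Rightarrow> real) \<times> (real \<Rightarrow> real)" where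
  "psi q F l = cauchy_solution q l pi (poly (down F) l) (poly (up F) l)"

definition cpoly :: "real poly \<Rightarrow> complex \<Rightarrow> complex" where
  "cpoly p l = poly (map_poly of_real p) l"

definition is_eigenvalue :: "(real \<Rightarrow> real) \<Rightarrow> ratfun \<Rightarrow> ratfun \<Rightarrow> complex \<Rightarrow> bool" where
  "is_eigenvalue q f F l \<longleftrightarrow>
     (\<exists>y y'. solution q l y y' \<and> (\<exists>x\<in>{0..pi}. y x \<noteq> 0) \<and>
        cpoly (down f) l * y' 0 + cpoly (up f) l * y 0 = 0 \<and>
        cpoly (down F) l * y' pi - cpoly (up F) l * y pi = 0)"

definition beta :: "(real \<Rightarrow> real) \<Rightarrow> ratfun \<Rightarrow> ratfun \<Rightarrow> real \<Rightarrow> real" where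
  "beta q f F l = (THE b. b \<noteq> 0 \<and> (\<forall>x\<in>{0..pi}. fst (psi q F l) x = b * fst (phi q f l) x))"

definition norming_constant :: "(real \<Rightarrow> real) \<Rightarrow> ratfun \<Rightarrow> ratfun \<Rightarrow> real \<Rightarrow> real" where
  "norming_constant q f F l =
     integral {0..pi} (\<lambda>x. (fst (phi q f l) x)\<^sup>2)
     + poly (deriv_down_sq f) l
     + 1 / (beta q f F l)\<^sup>2 * poly (deriv_down_sq F) l"

definition admissible :: "(real \<Rightarrow> real) \<Rightarrow> ratfun \<Rightarrow> ratfun \<Rightarrow> bool" where
  "admissible q f F \<longleftrightarrow> q absolutely_integrable_on {0..pi} \<and> f \<in> herglotz \<and> F \<in> herglotz"

text \<open>
  The spectral data are numbered, in increasing order of the eigenvalues, by a set \<open>N\<close> of integers,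
  since a transformed problem can have an eigenvalue with number \<open>-1\<close>.
\<close>

definition spectral_data ::
    "(real \<Rightarrow> real) \<Rightarrow> ratfun \<Rightarrow> ratfun \<Rightarrow> int set \<Rightarrow> (int \<Rightarrow> real) \<Rightarrow> (int \<Rightarrow> real) \<Rightarrow> bool" where
  "spectral_data q f F N lam gam \<longleftrightarrow>
     admissible q f F \<and>
     strict_mono_on N lam \<and>
     {l. is_eigenvalue q f F l} = (\<lambda>n. complex_of_real (lam n)) ` N \<and>
     (\<forall>n\<in>N. gam n = norming_constant q f F (lam n))"

definition min_eigenvalue :: "(real \<Rightarrow> real) \<Rightarrow> ratfun \<Rightarrow> ratfun \<Rightarrow> real" where
  "min_eigenvalue q f F = (LEAST l. is_eigenvalue q f F (complex_of_real l))"

definition min_norming_constant :: "(real \<Rightarrow> real) \<Rightarrow> ratfun \<Rightarrow> ratfun \<Rightarrow> real" where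
  "min_norming_constant q f F = norming_constant q f F (min_eigenvalue q f F)"


section \<open>The transformation \<open>T\<close>\<close>

type_synonym transform_args = "real \<times> real \<times> (real \<Rightarrow> real) \<times> ratfun \<times> ratfun"

definition dom1 :: "transform_args set" where
  "dom1 = {(\<mu>, \<nu>, q, f, F). admissible q f F \<and> \<mu> < min_eigenvalue q f F \<and> \<nu> > 0}"

definition dom2 :: "transform_args set" where
  "dom2 = {(\<mu>, \<nu>, q, f, F). admissible q f F \<and> f \<in> herglotz_of_index 0 \<and>
     \<mu> = min_eigenvalue q f F \<and> \<nu> = min_norming_constant q f F / 2}"

definition dom3 :: "transform_args set" where
  "dom3 = {(\<mu>, \<nu>, q, f, F). admissible q f F \<and> F \<in> herglotz_of_index 0 \<and>
     \<mu> = min_eigenvalue q f F \<and> \<nu> = 2 * min_norming_constant q f F}"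

definition transform_dom :: "transform_args set" where
  "transform_dom = dom1 \<union> dom2 \<union> dom3"

definition kappa :: "real \<Rightarrow> (real \<Rightarrow> real) \<Rightarrow> ratfun \<Rightarrow> real" where
  "kappa \<mu> q F =
     (let (C, C') = cauchy_solution q \<mu> 0 1 0; (S, S') = cauchy_solution q \<mu> 0 0 1
      in if F = None then C pi / S pi
         else (C' pi - C pi * rf_value F \<mu>) / (S' pi - S pi * rf_value F \<mu>))"

definition gamma_fun :: "real \<Rightarrow> (real \<Rightarrow> real) \<Rightarrow> ratfun \<Rightarrow> ratfun \<Rightarrow> real \<Rightarrow> real" where
  "gamma_fun \<mu> q f F t =
     (poly (up f) \<mu> - kappa \<mu> q F * poly (down f) \<mu>) *
     ((poly (up f) \<mu> + t * poly (down f) \<mu>) / (kappa \<mu> q F + t))"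

definition tau :: "real \<Rightarrow> real \<Rightarrow> (real \<Rightarrow> real) \<Rightarrow> ratfun \<Rightarrow> ratfun \<Rightarrow> real" where
  "tau \<mu> \<nu> q f F =
     (THE t. - kappa \<mu> q F < t \<and> (f \<noteq> None \<longrightarrow> t < - rf_value f \<mu>) \<and> gamma_fun \<mu> q f F t = \<nu>)"

definition transform_point :: "transform_args \<Rightarrow> real" where
  "transform_point = (\<lambda>(\<mu>, \<nu>, q, f, F). if (\<mu>, \<nu>, q, f, F) \<in> dom1 then \<mu> else \<mu> - 2)"

text \<open>The pair \<open>(u, u')\<close>.\<close>

definition transform_solution :: "transform_args \<Rightarrow> (real \<Rightarrow> real) \<times> (real \<Rightarrow> real)" where
  "transform_solution = (\<lambda>(\<mu>, \<nu>, q, f, F).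
     if (\<mu>, \<nu>, q, f, F) \<in> dom1 then cauchy_solution q \<mu> 0 1 (tau \<mu> \<nu> q f F)
     else if (\<mu>, \<nu>, q, f, F) \<in> dom2 then phi q f (\<mu> - 2)
     else psi q F (\<mu> - 2))"

text \<open>
  The derivative of \<open>u'/u\<close> is an element of \<open>L\<^sub>1(0, \<pi>)\<close>; some representative of it is chosen.
\<close>

definition transform :: "transform_args \<Rightarrow> (real \<Rightarrow> real) \<times> ratfun \<times> ratfun" where
  "transform = (\<lambda>(\<mu>, \<nu>, q, f, F).
     let \<Lambda> = transform_point (\<mu>, \<nu>, q, f, F);
         (u, u') = transform_solution (\<mu>, \<nu>, q, f, F);
         v' = (SOME g. abs_cont_deriv (\<lambda>x. u' x / u x) g)
     in (\<lambda>x. q x - 2 * v' x, Theta \<Lambda> (- (u' 0 / u 0)) f, Theta \<Lambda> (u' pi / u pi) F))"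

end

theory Submission
  imports Defs "HOL-Computational_Algebra.Fundamental_Theorem_Algebra"
begin

text \<open>
  Let \<open>u\<close> be a zero-free solution at \<open>\<Lambda>\<close>, \<open>v = u' / u\<close>. The map \<open>y \<mapsto> y' - v y\<close> takes solutions
  for \<open>q\<close> at \<open>\<lambda>\<close> to solutions for \<open>q - 2 v'\<close> at \<open>\<lambda>\<close>; the same construction with \<open>1 / u\<close> goes
  back, up to the factor \<open>\<Lambda> - \<lambda>\<close>. On the boundary vectors \<open>(f\<^sub>\<down>, - f\<^sub>\<up>)\<close> the map is the
  transformation \<open>\<Theta>\<close>, so the eigenvalues different from \<open>\<Lambda>\<close> agree, and the norming constants are
  compared by integrating \<open>(z \<phi>)' = z\<^sup>2 + (\<Lambda> - \<lambda>) \<phi>\<^sup>2\<close> for \<open>z = \<phi>' - v \<phi>\<close>. Whether \<open>\<Lambda>\<close> is an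
  eigenvalue of the new problem is read off from \<open>1 / u\<close>.

  That \<open>u\<close> has no zeros and that \<open>\<Theta>\<close> is applied inside its domain follows from positivity of
  \<open>\<phi>\<close>, \<open>\<psi>\<close> and of the characteristic function below the smallest eigenvalue. This positivity holds
  near \<open>- \<infinity>\<close>, and as \<open>\<lambda>\<close> increases it can only be lost at an eigenvalue. Since \<open>q\<close> is merely
  integrable, everything is done for the system satisfied by \<open>y\<close> and \<open>y' - y \<integral> q\<close>, whose coefficients
  are continuous.
\<close>

section \<open>Rational Herglotz functions\<close>

text \<open>The three domains reduce to one computation because \<Theta> becomes a pair of
  polynomial identities. With \<open>down\<close> normalised as it is,
  \<open>\<tau> * down f - up f\<close> is exactly the new \<open>down\<close> as soon as it is
  positive at \<Lambda>. This is the strict form of \<open>\<tau> \<ge> f(\<Lambda>)\<close>;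
  equality occurs only for constant \<open>f\<close>, where a factor
  \<open>\<Lambda> - \<lambda>\<close> splits off and the new condition is Dirichlet.

  Which case holds at which end decides about \<Lambda>. At an end of the first kind
  \<open>1 / u\<close> satisfies the new boundary condition; at an end of the second kind it cannot,
  having no zero. Two ends of the first kind create the eigenvalue \<Lambda>, one of each kind
  leaves the spectrum unchanged.

  On the first domain \<open>u\<close> is a combination of \<phi> and \<psi>, and the interval
  allowed for \<tau> is where both coefficients are positive; \<gamma> is the norming constant of
  the new lowest eigenvalue as a function of \<tau>. On the other two \<open>u\<close> is \<phi> or
  \<psi> itself, and the shift by 2 puts \<Lambda> strictly below the spectrum, where both are
  positive.\<close>

definition pole_poly :: "real set \<Rightarrow> real poly" where
  "pole_poly H = (\<Prod>a\<in>H. [:a, -1:])"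

text \<open>The numerator of the sum of the \<open>\<delta> a / (a - \<lambda>)\<close> over the
  common denominator \<open>pole_poly H\<close>.\<close>

definition pole_sum :: "real set \<Rightarrow> (real \<Rightarrow> real) \<Rightarrow> real poly" where
  "pole_sum H \<delta> = (\<Sum>a\<in>H. smult (\<delta> a) (pole_poly (H - {a})))"

lemma poly_pole_poly: "poly (pole_poly H) x = (\<Prod>a\<in>H. a - x)"
  by (simp add: pole_poly_def poly_prod)

lemma pole_poly_nonzero [simp]: "finite H \<Longrightarrow> pole_poly H \<noteq> 0"
  by (simp add: pole_poly_def)

lemma degree_pole_poly [simp]: "degree (pole_poly H) = card H"
  unfolding pole_poly_def by (subst degree_prod_eq_sum_degree) auto

lemma lead_coeff_pole_poly: "coeff (pole_poly H) (card H) = (-1) ^ card H"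
proof -
  have "lead_coeff (pole_poly H) = (\<Prod>a\<in>H. lead_coeff [:a, -1:])"
    unfolding pole_poly_def by (rule lead_coeff_prod)
  then show ?thesis by simp
qed

lemma poly_pole_poly_eq_0: "finite H \<Longrightarrow> poly (pole_poly H) x = 0 \<longleftrightarrow> x \<in> H"
  by (simp add: poly_pole_poly)

lemma poly_pole_sum: "poly (pole_sum H \<delta>) x = (\<Sum>a\<in>H. \<delta> a * poly (pole_poly (H - {a})) x)"
  by (simp add: pole_sum_def poly_sum)

lemma poly_pole_sum_pole:
  assumes "finite H" "a \<in> H"
  shows "poly (pole_sum H \<delta>) a = \<delta> a * poly (pole_poly (H - {a})) a"
proof -
  have "poly (pole_sum H \<delta>) a =
      \<delta> a * poly (pole_poly (H - {a})) a + (\<Sum>b\<in>H - {a}. \<delta> b * poly (pole_poly (H - {b})) a)"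
    unfolding poly_pole_sum using assms by (simp add: sum.remove)
  moreover have "(\<Sum>b\<in>H - {a}. \<delta> b * poly (pole_poly (H - {b})) a) = 0"
    using assms by (intro sum.neutral) (auto simp: poly_pole_poly_eq_0)
  ultimately show ?thesis by simp
qed

lemma poly_pole_poly_remove:
  assumes "finite H" "a \<in> H"
  shows "poly (pole_poly H) x = (a - x) * poly (pole_poly (H - {a})) x"
  using assms by (simp add: poly_pole_poly prod.remove)

lemma poly_pole_sum_nonpole:
  assumes "finite H" "x \<notin> H"
  shows "poly (pole_sum H \<delta>) x = poly (pole_poly H) x * (\<Sum>a\<in>H. \<delta> a / (a - x))"
  unfolding poly_pole_sum sum_distrib_left
proof (intro sum.cong[OF refl])
  fix a assume "a \<in> H"
  then have "a - x \<noteq> 0" using assms(2) by auto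
  then show "\<delta> a * poly (pole_poly (H - {a})) x = poly (pole_poly H) x * (\<delta> a / (a - x))"
    unfolding poly_pole_poly_remove[OF assms(1) \<open>a \<in> H\<close>] by simp
qed

lemma degree_pole_sum_less: "finite H \<Longrightarrow> pole_sum H \<delta> = 0 \<or> degree (pole_sum H \<delta>) < card H"
proof (cases "H = {}")
  case False
  assume fin: "finite H"
  then have "card H > 0" using False by (simp add: card_gt_0_iff)
  moreover have "degree (pole_sum H \<delta>) \<le> card H - 1"
    unfolding pole_sum_def using fin
    by (intro degree_sum_le) (auto intro: order.trans[OF degree_smult_le])
  ultimately show ?thesis by linarith
qed (simp add: pole_sum_def)

lemma coeff_pole_sum_top: "finite H \<Longrightarrow> card H \<le> n \<Longrightarrow> coeff (pole_sum H \<delta>) n = 0"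
  using degree_pole_sum_less[of H \<delta>] by (auto intro: coeff_eq_0)

lemma sum_Fract_same_denominator:
  assumes "(q :: 'a::idom) \<noteq> 0"
  shows "(\<Sum>a\<in>A. Fraction_Field.Fract (p a) q) = Fraction_Field.Fract (\<Sum>a\<in>A. p a) q"
proof (induction A rule: infinite_finite_induct)
  case (insert x A)
  then show ?case
    using assms by (simp add: eq_fract) (simp add: algebra_simps)
qed (use assms in \<open>auto simp: Zero_fract_def eq_fract\<close>)

lemma sum_simple_fractions:
  assumes "finite H"
  shows "(\<Sum>a\<in>H. Fraction_Field.Fract [:\<delta> a:] [:a, -1:]) =
    Fraction_Field.Fract (pole_sum H \<delta>) (pole_poly H)"
proof -
  have "Fraction_Field.Fract [:\<delta> a:] [:a, -1:] =
      Fraction_Field.Fract (smult (\<delta> a) (pole_poly (H - {a}))) (pole_poly H)" if "a \<in> H" for a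
  proof -
    have "pole_poly H = [:a, -1:] * pole_poly (H - {a})"
      unfolding pole_poly_def using assms that by (rule prod.remove)
    moreover have "pole_poly (H - {a}) \<noteq> 0" using assms by simp
    moreover have "smult (\<delta> a) (pole_poly (H - {a})) = [:\<delta> a:] * pole_poly (H - {a})" by simp
    ultimately show ?thesis by (metis mult.commute mult_fract_cancel)
  qed
  then have "(\<Sum>a\<in>H. Fraction_Field.Fract [:\<delta> a:] [:a, -1:]) =
      (\<Sum>a\<in>H. Fraction_Field.Fract (smult (\<delta> a) (pole_poly (H - {a}))) (pole_poly H))"
    by (rule sum.cong[OF refl])
  then show ?thesis
    using assms by (simp add: sum_Fract_same_denominator pole_sum_def)
qed

text \<open>The numerator of the whole expansion over \<open>pole_poly H\<close>. For positive
  \<delta> the fraction is in lowest terms, since the numerator does not vanish at the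
  poles.\<close>

definition expansion_numerator :: "real \<Rightarrow> real \<Rightarrow> real set \<Rightarrow> (real \<Rightarrow> real) \<Rightarrow> real poly" where
  "expansion_numerator h0 h H \<delta> = [:h, h0:] * pole_poly H + pole_sum H \<delta>"

lemma herglotz_expansion_Fract:
  "herglotz_expansion r h0 h H \<delta> \<longleftrightarrow> 0 \<le> h0 \<and> finite H \<and> (\<forall>a\<in>H. 0 < \<delta> a) \<and>
     r = Fraction_Field.Fract (expansion_numerator h0 h H \<delta>) (pole_poly H)"
  unfolding herglotz_expansion_def
  by (rule conj_cong[OF refl])+
     (simp add: sum_simple_fractions expansion_numerator_def)

lemma poly_expansion_numerator_pole:
  assumes "finite H" "a \<in> H"
  shows "poly (expansion_numerator h0 h H \<delta>) a = \<delta> a * poly (pole_poly (H - {a})) a"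
  using assms
  by (simp add: expansion_numerator_def poly_pole_sum_pole poly_pole_poly_eq_0 del: mult_pCons_left)

lemma poly_expansion_numerator_nonpole:
  assumes "finite H" "x \<notin> H"
  shows "poly (expansion_numerator h0 h H \<delta>) x =
    poly (pole_poly H) x * (h0 * x + h + (\<Sum>a\<in>H. \<delta> a / (a - x)))"
  using assms by (simp add: expansion_numerator_def poly_pole_sum_nonpole algebra_simps)

text \<open>Cross-multiply. At a pole of one expansion its numerator is non-zero, so the other
  denominator must vanish there. With equal poles the numerators agree, and their coefficient of
  degree \<open>card H + 1\<close> is \<open>h0\<close> up to sign. This gives the definite
  descriptions \<open>poles\<close> and \<open>lead_coefficient\<close> their meaning.\<close>

lemma herglotz_expansion_unique:
  assumes "herglotz_expansion r h0 h H \<delta>" "herglotz_expansion r k0 k K \<epsilon>"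
  shows "H = K" "h0 = k0"
proof -
  let ?P = "expansion_numerator h0 h H \<delta>" and ?R = "expansion_numerator k0 k K \<epsilon>"
  have fin: "finite H" "finite K" and pos: "\<forall>a\<in>H. 0 < \<delta> a" "\<forall>a\<in>K. 0 < \<epsilon> a"
    and eq: "?P * pole_poly K = ?R * pole_poly H"
    using assms by (auto simp: herglotz_expansion_Fract eq_fract)
  have sub: "A \<subseteq> B" if "finite A" "finite B" "\<forall>a\<in>A. 0 < \<alpha> a"
    and "expansion_numerator a0 a A \<alpha> * pole_poly B = expansion_numerator b0 b B \<beta> * pole_poly A"
    for A B \<alpha> \<beta> a0 a b0 b
  proof
    fix x assume "x \<in> A"
    then have "poly (expansion_numerator a0 a A \<alpha>) x \<noteq> 0"
      using that(1,3) by (auto simp: poly_expansion_numerator_pole poly_pole_poly_eq_0)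
    moreover have "poly (expansion_numerator a0 a A \<alpha> * pole_poly B) x = 0"
      unfolding that(4) using that(1) \<open>x \<in> A\<close> by (simp add: poly_pole_poly_eq_0)
    ultimately show "x \<in> B" using that(2) by (simp add: poly_pole_poly_eq_0)
  qed
  show HK: "H = K"
    using sub[OF fin pos(1) eq] sub[OF fin(2,1) pos(2) eq[symmetric]] by blast
  have "?P = ?R" using eq fin HK by simp
  then have "coeff ?P (Suc (card H)) = coeff ?R (Suc (card H))" by simp
  moreover have "coeff (expansion_numerator a0 a H \<alpha>) (Suc (card H)) = a0 * (-1) ^ card H" for a0 a \<alpha>
    using fin(1) by (simp add: expansion_numerator_def coeff_pole_sum_top coeff_eq_0 lead_coeff_pole_poly)
  ultimately show "h0 = k0" unfolding HK by simp
qed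

lemma poles_eq: "herglotz_expansion r h0 h H \<delta> \<Longrightarrow> poles r = H"
  unfolding poles_def by (rule the_equality) (auto dest: herglotz_expansion_unique(1))

lemma lead_coefficient_eq: "herglotz_expansion r h0 h H \<delta> \<Longrightarrow> lead_coefficient r = h0"
  unfolding lead_coefficient_def by (rule the_equality) (auto dest: herglotz_expansion_unique(2))

definition down_scale :: "real \<Rightarrow> real" where
  "down_scale h0 = (if h0 > 0 then 1 / h0 else 1)"

lemma down_scale_pos [simp]: "down_scale h0 > 0"
  by (simp add: down_scale_def)

lemma down_eq:
  "herglotz_expansion r h0 h H \<delta> \<Longrightarrow> down (Some r) = smult (down_scale h0) (pole_poly H)"
  by (simp add: poles_eq lead_coefficient_eq pole_poly_def down_scale_def)

lemma up_eq:
  assumes "herglotz_expansion r h0 h H \<delta>"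
  shows "up (Some r) = smult (down_scale h0) (expansion_numerator h0 h H \<delta>)"
proof -
  have fin: "finite H" and r: "r = Fraction_Field.Fract (expansion_numerator h0 h H \<delta>) (pole_poly H)"
    using assms by (auto simp: herglotz_expansion_Fract)
  show ?thesis
    unfolding up.simps down_eq[OF assms]
    unfolding r
  proof (rule the_equality)
    fix p
    assume "pfract p = Fraction_Field.Fract (expansion_numerator h0 h H \<delta>) (pole_poly H)
      * pfract (smult (down_scale h0) (pole_poly H))"
    then have "p * pole_poly H = smult (down_scale h0) (expansion_numerator h0 h H \<delta>) * pole_poly H"
      using fin by (simp add: eq_fract)
    then show "p = smult (down_scale h0) (expansion_numerator h0 h H \<delta>)"
      using fin by (metis mult_cancel_right pole_poly_nonzero)
  qed (use fin in \<open>simp add: eq_fract\<close>)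
qed

lemma ind_eq:
  "herglotz_expansion r h0 h H \<delta> \<Longrightarrow> ind (Some r) = 2 * int (card H) + (if h0 > 0 then 1 else 0)"
  by (simp add: poles_eq lead_coefficient_eq)

lemma Some_in_herglotz_iff: "Some r \<in> herglotz \<longleftrightarrow> (\<exists>h0 h H \<delta>. herglotz_expansion r h0 h H \<delta>)"
  by (auto simp: herglotz_def)

section \<open>Values at complex points and counting of real zeros\<close>

lemma cpoly_pCons [simp]: "cpoly (pCons a p) z = of_real a + z * cpoly p z"
  by (cases "a = 0 \<and> p = 0") (auto simp: cpoly_def map_poly_pCons)

lemma cpoly_0 [simp]: "cpoly 0 z = 0"
  by (simp add: cpoly_def)

lemma cpoly_add [simp]: "cpoly (p + q) z = cpoly p z + cpoly q z"
  by (induction p q rule: poly_induct2) (simp_all add: algebra_simps)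

lemma cpoly_smult [simp]: "cpoly (smult a p) z = of_real a * cpoly p z"
  by (induction p) (simp_all add: algebra_simps)

lemma cpoly_minus [simp]: "cpoly (- p) z = - cpoly p z"
  using cpoly_smult[of "-1" p z] by simp

lemma cpoly_diff [simp]: "cpoly (p - q) z = cpoly p z - cpoly q z"
  using cpoly_add[of p "- q" z] by simp

lemma cpoly_mult [simp]: "cpoly (p * q) z = cpoly p z * cpoly q z"
  by (induction p) (simp_all add: algebra_simps)

lemma cpoly_1 [simp]: "cpoly 1 z = 1"
  by (simp add: cpoly_def)

lemma cpoly_sum: "cpoly (\<Sum>a\<in>A. p a) z = (\<Sum>a\<in>A. cpoly (p a) z)"
  by (induction A rule: infinite_finite_induct) simp_all

lemma cpoly_prod: "cpoly (\<Prod>a\<in>A. p a) z = (\<Prod>a\<in>A. cpoly (p a) z)"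
  by (induction A rule: infinite_finite_induct) simp_all

lemma cpoly_of_real [simp]: "cpoly p (of_real x) = of_real (poly p x)"
  by (induction p) simp_all

lemma cpoly_pole_poly: "cpoly (pole_poly H) z = (\<Prod>a\<in>H. of_real a - z)"
  by (simp add: pole_poly_def cpoly_prod)

lemma cpoly_expansion_numerator:
  assumes "finite H" "Im z \<noteq> 0"
  shows "cpoly (expansion_numerator h0 h H \<delta>) z =
    cpoly (pole_poly H) z * (of_real h0 * z + of_real h + (\<Sum>a\<in>H. of_real (\<delta> a) / (of_real a - z)))"
proof -
  have "cpoly (pole_sum H \<delta>) z = cpoly (pole_poly H) z * (\<Sum>a\<in>H. of_real (\<delta> a) / (of_real a - z))"
    unfolding pole_sum_def cpoly_sum sum_distrib_left
  proof (intro sum.cong[OF refl])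
    fix a assume "a \<in> H"
    then have "cpoly (pole_poly H) z = (of_real a - z) * cpoly (pole_poly (H - {a})) z"
      using assms(1) by (simp add: cpoly_pole_poly prod.remove)
    moreover have "of_real a - z \<noteq> 0" using assms(2) by (auto simp: complex_eq_iff)
    ultimately show "cpoly (smult (\<delta> a) (pole_poly (H - {a}))) z =
        cpoly (pole_poly H) z * (of_real (\<delta> a) / (of_real a - z))"
      by simp
  qed
  then show ?thesis by (simp add: expansion_numerator_def algebra_simps)
qed

text \<open>Over the complex numbers a square-free polynomial is a product of distinct linear
  factors, and by assumption every zero is real. The poles of a transformed function are counted
  this way.\<close>

lemma card_real_roots_eq_degree:
  fixes p :: "real poly"
  assumes real: "\<And>z. cpoly p z = 0 \<Longrightarrow> Im z = 0"
    and simple: "\<And>x. poly p x = 0 \<Longrightarrow> poly (pderiv p) x \<noteq> 0"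
  shows "card {x. poly p x = 0} = degree p"
proof -
  let ?c = "map_poly complex_of_real p"
  have pd: "pderiv ?c = map_poly complex_of_real (pderiv p)"
    by (simp add: poly_eq_iff coeff_pderiv coeff_map_poly)
  have roots: "{z. poly ?c z = 0} = complex_of_real ` {x. poly p x = 0}"
  proof (intro equalityI subsetI)
    fix z assume "z \<in> {z. poly ?c z = 0}"
    then have z: "cpoly p z = 0" by (simp add: cpoly_def)
    then have "z = of_real (Re z)" using real by (simp add: complex_eq_iff)
    then show "z \<in> complex_of_real ` {x. poly p x = 0}"
      using z by (metis (mono_tags, lifting) cpoly_of_real image_eqI mem_Collect_eq of_real_eq_0_iff)
  qed (auto simp flip: cpoly_def)
  have "rsquarefree ?c"
    unfolding rsquarefree_roots pd
  proof safe
    fix z assume 1: "poly ?c z = 0" and 2: "poly (map_poly complex_of_real (pderiv p)) z = 0"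
    then obtain x where "z = of_real x" "poly p x = 0" using roots by blast
    then show False using 2 simple by (auto simp flip: cpoly_def)
  qed
  then have *: "?c = smult (lead_coeff ?c) (\<Prod>z|poly ?c z = 0. [:-z, 1:])" and "?c \<noteq> 0"
    by (simp_all add: complex_poly_decompose_rsquarefree rsquarefree_def)
  then have "degree ?c = degree (\<Prod>z|poly ?c z = 0. [:-z, 1:])"
    by (metis degree_smult_eq leading_coeff_0_iff)
  also have "\<dots> = card {z. poly ?c z = 0}"
    by (subst degree_prod_eq_sum_degree) auto
  also have "\<dots> = card {x. poly p x = 0}"
    unfolding roots by (rule card_image) (auto intro: inj_onI)
  finally show ?thesis using degree_map_poly[of complex_of_real p] by simp
qed

text \<open>Both sides agree at \<open>degree p\<close> points and in the top coefficient. The sign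
  is there because the factors \<open>a - \<lambda>\<close> have leading coefficient -1.\<close>

lemma poly_eq_smult_pole_poly:
  fixes p :: "real poly"
  assumes card: "card {x. poly p x = 0} = degree p" and "p \<noteq> 0"
  shows "p = smult (lead_coeff p * (-1) ^ degree p) (pole_poly {x. poly p x = 0})"
proof -
  define R where "R = {x. poly p x = 0}"
  have fin: "finite R" using assms(2) unfolding R_def by (rule poly_roots_finite)
  have "coeff (pole_poly R) (degree p) = (-1) ^ degree p"
    using lead_coeff_pole_poly[of R] card unfolding R_def[symmetric] by metis
  then have "lead_coeff p = coeff (smult (lead_coeff p * (-1) ^ degree p) (pole_poly R)) (degree p)"
    by (simp flip: power_add mult_2)
  moreover have "poly p z = poly (smult (lead_coeff p * (-1) ^ degree p) (pole_poly R)) z"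
    if "z \<in> R" for z
    using that poly_pole_poly_eq_0[OF fin] by (simp add: R_def)
  moreover have "degree (smult (lead_coeff p * (-1) ^ degree p) (pole_poly R)) \<le> degree p"
    using card unfolding R_def[symmetric] by (intro order.trans[OF degree_smult_le]) simp
  ultimately show ?thesis
    unfolding R_def[symmetric] using card
    by (intro poly_eqI_degree_lead_coeff[where n = "degree p" and A = R]) (auto simp flip: R_def)
qed

text \<open>Division with a quotient of degree at most one. It is done by hand so that the slope of
  the quotient is an explicit ratio of coefficients; this slope becomes the \<open>h0\<close> of a
  transformed function.\<close>

lemma pseudo_linear_quotient:
  fixes E N :: "real poly"
  assumes "N \<noteq> 0" "degree E \<le> Suc (degree N)"
  obtains s0 where
    "\<forall>i\<ge>degree N. coeff (E - N * [:s0, coeff E (Suc (degree N)) / lead_coeff N:]) i = 0"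
proof -
  define n s1 where "n = degree N" and "s1 = coeff E (Suc n) / lead_coeff N"
  define s0 where "s0 = coeff (E - N * [:0, s1:]) n / lead_coeff N"
  have lc: "coeff N n \<noteq> 0" using assms(1) by (simp add: n_def)
  have split: "E - N * [:s0, s1:] = (E - N * [:0, s1:]) - smult s0 N"
    by simp
  have "coeff (E - N * [:s0, s1:]) i = 0" if i: "i \<ge> n" for i
  proof (cases "i = n")
    case True
    then show ?thesis unfolding split s0_def coeff_diff coeff_smult using lc by (simp add: n_def)
  next
    case False
    then obtain j where j: "i = Suc j" "j \<ge> n" using i by (cases i) auto
    have "coeff N i = 0" using j by (intro coeff_eq_0) (simp add: n_def)
    then have c: "coeff (E - N * [:s0, s1:]) i = coeff E i - s1 * coeff N j"
      unfolding j(1) by simp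
    show ?thesis
    proof (cases "j = n")
      case True
      then show ?thesis unfolding c unfolding j(1) s1_def using lc by (simp add: n_def)
    next
      case False
      then have "coeff E i = 0" "coeff N j = 0"
        using j assms(2) by (auto intro!: coeff_eq_0 simp: n_def)
      then show ?thesis unfolding c by simp
    qed
  qed
  then show thesis using that unfolding n_def s1_def by blast
qed

text \<open>Lagrange interpolation at the simple zeros of the denominator gives the residues.\<close>

lemma partial_fractions:
  fixes E N :: "real poly" and k :: real
  assumes N: "N = smult k (pole_poly R)" "k \<noteq> 0" "finite R"
    and deg: "degree E \<le> Suc (card R)"
    and \<delta>: "\<And>a. a \<in> R \<Longrightarrow> \<delta> a * poly (pderiv N) a = - poly E a"
  shows "\<exists>s0. E = N * [:s0, coeff E (Suc (card R)) / lead_coeff N:] + smult k (pole_sum R \<delta>)"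
proof -
  have degN: "degree N = card R" and "N \<noteq> 0" using N by simp_all
  then obtain s0 where s0:
    "\<forall>i\<ge>card R. coeff (E - N * [:s0, coeff E (Suc (card R)) / lead_coeff N:]) i = 0"
    using pseudo_linear_quotient[of N E] deg by metis
  define r where "r = E - N * [:s0, coeff E (Suc (card R)) / lead_coeff N:]"
  have r0: "\<And>i. i \<ge> card R \<Longrightarrow> coeff r i = 0" using s0 unfolding r_def by blast
  have "r = smult k (pole_sum R \<delta>)"
  proof (cases "R = {}")
    \<comment> \<open>Without poles there is no point to interpolate at and no degree below
      \<open>card R\<close>; here the remainder is zero outright.\<close>
    case True
    then have "r = 0" using r0 by (intro poly_eqI) simp
    then show ?thesis using True by (simp add: pole_sum_def)
  next
    case False
    then have pos: "card R > 0" using N(3) by (simp add: card_gt_0_iff)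
    show ?thesis
    proof (rule poly_eqI_degree[of R])
      fix a assume a: "a \<in> R"
      have "pole_poly R = [:a, -1:] * pole_poly (R - {a})"
        unfolding pole_poly_def using N(3) a by (rule prod.remove)
      then have N': "N = smult k ([:a, -1:] * pole_poly (R - {a}))" using N(1) by metis
      have "poly (pderiv N) a = - k * poly (pole_poly (R - {a})) a"
        unfolding N' by (simp add: pderiv_smult pderiv_mult pderiv_pCons del: mult_pCons_left)
      then have "poly E a = k * (\<delta> a * poly (pole_poly (R - {a})) a)"
        using \<delta>[OF a] by (simp add: algebra_simps)
      moreover have "poly N a = 0" unfolding N' by simp
      then have "poly r a = poly E a" unfolding r_def by (simp del: mult_pCons_right)
      ultimately show "poly r a = poly (smult k (pole_sum R \<delta>)) a"
        by (simp add: poly_pole_sum_pole[OF N(3) a])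
    next
      show "degree r < card R" using r0 pos by (intro degree_lessI) auto
      show "degree (smult k (pole_sum R \<delta>)) < card R"
        using degree_pole_sum_less[OF N(3), of \<delta>] pos by (auto intro: le_less_trans[OF degree_smult_le])
    qed
  qed
  then have "E = N * [:s0, coeff E (Suc (card R)) / lead_coeff N:] + smult k (pole_sum R \<delta>)"
    unfolding r_def by (metis add.commute diff_add_cancel)
  then show ?thesis by blast
qed

section \<open>Values, poles and behaviour to the left of the poles\<close>

text \<open>Elements of the fraction field are not functions; monotonicity and differentiation are
  carried out on this real function and transferred through
  \<open>up_eq_down_mult_value\<close>.\<close>

definition herglotz_value :: "real \<Rightarrow> real \<Rightarrow> real set \<Rightarrow> (real \<Rightarrow> real) \<Rightarrow> real \<Rightarrow> real" where
  "herglotz_value h0 h H \<delta> x = h0 * x + h + (\<Sum>a\<in>H. \<delta> a / (a - x))"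

lemma up_eq_down_mult_value:
  assumes "herglotz_expansion r h0 h H \<delta>" "x \<notin> H"
  shows "poly (up (Some r)) x = poly (down (Some r)) x * herglotz_value h0 h H \<delta> x"
proof -
  have "finite H" using assms(1) by (simp add: herglotz_expansion_def)
  then show ?thesis
    using assms by (simp add: down_eq up_eq poly_expansion_numerator_nonpole herglotz_value_def
        del: down.simps up.simps)
qed

lemma herglotz_value_mono:
  assumes "0 \<le> h0" "\<forall>a\<in>H. 0 < \<delta> a" "x \<le> y" "\<forall>a\<in>H. y < a"
  shows "herglotz_value h0 h H \<delta> x \<le> herglotz_value h0 h H \<delta> y"
  unfolding herglotz_value_def using assms
  by (intro add_mono mult_left_mono sum_mono divide_left_mono mult_pos_pos) (auto simp: less_imp_le)

lemma herglotz_value_deriv: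
  assumes "finite H" "x \<notin> H"
  shows "(herglotz_value h0 h H \<delta> has_real_derivative (h0 + (\<Sum>a\<in>H. \<delta> a / (a - x)\<^sup>2))) (at x)"
proof -
  have "((\<lambda>x. \<delta> a / (a - x)) has_real_derivative \<delta> a / (a - x)\<^sup>2) (at x)" if "a \<in> H" for a
    using assms(2) that by (auto intro!: derivative_eq_intros simp: power2_eq_square)
  then have "((\<lambda>x. h0 * x + h + (\<Sum>a\<in>H. \<delta> a / (a - x))) has_real_derivative
      (h0 * 1 + 0 + (\<Sum>a\<in>H. \<delta> a / (a - x)\<^sup>2))) (at x)"
    by (intro derivative_intros DERIV_sum) auto
  then show ?thesis by (simp add: herglotz_value_def[abs_def])
qed

text \<open>Says that \<open>x\<close> is less than the smallest pole, and is vacuous when there is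
  none, so that no value \<open>+\<infinity>\<close> has to be introduced.\<close>

definition below_poles :: "ratfun \<Rightarrow> real \<Rightarrow> bool" where
  "below_poles f x \<longleftrightarrow> (\<forall>r. f = Some r \<longrightarrow> (\<forall>a\<in>poles r. x < a))"

lemma below_poles_None [simp]: "below_poles None x"
  by (simp add: below_poles_def)

lemma below_poles_mono: "below_poles f y \<Longrightarrow> x \<le> y \<Longrightarrow> below_poles f x"
  by (force simp: below_poles_def)

lemma down_pos:
  assumes "f \<in> herglotz" "f \<noteq> None" "below_poles f x"
  shows "poly (down f) x > 0"
proof -
  obtain r h0 h H \<delta> where f: "f = Some r" and r: "herglotz_expansion r h0 h H \<delta>"
    using assms(1,2) by (auto simp: herglotz_def)
  have "\<forall>a\<in>H. x < a" using assms(3) f poles_eq[OF r] by (auto simp: below_poles_def)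
  then show ?thesis unfolding f down_eq[OF r] by (auto simp: poly_pole_poly intro!: prod_pos mult_pos_pos)
qed

text \<open>At a pole the numerator is the positive residue times a product of non-zero differences.
  Hence the boundary vectors that start \<phi> and \<psi> are never trivial.\<close>

lemma down_up_not_both_zero:
  assumes "f \<in> herglotz"
  shows "poly (down f) x \<noteq> 0 \<or> poly (up f) x \<noteq> 0"
proof (cases f)
  case (Some r)
  then obtain h0 h H \<delta> where r: "herglotz_expansion r h0 h H \<delta>"
    using assms by (auto simp: Some_in_herglotz_iff)
  then have fin: "finite H" and pos: "\<forall>a\<in>H. 0 < \<delta> a" by (auto simp: herglotz_expansion_def)
  have c: "down_scale h0 \<noteq> 0" using down_scale_pos[of h0] by linarith
  show ?thesis
  proof (cases "x \<in> H")
    case True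
    then have "poly (expansion_numerator h0 h H \<delta>) x \<noteq> 0"
      using fin pos by (auto simp: poly_expansion_numerator_pole poly_pole_poly_eq_0)
    then show ?thesis unfolding Some up_eq[OF r] using c by simp
  next
    case False
    then show ?thesis unfolding Some down_eq[OF r] using c fin by (simp add: poly_pole_poly_eq_0)
  qed
qed simp

text \<open>If \<open>s\<close> is itself the smallest pole, all other factors \<open>a - s\<close>
  are positive, so \<open>up\<close> has the sign of the residue. This borderline case is refuted
  later, in \<open>oscillation_free_limit\<close>.\<close>

lemma below_poles_limit:
  assumes "f \<in> herglotz" "\<And>y. y < s \<Longrightarrow> below_poles f y"
  shows "below_poles f s \<or> poly (down f) s = 0 \<and> poly (up f) s > 0"
proof (cases f)
  case (Some r)
  then obtain h0 h H \<delta> where r: "herglotz_expansion r h0 h H \<delta>"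
    using assms by (auto simp: Some_in_herglotz_iff)
  then have fin: "finite H" and pos: "\<forall>a\<in>H. 0 < \<delta> a" by (auto simp: herglotz_expansion_def)
  have le: "s \<le> a" if "a \<in> H" for a
  proof (rule dense_le)
    fix y assume "y < s"
    then show "y \<le> a" using assms(2)[of y] that Some poles_eq[OF r] by (auto simp: below_poles_def)
  qed
  show ?thesis
  proof (cases "s \<in> H")
    case True
    then have "poly (pole_poly (H - {s})) s > 0"
      using le unfolding poly_pole_poly by (intro prod_pos) (force simp: less_le)
    then have "poly (expansion_numerator h0 h H \<delta>) s > 0"
      using True fin pos by (simp add: poly_expansion_numerator_pole)
    then show ?thesis unfolding Some up_eq[OF r] down_eq[OF r]
      using True fin by (simp add: poly_pole_poly_eq_0)
  next
    case False
    then show ?thesis using le poles_eq[OF r] Some by (force simp: below_poles_def less_le)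
  qed
qed simp

lemma below_poles_open:
  assumes "f \<in> herglotz" "below_poles f x"
  shows "\<exists>e>0. below_poles f (x + e)"
proof (cases f)
  case (Some r)
  then obtain h0 h H \<delta> where r: "herglotz_expansion r h0 h H \<delta>"
    using assms by (auto simp: Some_in_herglotz_iff)
  then have fin: "finite H" by (auto simp: herglotz_expansion_def)
  define m where "m = Min (insert (x + 1) H)"
  have "x < m" unfolding m_def using fin assms(2) Some poles_eq[OF r] by (auto simp: below_poles_def)
  moreover have "m \<le> a" if "a \<in> H" for a unfolding m_def using fin that by simp
  ultimately have "below_poles f (x + (m - x) / 2)"
    unfolding below_poles_def using Some poles_eq[OF r] by (force simp: field_simps)
  then show ?thesis using \<open>x < m\<close> by (intro exI[of _ "(m - x) / 2"]) simp
qed (auto intro: exI[of _ 1])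

text \<open>To the left of its poles a Herglotz function increases, so its value at one such point
  bounds it from there down to \<open>-\<infinity>\<close>.\<close>

lemma herglotz_bounded_at_minus_infinity:
  assumes "f \<in> herglotz"
  shows "\<exists>c M. \<forall>x\<le>M. below_poles f x \<and> (f \<noteq> None \<longrightarrow> poly (up f) x \<le> c * poly (down f) x)"
proof (cases f)
  case (Some r)
  then obtain h0 h H \<delta> where r: "herglotz_expansion r h0 h H \<delta>"
    using assms by (auto simp: Some_in_herglotz_iff)
  then have fin: "finite H" and h0: "0 \<le> h0" and pos: "\<forall>a\<in>H. 0 < \<delta> a"
    by (auto simp: herglotz_expansion_def)
  \<comment> \<open>The inserted 0 keeps the minimum meaningful when there are no poles.\<close>
  define M where "M = Min (insert 0 H) - 1"
  have M: "M < a" if "a \<in> H" for a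
    using fin that unfolding M_def by (smt (verit) Min_le finite.insertI insertCI)
  show ?thesis
  proof (intro exI allI impI conjI)
    fix x assume x: "x \<le> M"
    then show b: "below_poles f x"
      using M Some poles_eq[OF r] by (force simp: below_poles_def)
    have "x \<notin> H" using M x by force
    have "herglotz_value h0 h H \<delta> x \<le> herglotz_value h0 h H \<delta> M"
      using h0 pos x M by (intro herglotz_value_mono) auto
    then show "poly (up f) x \<le> herglotz_value h0 h H \<delta> M * poly (down f) x"
      using down_pos[OF assms _ b] Some
      unfolding Some up_eq_down_mult_value[OF r \<open>x \<notin> H\<close>] by (simp add: mult.commute mult_left_mono del: down.simps)
  qed
qed auto

lemma herglotz_of_index_0:
  assumes "f \<in> herglotz_of_index 0"
  obtains h where "f = Some (pfract [:h:])" "down f = 1" "up f = [:h:]" "f \<in> herglotz"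
proof -
  have f: "f \<in> herglotz" "ind f = 0" using assms by (auto simp: herglotz_of_index_def)
  then obtain r where r: "f = Some r" by (cases f) auto
  then obtain h0 h H \<delta> where e: "herglotz_expansion r h0 h H \<delta>"
    using f by (auto simp: Some_in_herglotz_iff)
  then have fin: "finite H" and "0 \<le> h0" by (auto simp: herglotz_expansion_def)
  have "2 * int (card H) + (if h0 > 0 then 1 else 0) = 0" using f(2) unfolding r ind_eq[OF e] .
  then have "card H = 0" "h0 = 0" using \<open>0 \<le> h0\<close> by (auto split: if_splits)
  then have "H = {}" using fin by simp
  have "r = pfract [:h:]" using e \<open>H = {}\<close> \<open>h0 = 0\<close> by (simp add: herglotz_expansion_def)
  moreover have "down f = 1" unfolding r down_eq[OF e] using \<open>H = {}\<close> \<open>h0 = 0\<close>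
    by (simp add: pole_poly_def down_scale_def)
  moreover have "up f = [:h:]" unfolding r up_eq[OF e] using \<open>H = {}\<close> \<open>h0 = 0\<close>
    by (simp add: expansion_numerator_def pole_poly_def pole_sum_def down_scale_def)
  ultimately show thesis using that f r by blast
qed

lemma herglotz_constant:
  "herglotz_expansion (pfract [:h:]) 0 h {} \<delta>"
  by (simp add: herglotz_expansion_def)

section \<open>The transformation \<Theta>\<close>

text \<open>The new poles are the solutions of \<open>f = \<tau>\<close>. They are real and simple
  by the Herglotz property, and lie to the right of \<open>L\<close> because
  \<open>f \<le> f(L) < \<tau>\<close> up to \<open>L\<close>. That places the residues of
  \<open>(\<lambda> - L) * down f / N\<close> on the positive side, and partial fractions give the
  new expansion.\<close>

lemma Theta_Some_generic:
  assumes r: "herglotz_expansion r h0 h H \<delta>" and below: "\<forall>a\<in>H. L < a"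
    and N_def: "N = smult \<tau> (down (Some r)) - up (Some r)" and NL: "poly N L > 0"
  shows "\<exists>g k0 k K \<epsilon>. Theta L \<tau> (Some r) = Some g \<and> herglotz_expansion g k0 k K \<epsilon> \<and>
    down (Some g) = N \<and>
    up (Some g) = smult \<tau> (up (Some r)) - smult (\<tau>\<^sup>2 + L) (down (Some r)) + pCons 0 (down (Some r)) \<and>
    ind (Some g) = ind (Some r) + 1"
proof -
  define D U where "D = down (Some r)" and "U = up (Some r)"
  define v where "v = herglotz_value h0 h H \<delta>"
  have fin: "finite H" and h0: "0 \<le> h0" and pos: "\<forall>a\<in>H. 0 < \<delta> a"
    and r_eq: "r = Fraction_Field.Fract (expansion_numerator h0 h H \<delta>) (pole_poly H)"
    using r by (auto simp: herglotz_expansion_Fract)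
  have c: "down_scale h0 > 0" "down_scale h0 \<noteq> 0" by (simp_all add: down_scale_def)
  have D: "D = smult (down_scale h0) (pole_poly H)" and U: "U = smult (down_scale h0) (expansion_numerator h0 h H \<delta>)"
    unfolding D_def U_def by (rule down_eq[OF r], rule up_eq[OF r])
  have D0: "D \<noteq> 0" using c fin by (simp add: D)
  have N: "N = smult \<tau> D - U" by (simp only: N_def D_def U_def)
  have N0: "N \<noteq> 0" using NL by auto
  have Dx: "poly D x = 0 \<longleftrightarrow> x \<in> H" for x
    using c fin by (auto simp: D poly_pole_poly_eq_0)
  have Nx: "poly N x = poly D x * (\<tau> - v x)" if "x \<notin> H" for x
    using up_eq_down_mult_value[OF r that] by (simp add: N D_def U_def v_def algebra_simps del: down.simps up.simps)
  have L: "L \<notin> H" using below by auto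
  have "poly D L > 0"
    unfolding D using below c by (auto simp: poly_pole_poly intro!: prod_pos mult_pos_pos)
  then have vL: "v L < \<tau>" using NL Nx[OF L] by (simp add: zero_less_mult_iff)
  have root_notin: "x \<notin> H" if "poly N x = 0" for x
  proof
    assume "x \<in> H"
    then have "poly U x \<noteq> 0" using c fin pos
      by (auto simp: U poly_expansion_numerator_pole poly_pole_poly_eq_0)
    moreover have "poly D x = 0" using Dx \<open>x \<in> H\<close> by blast
    ultimately show False using that by (simp add: N)
  qed
  then have root_v: "v x = \<tau>" if "poly N x = 0" for x
    using Nx[of x] Dx[of x] that by auto
  have root_gt: "L < x" if "poly N x = 0" for x
  proof (rule ccontr)
    assume "\<not> L < x"
    then have "v x \<le> v L" unfolding v_def using h0 pos below by (intro herglotz_value_mono) auto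
    then show False using vL root_v[OF that] by simp
  qed
  have slope: "poly D x * poly (pderiv N) x < 0" if x: "poly N x = 0" for x
  proof -
    \<comment> \<open>This is the derivative of \<open>f\<close>. It vanishes only for a constant,
      and a constant cannot take the value \<open>\<tau> > f(L)\<close>. At a zero of
      \<open>N = D * (\<tau> - f)\<close> the derivative of \<open>N\<close> is then
      \<open>- m * D\<close>.\<close>
    define m where "m = h0 + (\<Sum>a\<in>H. \<delta> a / (a - x)\<^sup>2)"
    have "x \<notin> H" using root_notin[OF x] .
    have "m > 0"
    proof (rule ccontr)
      assume "\<not> m > 0"
      moreover have "H \<noteq> {} \<Longrightarrow> (\<Sum>a\<in>H. \<delta> a / (a - x)\<^sup>2) > 0"
        using fin pos \<open>x \<notin> H\<close> by (intro sum_pos) (auto intro!: divide_pos_pos)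
      ultimately have "H = {}" "h0 = 0" using h0 unfolding m_def by (cases "H = {}"; force)+
      then have "v x = v L" by (simp add: v_def herglotz_value_def)
      then show False using vL root_v[OF x] by simp
    qed
    have "(v has_real_derivative m) (at x)"
      unfolding v_def m_def using fin \<open>x \<notin> H\<close> by (rule herglotz_value_deriv)
    then have der: "((\<lambda>x. poly D x * (\<tau> - v x)) has_real_derivative
        poly (pderiv D) x * (\<tau> - v x) + (0 - m) * poly D x) (at x)"
      by (intro derivative_intros poly_DERIV)
    have "open (- H)" using fin by (simp add: finite_imp_closed open_Compl)
    then have ev: "eventually (\<lambda>y. poly D y * (\<tau> - v y) = poly N y) (nhds x)"
      using \<open>x \<notin> H\<close> by (auto simp: eventually_nhds Nx)
    have "(poly N has_real_derivative poly (pderiv D) x * (\<tau> - v x) + (0 - m) * poly D x) (at x)"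
      using der unfolding DERIV_cong_ev[OF refl ev refl] .
    then have "poly (pderiv N) x = - m * poly D x"
      using DERIV_unique[OF poly_DERIV] root_v[OF x] by force
    then have "poly D x * poly (pderiv N) x = - (m * (poly D x)\<^sup>2)" by (simp add: power2_eq_square)
    then show ?thesis using \<open>m > 0\<close> Dx \<open>x \<notin> H\<close> by simp
  qed
  \<comment> \<open>The imaginary part of \<open>f(z)\<close> is \<open>Im z\<close> times a
    non-negative number which is zero only for constant \<open>f\<close>, so a real value \<tau> is
    not taken off the real line.\<close>
  have real_roots: "Im z = 0" if z: "cpoly N z = 0" for z
  proof (rule ccontr)
    assume im: "Im z \<noteq> 0"
    have "cpoly (pole_poly H) z \<noteq> 0"
      unfolding cpoly_pole_poly using fin im by (subst prod_zero_iff) (auto simp: complex_eq_iff)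
    moreover have "cpoly N z = of_real (down_scale h0) * cpoly (pole_poly H) z *
        (of_real \<tau> - (of_real h0 * z + of_real h + (\<Sum>a\<in>H. of_real (\<delta> a) / (of_real a - z))))"
      by (simp add: N D U cpoly_expansion_numerator[OF fin im] algebra_simps)
    ultimately have "of_real \<tau> = of_real h0 * z + of_real h + (\<Sum>a\<in>H. of_real (\<delta> a) / (of_real a - z))"
      using z c by simp
    then have "Im (of_real h0 * z + of_real h + (\<Sum>a\<in>H. of_real (\<delta> a) / (of_real a - z))) = 0"
      by (metis Im_complex_of_real)
    moreover have "Im (of_real (\<delta> a) / (of_real a - z)) = Im z * (\<delta> a / ((a - Re z)\<^sup>2 + (Im z)\<^sup>2))" for a
      by (simp add: Im_divide)
    ultimately have "Im z * (h0 + (\<Sum>a\<in>H. \<delta> a / ((a - Re z)\<^sup>2 + (Im z)\<^sup>2))) = 0"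
      by (simp add: sum_distrib_left distrib_left mult.commute)
    then have *: "h0 + (\<Sum>a\<in>H. \<delta> a / ((a - Re z)\<^sup>2 + (Im z)\<^sup>2)) = 0" using im by simp
    have "H \<noteq> {} \<Longrightarrow> (\<Sum>a\<in>H. \<delta> a / ((a - Re z)\<^sup>2 + (Im z)\<^sup>2)) > 0"
      using fin pos im by (intro sum_pos) (auto intro!: divide_pos_pos add_nonneg_pos)
    then have "H = {}" "h0 = 0" using h0 * by (cases "H = {}"; force)+
    then have "of_real \<tau> = (of_real h :: complex)"
      using \<open>of_real \<tau> = of_real h0 * z + of_real h + _\<close> by simp
    then have "\<tau> = v L" using \<open>H = {}\<close> \<open>h0 = 0\<close> by (simp add: v_def herglotz_value_def)
    then show False using vL by simp
  qed
  define R where "R = {x. poly N x = 0}"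
  define k where "k = lead_coeff N * (-1) ^ degree N"
  have card: "card R = degree N"
    unfolding R_def using real_roots slope by (intro card_real_roots_eq_degree) force+
  have finR: "finite R" unfolding R_def using N0 by (rule poly_roots_finite)
  have Nk: "N = smult k (pole_poly R)"
    unfolding R_def k_def using card N0 by (intro poly_eq_smult_pole_poly) (auto simp: R_def)
  have k0: "k \<noteq> 0" using N0 by (simp add: k_def)
  define d where "d = card H"
  have coD: "coeff D d = down_scale h0 * (-1) ^ d" "\<And>i. i > d \<Longrightarrow> coeff D i = 0"
    unfolding D d_def by (auto simp: lead_coeff_pole_poly coeff_eq_0)
  have coU: "coeff U (Suc d) = down_scale h0 * h0 * (-1) ^ d" "\<And>i. i > Suc d \<Longrightarrow> coeff U i = 0"
    unfolding U d_def expansion_numerator_def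
    using fin by (auto simp: lead_coeff_pole_poly coeff_eq_0 coeff_pole_sum_top coeff_pCons split: nat.splits)
  \<comment> \<open>The first term \<open>(L - \<lambda>) / (f - \<tau>)\<close> of \<Theta> equals
    \<open>E / N\<close>.\<close>
  define E where "E = [:- L, 1:] * D"
  have coE: "coeff E (Suc i) = coeff D i - L * coeff D (Suc i)" for i
    unfolding E_def by simp
  have degE: "degree E \<le> Suc d"
    unfolding E_def using D by (intro order.trans[OF degree_mult_le]) (auto simp: d_def)
  define s1 where "s1 = coeff E (Suc (card R)) / lead_coeff N"
  \<comment> \<open>The equality \<open>k = down_scale s1\<close> makes \<open>N\<close> itself the
    new \<open>down\<close>, without rescaling. If \<open>h0 > 0\<close>, there is one more pole and
    the slope disappears; if \<open>h0 = 0\<close>, the number of poles stays and the slope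
    \<open>1 / (\<tau> - h)\<close> appears. Either way the index grows by one.\<close>
  have key: "k = down_scale s1 \<and> s1 \<ge> 0 \<and> 2 * int (card R) + (if s1 > 0 then 1 else 0)
      = 2 * int d + (if h0 > 0 then 1 else 0) + 1 \<and> d \<le> card R"
  proof (cases "h0 > 0")
    case True
    have top: "coeff N (Suc d) = - ((-1) ^ d)"
      unfolding N using coD(2) coU(1) True by (simp add: down_scale_def)
    moreover have "coeff N i = 0" if "i > Suc d" for i
      unfolding N using coD(2) coU(2) that by simp
    ultimately have deg: "degree N = Suc d"
      by (intro antisym degree_le le_degree) auto
    have "s1 = 0" unfolding s1_def card deg coE using coD by simp
    moreover have "k = 1" unfolding k_def deg top by (simp flip: power_add mult_2)
    ultimately show ?thesis using card deg True by (simp add: down_scale_def)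
  next
    case False
    then have "h0 = 0" using h0 by simp
    have "coeff U d = h * (-1) ^ d"
      unfolding U d_def expansion_numerator_def \<open>h0 = 0\<close>
      using fin by (simp add: lead_coeff_pole_poly coeff_pole_sum_top down_scale_def)
    then have top: "coeff N d = (\<tau> - h) * (-1) ^ d"
      unfolding N using coD(1) \<open>h0 = 0\<close> by (simp add: down_scale_def algebra_simps)
    \<comment> \<open>For \<open>h0 = 0\<close> and \<open>L\<close> below the poles,
      \<open>f(L)\<close> is at least the constant term \<open>h\<close>; so
      \<open>\<tau> > h\<close>, and \<open>N\<close> keeps the degree of \<open>D\<close>.\<close>
    have "(\<Sum>a\<in>H. \<delta> a / (a - L)) \<ge> 0"
      using pos below by (intro sum_nonneg divide_nonneg_nonneg) (auto simp: less_imp_le)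
    then have gt: "\<tau> > h" using vL \<open>h0 = 0\<close> by (simp add: v_def herglotz_value_def)
    have "coeff N i = 0" if "i > d" for i
    proof (cases "i = Suc d")
      case True
      then show ?thesis unfolding N using coD(2) coU(1) \<open>h0 = 0\<close> by simp
    next
      case False
      then show ?thesis unfolding N using coD(2) coU(2) that by simp
    qed
    then have deg: "degree N = d" using top gt
      by (intro antisym degree_le le_degree) auto
    have "s1 = 1 / (\<tau> - h)" unfolding s1_def card deg coE top using coD \<open>h0 = 0\<close> by (simp add: down_scale_def)
    moreover have "k = \<tau> - h" unfolding k_def deg top by (simp flip: power_add mult_2)
    ultimately show ?thesis using card deg gt \<open>h0 = 0\<close> by (simp add: down_scale_def)
  qed
  define \<epsilon> where "\<epsilon> a = - poly E a / poly (pderiv N) a" for a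
  have \<epsilon>: "\<epsilon> a * poly (pderiv N) a = - poly E a" "\<epsilon> a > 0" if "a \<in> R" for a
  proof -
    have a: "poly N a = 0" using that by (simp add: R_def)
    have *: "poly D a * poly (pderiv N) a < 0" "L < a" using slope[OF a] root_gt[OF a] .
    then show "\<epsilon> a * poly (pderiv N) a = - poly E a" by (auto simp: \<epsilon>_def)
    have "poly (pderiv N) a \<noteq> 0" using *(1) by auto
    \<comment> \<open>The form in which the sign is visible: \<open>a > L\<close>, and
      \<open>D\<close> and the derivative of \<open>N\<close> have opposite signs at
      \<open>a\<close>.\<close>
    then have "\<epsilon> a = (a - L) * (- (poly D a * poly (pderiv N) a)) / (poly (pderiv N) a)\<^sup>2"
      unfolding \<epsilon>_def E_def by (simp add: power2_eq_square field_simps)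
    also have "\<dots> > 0" using * by (intro divide_pos_pos mult_pos_pos) auto
    finally show "\<epsilon> a > 0" .
  qed
  obtain s0 where s0: "E = N * [:s0, s1:] + smult k (pole_sum R \<epsilon>)"
    using partial_fractions[OF Nk k0 finR _ \<epsilon>(1)] degE key unfolding s1_def by fastforce
  define g where "g = Fraction_Field.Fract (E - smult \<tau> N) N"
  have exp_g: "expansion_numerator s1 (s0 - \<tau>) R \<epsilon> * N = (E - smult \<tau> N) * pole_poly R"
  proof -
    show ?thesis
      unfolding s0 expansion_numerator_def Nk
      by (simp add: fun_eq_iff algebra_simps flip: poly_eq_poly_eq_iff)
  qed
  then have g: "herglotz_expansion g s1 (s0 - \<tau>) R \<epsilon>"
    unfolding herglotz_expansion_Fract g_def
    using key finR \<epsilon>(2) N0 by (simp add: eq_fract)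
  have r_frac: "r = Fraction_Field.Fract U D"
    unfolding r_eq using D0 c fin by (simp add: eq_fract D U)
  have diff: "r - pfract [:\<tau>:] = Fraction_Field.Fract (- N) D"
    unfolding r_frac using D0 by (simp add: N)
  then have ne: "r \<noteq> pfract [:\<tau>:]" using N0 D0 by (auto simp: Zero_fract_def eq_fract)
  have "Theta L \<tau> (Some r) = Some (pfract [:L, -1:] / Fraction_Field.Fract (- N) D - pfract [:\<tau>:])"
    using ne by (simp add: diff)
  also have "pfract [:L, -1:] / Fraction_Field.Fract (- N) D - pfract [:\<tau>:] = g"
    using D0 N0 by (simp add: g_def eq_fract E_def) (simp add: fun_eq_iff algebra_simps flip: poly_eq_poly_eq_iff)
  finally have "Theta L \<tau> (Some r) = Some g" .
  moreover have down_g: "down (Some g) = N"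
    unfolding down_eq[OF g] using Nk key by simp
  moreover have "up (Some g) = E - smult \<tau> N"
    unfolding up.simps down_g unfolding g_def
    by (rule the_equality) (use N0 in \<open>auto simp: eq_fract\<close>)
  then have "up (Some g) = smult \<tau> U - smult (\<tau>\<^sup>2 + L) D + pCons 0 D"
    unfolding E_def N by (simp add: smult_diff_right smult_add_left power2_eq_square)
  moreover have "ind (Some g) = ind (Some r) + 1"
    unfolding ind_eq[OF g] ind_eq[OF r] using key by (simp add: d_def)
  ultimately show ?thesis using g unfolding D_def U_def by blast
qed

text \<open>The sign condition is \<open>\<tau> > f(L)\<close> cleared of denominators. In this form
  it covers \<open>f = None\<close> as well, where it reads \<open>1 > 0\<close> and the same
  formulas for \<open>down\<close> and \<open>up\<close> hold.\<close>

lemma Theta_generic: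
  assumes "f \<in> herglotz" "below_poles f L" "\<tau> * poly (down f) L - poly (up f) L > 0"
  shows "Theta L \<tau> f \<in> herglotz"
    and "down (Theta L \<tau> f) = smult \<tau> (down f) - up f"
    and "up (Theta L \<tau> f) = smult \<tau> (up f) - smult (\<tau>\<^sup>2 + L) (down f) + pCons 0 (down f)"
    and "ind (Theta L \<tau> f) = ind f + 1"
proof -
  have "Theta L \<tau> f \<in> herglotz \<and> down (Theta L \<tau> f) = smult \<tau> (down f) - up f \<and>
    up (Theta L \<tau> f) = smult \<tau> (up f) - smult (\<tau>\<^sup>2 + L) (down f) + pCons 0 (down f) \<and>
    ind (Theta L \<tau> f) = ind f + 1"
  proof (cases f)
    case None
    have e: "herglotz_expansion (pfract [:- \<tau>:]) 0 (- \<tau>) {} (\<lambda>_. 1)" by (rule herglotz_constant)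
    have "Some (pfract [:- \<tau>:]) \<in> herglotz" using e by (auto simp: Some_in_herglotz_iff)
    moreover have "down (Some (pfract [:- \<tau>:])) = 1" "up (Some (pfract [:- \<tau>:])) = [:- \<tau>:]"
      unfolding down_eq[OF e] up_eq[OF e]
      by (simp_all add: pole_poly_def down_scale_def expansion_numerator_def pole_sum_def)
    moreover have "ind (Some (pfract [:- \<tau>:])) = 0" unfolding ind_eq[OF e] by simp
    moreover have "smult \<tau> (- 1) = [:- \<tau>:]" by (simp add: one_pCons)
    ultimately show ?thesis unfolding None Theta.simps by (simp del: ind.simps(2) down.simps(2) up.simps(2))
  next
    case (Some r)
    then obtain h0 h H \<delta> where r: "herglotz_expansion r h0 h H \<delta>"
      using assms by (auto simp: Some_in_herglotz_iff)
    have "\<forall>a\<in>H. L < a" using assms(2) Some poles_eq[OF r] by (auto simp: below_poles_def)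
    moreover have "poly (smult \<tau> (down (Some r)) - up (Some r)) L > 0"
      using assms(3) Some by (simp del: down.simps up.simps)
    ultimately show ?thesis
      using Theta_Some_generic[OF r _ refl] Some by (metis Some_in_herglotz_iff)
  qed
  then show "Theta L \<tau> f \<in> herglotz"
    and "down (Theta L \<tau> f) = smult \<tau> (down f) - up f"
    and "up (Theta L \<tau> f) = smult \<tau> (up f) - smult (\<tau>\<^sup>2 + L) (down f) + pCons 0 (down f)"
    and "ind (Theta L \<tau> f) = ind f + 1"
    by blast+
qed

section \<open>Mean values and integration by parts\<close>

lemma increment_within:
  fixes f :: "real \<Rightarrow> real"
  assumes f: "\<And>x. x \<in> {0..b} \<Longrightarrow> (f has_real_derivative f' x) (at x within {0..b})"
    and "0 \<le> c" "c < d" "d \<le> b"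
  obtains x where "c < x" "x < d" "f d - f c = (d - c) * f' x"
proof -
  have "(f has_real_derivative f' x) (at x)" if "c < x" "x < d" for x
    using f[of x] assms(2-4) that by (simp add: at_within_Icc_at)
  moreover have "continuous_on {c..d} f"
  proof (rule continuous_on_subset)
    show "continuous_on {0..b} f" using f by (rule DERIV_continuous_on)
  qed (use assms(2-4) in auto)
  ultimately obtain x where "c < x" "x < d" "f d - f c = (d - c) * f' x"
    using MVT[OF \<open>c < d\<close>, of f] DERIV_unique real_differentiable_def by metis
  then show thesis by (rule that)
qed

lemma absolutely_integrable_mult_continuous:
  fixes p g :: "real \<Rightarrow> 'a::{real_normed_field,euclidean_space}"
  assumes "p absolutely_integrable_on {a..c}" "continuous_on {a..c} g"
  shows "(\<lambda>t. p t * g t) absolutely_integrable_on {a..c}"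
proof -
  have "(\<lambda>t. g t * p t) absolutely_integrable_on {a..c}"
    by (rule absolutely_integrable_bounded_measurable_product
        [OF bilinear_times continuous_imp_measurable_on_sets_lebesgue _ _ assms(1)])
       (use assms(2) in \<open>auto intro!: compact_imp_bounded compact_continuous_image\<close>)
  then show ?thesis by (simp add: mult.commute)
qed

lemma product_remainder_estimate:
  fixes p y :: "real \<Rightarrow> 'a::{real_normed_field,euclidean_space}"
  assumes p: "p absolutely_integrable_on {a..c}" and y: "continuous_on {a..c} y"
    and C: "\<And>t. t \<in> {a..c} \<Longrightarrow> norm (y t - z) \<le> C"
  shows "norm (integral {a..c} (\<lambda>t. p t * y t) - integral {a..c} p * z) \<le>
      C * integral {a..c} (\<lambda>t. norm (p t))"
proof -
  have yz: "continuous_on {a..c} (\<lambda>t. y t - z)" using y by (intro continuous_intros)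
  have int: "p integrable_on {a..c}" "(\<lambda>t. p t * y t) integrable_on {a..c}"
    "(\<lambda>t. norm (p t)) integrable_on {a..c}" "(\<lambda>t. p t * (y t - z)) integrable_on {a..c}"
    using p absolutely_integrable_mult_continuous[OF p y] absolutely_integrable_mult_continuous[OF p yz]
    unfolding absolutely_integrable_on_def by blast+
  have "((\<lambda>t. p t * y t - p t * z) has_integral
      integral {a..c} (\<lambda>t. p t * y t) - integral {a..c} p * z) {a..c}"
    using int(1,2) by (intro has_integral_diff has_integral_mult_left integrable_integral)
  then have eq: "integral {a..c} (\<lambda>t. p t * y t) - integral {a..c} p * z = integral {a..c} (\<lambda>t. p t * (y t - z))"
    unfolding right_diff_distrib by (rule integral_unique[symmetric])
  have "norm (integral {a..c} (\<lambda>t. p t * (y t - z))) \<le> integral {a..c} (\<lambda>t. C * norm (p t))"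
  proof (rule integral_norm_bound_integral)
    show "(\<lambda>t. C * norm (p t)) integrable_on {a..c}" using int(3) by (rule integrable_on_mult_right)
    show "norm (p t * (y t - z)) \<le> C * norm (p t)" if "t \<in> {a..c}" for t
      unfolding norm_mult mult.commute[of C]
      using C[OF that] norm_ge_zero by (rule mult_left_mono)
  qed (rule int)
  then show ?thesis unfolding eq by (simp only: integral_mult_right)
qed

text \<open>
  Integration by parts: \<open>p\<close> is only integrable, but replacing the differentiable factor by a constant
  on an interval costs the length of the interval times the integral of \<open>\<bar>p\<bar>\<close> over it.
\<close>

lemma indefinite_integral_product:
  fixes p y :: "real \<Rightarrow> 'a::{real_normed_field,euclidean_space}"
  assumes p: "p absolutely_integrable_on {0..b}"
    and y: "\<And>x. x \<in> {0..b} \<Longrightarrow> (y has_vector_derivative y' x) (at x within {0..b})"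
    and y': "continuous_on {0..b} y'" and x: "x \<in> {0..b}"
  shows "((\<lambda>x. integral {0..x} p * y x - integral {0..x} (\<lambda>t. p t * y t))
    has_vector_derivative (integral {0..x} p * y' x)) (at x within {0..b})"
proof -
  let ?P = "\<lambda>x. integral {0..x} p" and ?V = "\<lambda>x. integral {0..x} (\<lambda>t. norm (p t))"
    and ?G = "\<lambda>x. integral {0..x} (\<lambda>t. p t * y t)"
  have cont_y: "continuous_on {0..b} y" using y by (rule continuous_on_vector_derivative)
  have py: "(\<lambda>t. p t * y t) absolutely_integrable_on {0..b}"
    using p cont_y by (rule absolutely_integrable_mult_continuous)
  have int: "p integrable_on {0..b}" "(\<lambda>t. p t * y t) integrable_on {0..b}"
    "(\<lambda>t. norm (p t)) integrable_on {0..b}"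
    using p py by (auto simp: absolutely_integrable_on_def)
  have "bounded (y' ` {0..b})"
    using y' by (intro compact_imp_bounded compact_continuous_image) auto
  then obtain C where "\<forall>v\<in>y' ` {0..b}. norm v \<le> C" unfolding bounded_iff by blast
  then have C: "\<And>x. x \<in> {0..b} \<Longrightarrow> norm (y' x) \<le> C" by blast
  have C0: "C \<ge> 0" using C[OF x] norm_ge_zero[of "y' x"] by linarith
  have lip: "norm (y t - y s) \<le> C * \<bar>t - s\<bar>" if "s \<in> {0..b}" "t \<in> {0..b}" for s t
  proof -
    have "onorm (\<lambda>h. h *\<^sub>R y' x) \<le> C" if "x \<in> {0..b}" for x
    proof (rule onorm_le)
      show "norm (h *\<^sub>R y' x) \<le> C * norm h" for h
        unfolding norm_scaleR mult.commute[of C] real_norm_def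
        using C[OF that] abs_ge_zero by (rule mult_left_mono)
    qed
    then show ?thesis
      using differentiable_bound[of "{0..b}" y "\<lambda>x h. h *\<^sub>R y' x" C t s] y that
      by (simp add: has_vector_derivative_def)
  qed
  have diff: "integral {0..d} g - integral {0..c} g = integral {c..d} g"
    if "g integrable_on {0..b}" "0 \<le> c" "c \<le> d" "d \<le> b" for c d and g :: "real \<Rightarrow> 'b::euclidean_space"
  proof -
    have "g integrable_on {0..d}" using that by (intro integrable_subinterval_real[OF that(1)]) auto
    from Henstock_Kurzweil_Integration.integral_combine[OF that(2,3) this] show ?thesis by (simp add: algebra_simps)
  qed
  \<comment> \<open>On \<open>[c, d]\<close> the function \<open>y\<close> differs from
    \<open>y s\<close> by at most \<open>C * (d - c)\<close>.\<close>
  have est: "norm (?G d - ?G c - (?P d - ?P c) * y s) \<le> C * (d - c) * (?V d - ?V c)"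
    if "0 \<le> c" "c \<le> d" "d \<le> b" "s \<in> {c..d}" for c d s
  proof -
    have "norm (y t - y s) \<le> C * (d - c)" if "t \<in> {c..d}" for t
    proof -
      have "norm (y t - y s) \<le> C * \<bar>t - s\<bar>" using lip[of s t] that \<open>0 \<le> c\<close> \<open>d \<le> b\<close> \<open>s \<in> {c..d}\<close> by auto
      also have "\<dots> \<le> C * (d - c)" using that \<open>s \<in> {c..d}\<close> C0 by (intro mult_left_mono) auto
      finally show ?thesis .
    qed
    moreover have "p absolutely_integrable_on {c..d}"
      using that by (intro absolutely_integrable_on_subinterval[OF p]) auto
    moreover have "continuous_on {c..d} y"
      using that by (intro continuous_on_subset[OF cont_y]) auto
    ultimately have "norm (integral {c..d} (\<lambda>t. p t * y t) - integral {c..d} p * y s) \<le>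
        C * (d - c) * integral {c..d} (\<lambda>t. norm (p t))"
      by (intro product_remainder_estimate)
    then show ?thesis using that by (simp only: diff[OF int(1)] diff[OF int(2)] diff[OF int(3)])
  qed
  \<comment> \<open>What remains of \<open>P y - G\<close> near \<open>x\<close> after removing
    \<open>?P x * y\<close> and a constant. It is bounded by \<open>\<bar>z - x\<bar>\<close> times
    the increment of the continuous function \<open>?V\<close>, hence has derivative 0 at
    \<open>x\<close>.\<close>
  define e where "e z = (?P z - ?P x) * y z - (?G z - ?G x)" for z
  have e: "norm (e z) \<le> \<bar>z - x\<bar> * (C * \<bar>?V z - ?V x\<bar>)" if z: "z \<in> {0..b}" for z
  proof (cases "x \<le> z")
    case True
    then have "norm (e z) \<le> C * (z - x) * (?V z - ?V x)"
      using est[of x z z] x z by (simp add: e_def norm_minus_commute)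
    also have "\<dots> \<le> C * \<bar>z - x\<bar> * \<bar>?V z - ?V x\<bar>"
      using C0 True by (simp add: mult_left_mono)
    finally show ?thesis by (simp only: mult_ac)
  next
    case False
    have "e z = ?G x - ?G z - (?P x - ?P z) * y z" by (simp add: e_def algebra_simps)
    then have "norm (e z) \<le> C * (x - z) * (?V x - ?V z)"
      using est[of z x z] x z False by simp
    also have "\<dots> \<le> C * \<bar>z - x\<bar> * \<bar>?V z - ?V x\<bar>"
      using C0 False by (simp add: mult_left_mono abs_minus_commute)
    finally show ?thesis by (simp only: mult_ac)
  qed
  have "(e has_vector_derivative 0) (at x within {0..b})"
    unfolding has_vector_derivative_def has_derivative_within
  proof (intro conjI)
    have "(?V \<longlongrightarrow> ?V x) (at x within {0..b})"
      using indefinite_integral_continuous_1[OF int(3)] x by (simp add: continuous_on)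
    then have "((\<lambda>z. C * \<bar>?V z - ?V x\<bar>) \<longlongrightarrow> C * \<bar>?V x - ?V x\<bar>) (at x within {0..b})"
      by (intro tendsto_intros)
    then have lim: "((\<lambda>z. C * \<bar>?V z - ?V x\<bar>) \<longlongrightarrow> 0) (at x within {0..b})" by simp
    show "((\<lambda>z. (1 / norm (z - x)) *\<^sub>R (e z - (e x + (z - x) *\<^sub>R 0))) \<longlongrightarrow> 0) (at x within {0..b})"
    proof (rule Lim_null_comparison[OF _ lim])
      have "norm ((1 / norm (z - x)) *\<^sub>R (e z - (e x + (z - x) *\<^sub>R 0))) \<le> C * \<bar>?V z - ?V x\<bar>"
        if "z \<in> {0..b}" "z \<noteq> x" for z
      proof -
        have "norm (z - x) > 0" "e x = 0" using that(2) by (simp_all add: e_def)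
        then show ?thesis using e[OF that(1)] by (simp add: divide_le_eq mult.commute)
      qed
      then show "\<forall>\<^sub>F z in at x within {0..b}.
          norm ((1 / norm (z - x)) *\<^sub>R (e z - (e x + (z - x) *\<^sub>R 0))) \<le> C * \<bar>?V z - ?V x\<bar>"
        unfolding eventually_at_filter by (intro always_eventually) blast
    qed
  qed (rule bounded_linear_scaleR_left)
  moreover have "((\<lambda>z. ?P x * y z) has_vector_derivative ?P x * y' x) (at x within {0..b})"
    using y[OF x] by (rule has_vector_derivative_mult_right)
  ultimately have "((\<lambda>z. e z + ?P x * y z + (- ?G x)) has_vector_derivative 0 + ?P x * y' x + 0)
      (at x within {0..b})"
    by (intro has_vector_derivative_add has_vector_derivative_const)
  moreover have "e z + ?P x * y z + (- ?G x) = ?P z * y z - ?G z" for z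
    by (simp add: e_def algebra_simps)
  ultimately show ?thesis by (simp only: add_0_left add_0_right)
qed

section \<open>Regularisation of the Sturm--Liouville equation\<close>

abbreviation potential :: "(real \<Rightarrow> real) \<Rightarrow> real \<Rightarrow> real" where
  "potential q x \<equiv> integral {0..x} q"

lemma zero_derivative_constant:
  fixes f :: "real \<Rightarrow> 'a::real_normed_vector"
  assumes "\<And>x. x \<in> {0..b} \<Longrightarrow> (f has_vector_derivative 0) (at x within {0..b})" "x \<in> {0..b}"
  shows "f x = f 0"
  using has_derivative_zero_unique[of "{0..b}" f x 0] assms
  by (auto simp: has_vector_derivative_def)

text \<open>
  With \<open>Q\<close> an antiderivative of \<open>q\<close>, the function \<open>y' - Q y\<close> is continuously differentiable, so the
  equation becomes a linear system with continuous coefficients.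
\<close>

lemma solution_iff:
  fixes y y' :: "real \<Rightarrow> 'a::{real_normed_field,euclidean_space}"
  assumes q: "q absolutely_integrable_on {0..pi}"
  shows "solution q l y y' \<longleftrightarrow>
    (\<forall>x\<in>{0..pi}. (y has_vector_derivative y' x) (at x within {0..pi})) \<and>
    (\<forall>x\<in>{0..pi}. ((\<lambda>x. y' x - of_real (potential q x) * y x) has_vector_derivative
      - (l * y x) - of_real (potential q x) * y' x) (at x within {0..pi}))"
    (is "_ \<longleftrightarrow> ?D \<and> ?R")
proof -
  let ?Q = "\<lambda>x. of_real (potential q x) :: 'a" and ?p = "\<lambda>x. of_real (q x) :: 'a"
  have p: "?p absolutely_integrable_on {0..pi}"
    using absolutely_integrable_linear[OF q bounded_linear_of_real] by (simp add: o_def)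
  have qi: "q integrable_on {0..pi}" using q by (simp add: absolutely_integrable_on_def)
  have P: "integral {0..x} ?p = ?Q x" if "x \<in> {0..pi}" for x
  proof -
    have "q integrable_on {0..x}" using that by (intro integrable_subinterval_real[OF qi]) auto
    from integral_linear[OF this bounded_linear_of_real] show ?thesis by (simp add: o_def)
  qed
  have Qcont: "continuous_on {0..pi} ?Q"
    using indefinite_integral_continuous_1[OF qi] by (intro continuous_intros)
  define z where "z x = integral {0..x} (\<lambda>t. (?p t - l) * y t)" for x
  \<comment> \<open>The derivative of \<open>z - Q y\<close> is computed without the equation, from
    continuity of \<open>y'\<close> alone. Both directions then compare \<open>z - Q y\<close> with
    \<open>y' - Q y\<close>.\<close>
  have main: "(\<lambda>t. (?p t - l) * y t) absolutely_integrable_on {0..pi} \<and>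
    (\<forall>x\<in>{0..pi}. ((\<lambda>x. z x - ?Q x * y x) has_vector_derivative
      - (l * y x) - ?Q x * y' x) (at x within {0..pi}))"
    if y: ?D and y': "continuous_on {0..pi} y'"
  proof
    have cont_y: "continuous_on {0..pi} y" using y by (intro continuous_on_vector_derivative) auto
    have py: "(\<lambda>t. ?p t * y t) absolutely_integrable_on {0..pi}"
      using p cont_y by (rule absolutely_integrable_mult_continuous)
    have ly: "(\<lambda>t. l * y t) absolutely_integrable_on {0..pi}"
      using cont_y by (intro absolutely_integrable_continuous_real continuous_intros)
    show ai: "(\<lambda>t. (?p t - l) * y t) absolutely_integrable_on {0..pi}"
      using set_integral_diff(1)[OF py ly] by (simp add: left_diff_distrib)
    show "\<forall>x\<in>{0..pi}. ((\<lambda>x. z x - ?Q x * y x) has_vector_derivative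
      - (l * y x) - ?Q x * y' x) (at x within {0..pi})"
    proof
      fix x assume x: "x \<in> {0..pi}"
      have "((\<lambda>x. integral {0..x} ?p * y x - integral {0..x} (\<lambda>t. ?p t * y t))
          has_vector_derivative (integral {0..x} ?p * y' x)) (at x within {0..pi})"
        using y by (intro indefinite_integral_product[OF p _ y' x]) auto
      moreover have "((\<lambda>x. integral {0..x} (\<lambda>t. l * y t)) has_vector_derivative l * y x) (at x within {0..pi})"
        using cont_y x by (intro integral_has_vector_derivative continuous_intros)
      ultimately have "((\<lambda>x. - (integral {0..x} ?p * y x - integral {0..x} (\<lambda>t. ?p t * y t))
          - integral {0..x} (\<lambda>t. l * y t)) has_vector_derivative
          - (integral {0..x} ?p * y' x) - l * y x) (at x within {0..pi})"
        by (intro derivative_intros)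
      moreover have "z t - ?Q t * y t = - (integral {0..t} ?p * y t - integral {0..t} (\<lambda>t. ?p t * y t))
          - integral {0..t} (\<lambda>t. l * y t)" if "t \<in> {0..pi}" for t
      proof -
        have "(\<lambda>t. ?p t * y t) integrable_on {0..t}" "(\<lambda>t. l * y t) integrable_on {0..t}"
          using that py ly by (auto simp: absolutely_integrable_on_def intro: integrable_subinterval_real)
        then show ?thesis unfolding z_def P[OF that] by (simp add: left_diff_distrib integral_diff)
      qed
      ultimately have "((\<lambda>x. z x - ?Q x * y x) has_vector_derivative
          - (integral {0..x} ?p * y' x) - l * y x) (at x within {0..pi})"
        using x by (elim has_vector_derivative_transform[rotated 2]) auto
      moreover have "- (integral {0..x} ?p * y' x) - l * y x = - (l * y x) - ?Q x * y' x"
        unfolding P[OF x] by (simp only: diff_conv_add_uminus add.commute)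
      ultimately show "((\<lambda>x. z x - ?Q x * y x) has_vector_derivative
          - (l * y x) - ?Q x * y' x) (at x within {0..pi})"
        by (simp only:)
    qed
  qed
  show ?thesis
  proof
    assume s: "solution q l y y'"
    then have y: ?D and ai: "(\<lambda>t. (?p t - l) * y t) absolutely_integrable_on {0..pi}"
      and y'_eq: "\<And>x. x \<in> {0..pi} \<Longrightarrow> y' x = y' 0 + z x"
      unfolding solution_def abs_cont_deriv_def z_def by blast+
    have "(\<lambda>t. (?p t - l) * y t) integrable_on {0..pi}" using ai by (simp add: absolutely_integrable_on_def)
    then have "continuous_on {0..pi} (\<lambda>x. y' 0 + z x)"
      unfolding z_def by (intro continuous_intros indefinite_integral_continuous_1)
    then have "continuous_on {0..pi} y'" by (rule continuous_on_eq) (rule y'_eq[symmetric])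
    then have M: "((\<lambda>x. z x - ?Q x * y x) has_vector_derivative
        - (l * y x) - ?Q x * y' x) (at x within {0..pi})" if "x \<in> {0..pi}" for x
      using main[OF y] that by blast
    have "((\<lambda>x. y' x - ?Q x * y x) has_vector_derivative
        - (l * y x) - ?Q x * y' x) (at x within {0..pi})" if x: "x \<in> {0..pi}" for x
    proof (rule has_vector_derivative_transform[OF x])
      show "y' t - ?Q t * y t = y' 0 + (z t - ?Q t * y t)" if "t \<in> {0..pi}" for t
        unfolding y'_eq[OF that] by simp
      show "((\<lambda>t. y' 0 + (z t - ?Q t * y t)) has_vector_derivative
          - (l * y x) - ?Q x * y' x) (at x within {0..pi})"
        using has_vector_derivative_add[OF has_vector_derivative_const M[OF x]] by simp
    qed
    then show "?D \<and> ?R" using y by blast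
  next
    assume "?D \<and> ?R"
    then have y: ?D and R: ?R by auto
    have "continuous_on {0..pi} (\<lambda>x. y' x - ?Q x * y x)"
      using R by (intro continuous_on_vector_derivative) auto
    moreover have "continuous_on {0..pi} (\<lambda>x. ?Q x * y x)"
      using y by (intro continuous_on_mult[OF Qcont] continuous_on_vector_derivative) auto
    ultimately have "continuous_on {0..pi} (\<lambda>x. (y' x - ?Q x * y x) + ?Q x * y x)"
      by (intro continuous_on_add)
    then have y': "continuous_on {0..pi} y'" by simp
    have "y' x = y' 0 + z x" if "x \<in> {0..pi}" for x
    proof -
      have "((\<lambda>x. (y' x - ?Q x * y x) - (z x - ?Q x * y x)) has_vector_derivative 0) (at x within {0..pi})"
        if x: "x \<in> {0..pi}" for x
        using has_vector_derivative_diff[OF bspec[OF R x] bspec[OF conjunct2[OF main[OF y y']] x]] by simp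
      from zero_derivative_constant[OF this that] have "y' x - z x = y' 0 - z 0" by simp
      moreover have "z 0 = 0" by (simp add: z_def)
      ultimately show ?thesis by (simp only: diff_eq_eq diff_zero)
    qed
    then show "solution q l y y'"
      using y main[OF y y'] unfolding solution_def abs_cont_deriv_def z_def by blast
  qed
qed

section \<open>Linear systems with continuous coefficients\<close>

text \<open>Not the Picard iterates but their successive differences, the terms of the Neumann
  series; the solution is their sum.\<close>

primrec picard :: "(real \<Rightarrow> real) \<Rightarrow> (real \<Rightarrow> real) \<Rightarrow> (real \<Rightarrow> real) \<Rightarrow> (real \<Rightarrow> real) \<Rightarrow>
    real \<Rightarrow> real \<Rightarrow> nat \<Rightarrow> (real \<Rightarrow> real) \<times> (real \<Rightarrow> real)" where
  "picard a b c d y0 w0 0 = ((\<lambda>x. y0), (\<lambda>x. w0))"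
| "picard a b c d y0 w0 (Suc n) =
    ((\<lambda>x. integral {0..x} (\<lambda>t. a t * fst (picard a b c d y0 w0 n) t + b t * snd (picard a b c d y0 w0 n) t)),
     (\<lambda>x. integral {0..x} (\<lambda>t. c t * fst (picard a b c d y0 w0 n) t + d t * snd (picard a b c d y0 w0 n) t)))"

text \<open>The bound on the integrand is the exact derivative of the next majorant
  \<open>B * (L * t) ^ Suc n / fact (Suc n)\<close>.\<close>

lemma picard_step_bound:
  fixes g :: "real \<Rightarrow> real"
  assumes "continuous_on {0..r} g" and g: "\<And>t. t \<in> {0..r} \<Longrightarrow> \<bar>g t\<bar> \<le> L * (B * (L * t) ^ n / fact n)"
    and x: "x \<in> {0..r}"
  shows "\<bar>integral {0..x} g\<bar> \<le> B * (L * x) ^ Suc n / fact (Suc n)"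
proof -
  have sub: "{0..x} \<subseteq> {0..r}" using x by auto
  have der: "((\<lambda>t. B * (L * t) ^ Suc n / fact (Suc n)) has_real_derivative L * (B * (L * t) ^ n / fact n))
      (at t within {0..x})" for t
  proof -
    have "((\<lambda>t. B * (L * t) ^ Suc n / fact (Suc n)) has_real_derivative
        B * (real (Suc n) * (L * t) ^ n * L) / fact (Suc n)) (at t within {0..x})"
      by (auto intro!: derivative_eq_intros simp del: power_Suc fact_Suc)
    moreover have "B * (real (Suc n) * (L * t) ^ n * L) / fact (Suc n) = L * (B * (L * t) ^ n / fact n)"
      by (simp add: field_simps del: of_nat_Suc)
    ultimately show ?thesis by (simp only:)
  qed
  have "((\<lambda>t. L * (B * (L * t) ^ n / fact n)) has_integral
      (B * (L * x) ^ Suc n / fact (Suc n) - B * (L * 0) ^ Suc n / fact (Suc n))) {0..x}"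
    using x der by (intro fundamental_theorem_of_calculus)
      (simp_all add: has_real_derivative_iff_has_vector_derivative[symmetric] del: power_Suc fact_Suc)
  then have int: "((\<lambda>t. L * (B * (L * t) ^ n / fact n)) has_integral (B * (L * x) ^ Suc n / fact (Suc n))) {0..x}"
    by simp
  have "norm (integral {0..x} g) \<le> integral {0..x} (\<lambda>t. L * (B * (L * t) ^ n / fact n))"
  proof (rule integral_norm_bound_integral)
    show "g integrable_on {0..x}"
      using assms(1) sub by (intro integrable_continuous_real) (rule continuous_on_subset)
    show "(\<lambda>t. L * (B * (L * t) ^ n / fact n)) integrable_on {0..x}" using int by (rule has_integral_integrable)
    show "norm (g t) \<le> L * (B * (L * t) ^ n / fact n)" if "t \<in> {0..x}" for t
      using g[of t] that sub by auto
  qed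
  then show ?thesis using integral_unique[OF int] by simp
qed

text \<open>Factorial bounds make the series and its termwise derivatives converge uniformly on the
  whole interval, whatever its length, so the solution is obtained globally in one go.\<close>

lemma linear_system_exists:
  fixes a b c d :: "real \<Rightarrow> real"
  assumes r: "0 \<le> r" and cont: "continuous_on {0..r} a" "continuous_on {0..r} b"
    "continuous_on {0..r} c" "continuous_on {0..r} d"
  shows "\<exists>y w. y 0 = y0 \<and> w 0 = w0 \<and> (\<forall>x\<in>{0..r}.
      (y has_real_derivative a x * y x + b x * w x) (at x within {0..r}) \<and>
      (w has_real_derivative c x * y x + d x * w x) (at x within {0..r}))"
proof -
  define u v where "u n = fst (picard a b c d y0 w0 n)" and "v n = snd (picard a b c d y0 w0 n)" for n
  \<comment> \<open>The derivatives of the terms: 0 for the constant first term, then the right-hand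
    side at the previous term. Because of this shift by one, summing them reproduces the
    system.\<close>
  define ud where "ud n = (case n of 0 \<Rightarrow> (\<lambda>x. 0) | Suc n \<Rightarrow> (\<lambda>x. a x * u n x + b x * v n x))" for n
  define vd where "vd n = (case n of 0 \<Rightarrow> (\<lambda>x. 0) | Suc n \<Rightarrow> (\<lambda>x. c x * u n x + d x * v n x))" for n
  have u0: "u 0 = (\<lambda>x. y0)" "v 0 = (\<lambda>x. w0)" by (simp_all add: u_def v_def)
  have uS: "u (Suc n) = (\<lambda>x. integral {0..x} (ud (Suc n)))" "v (Suc n) = (\<lambda>x. integral {0..x} (vd (Suc n)))" for n
    by (simp_all add: u_def v_def ud_def vd_def)
  have comb_cont: "continuous_on {0..r} (\<lambda>x. p x * g x + s x * h x)"
    if "continuous_on {0..r} p" "continuous_on {0..r} s" "continuous_on {0..r} g" "continuous_on {0..r} h"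
    for p s g h :: "real \<Rightarrow> real"
    using that by (intro continuous_on_add continuous_on_mult)
  have contuv: "continuous_on {0..r} (u n) \<and> continuous_on {0..r} (v n)" for n
  proof (induction n)
    case 0
    show ?case unfolding u0 by (intro conjI continuous_on_const)
  next
    case (Suc n)
    then have "continuous_on {0..r} (ud (Suc n))" "continuous_on {0..r} (vd (Suc n))"
      unfolding ud_def vd_def nat.case using comb_cont cont by blast+
    then show ?case unfolding uS
      by (intro conjI indefinite_integral_continuous_1 integrable_continuous_real)
  qed
  have contd: "continuous_on {0..r} (ud (Suc n))" "continuous_on {0..r} (vd (Suc n))" for n
    unfolding ud_def vd_def nat.case using comb_cont cont contuv[of n] by blast+
  have bdd: "\<exists>K. \<forall>x\<in>{0..r}. \<bar>g x\<bar> \<le> K" if "continuous_on {0..r} g" for g :: "real \<Rightarrow> real"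
    using compact_imp_bounded[OF compact_continuous_image[OF that compact_Icc]] by (simp add: bounded_iff)
  obtain Ka where Ka: "\<forall>x\<in>{0..r}. \<bar>a x\<bar> \<le> Ka" using bdd[OF cont(1)] ..
  obtain Kb where Kb: "\<forall>x\<in>{0..r}. \<bar>b x\<bar> \<le> Kb" using bdd[OF cont(2)] ..
  obtain Kc where Kc: "\<forall>x\<in>{0..r}. \<bar>c x\<bar> \<le> Kc" using bdd[OF cont(3)] ..
  obtain Kd where Kd: "\<forall>x\<in>{0..r}. \<bar>d x\<bar> \<le> Kd" using bdd[OF cont(4)] ..
  define K where "K = max (max Ka Kb) (max Kc Kd)"
  have K: "\<bar>a x\<bar> \<le> K" "\<bar>b x\<bar> \<le> K" "\<bar>c x\<bar> \<le> K" "\<bar>d x\<bar> \<le> K" if "x \<in> {0..r}" for x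
    using bspec[OF Ka that] bspec[OF Kb that] bspec[OF Kc that] bspec[OF Kd that]
    by (simp_all add: K_def le_max_iff_disj)
  have "0 \<in> {0..r}" using r by simp
  then have K0: "K \<ge> 0" using K(1)[of 0] by linarith
  define B where "B = max \<bar>y0\<bar> \<bar>w0\<bar>"
  have B0: "B \<ge> 0" by (simp add: B_def le_max_iff_disj)
  \<comment> \<open>Each row of the system has two coefficients, both bounded by
    \<open>K\<close>.\<close>
  define L where "L = 2 * K"
  have L0: "L \<ge> 0" using K0 by (simp add: L_def)
  have comb: "\<bar>p * s + q * t\<bar> \<le> L * M" if "\<bar>p\<bar> \<le> K" "\<bar>q\<bar> \<le> K" "\<bar>s\<bar> \<le> M" "\<bar>t\<bar> \<le> M" for p q s t M :: real
  proof -
    have "\<bar>p * s\<bar> \<le> K * M" "\<bar>q * t\<bar> \<le> K * M"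
      unfolding abs_mult using that K0 by (auto intro!: mult_mono)
    then show ?thesis unfolding L_def by linarith
  qed
  have bound: "\<forall>x\<in>{0..r}. \<bar>u n x\<bar> \<le> B * (L * x) ^ n / fact n \<and> \<bar>v n x\<bar> \<le> B * (L * x) ^ n / fact n" for n
  proof (induction n)
    case 0
    then show ?case by (simp add: u0 B_def)
  next
    case (Suc n)
    have "\<bar>ud (Suc n) x\<bar> \<le> L * (B * (L * x) ^ n / fact n)" "\<bar>vd (Suc n) x\<bar> \<le> L * (B * (L * x) ^ n / fact n)"
      if "x \<in> {0..r}" for x
      unfolding ud_def vd_def nat.case using bspec[OF Suc that] K[OF that] by (blast intro: comb)+
    then show ?case unfolding uS
      by (intro ballI conjI) (rule picard_step_bound[OF contd(1)] picard_step_bound[OF contd(2)]; assumption)+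
  qed
  define M where "M n = B * (L * r) ^ n / fact n" for n
  have M: "\<bar>u n x\<bar> \<le> M n" "\<bar>v n x\<bar> \<le> M n" if "x \<in> {0..r}" for n x
  proof -
    have "(L * x) ^ n \<le> (L * r) ^ n" using that L0 by (intro power_mono mult_left_mono) auto
    then have "B * (L * x) ^ n / fact n \<le> M n"
      unfolding M_def using B0 by (intro divide_right_mono mult_left_mono) auto
    then show "\<bar>u n x\<bar> \<le> M n" "\<bar>v n x\<bar> \<le> M n" using bspec[OF bound that, of n] by linarith+
  qed
  define Md where "Md n = (case n of 0 \<Rightarrow> 0 | Suc n \<Rightarrow> L * M n)" for n
  have Md: "\<bar>ud n x\<bar> \<le> Md n" "\<bar>vd n x\<bar> \<le> Md n" if "x \<in> {0..r}" for n x
  proof -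
    have "\<bar>ud (Suc k) x\<bar> \<le> Md (Suc k)" "\<bar>vd (Suc k) x\<bar> \<le> Md (Suc k)" for k
      unfolding ud_def vd_def Md_def nat.case by (intro comb K[OF that] M[OF that])+
    moreover have "\<bar>ud 0 x\<bar> \<le> Md 0" "\<bar>vd 0 x\<bar> \<le> Md 0" by (simp_all add: ud_def vd_def Md_def)
    ultimately show "\<bar>ud n x\<bar> \<le> Md n" "\<bar>vd n x\<bar> \<le> Md n" by (metis not0_implies_Suc)+
  qed
  have "summable (\<lambda>n. B * (inverse (fact n) * (L * r) ^ n))" by (intro summable_mult summable_exp)
  then have "summable M" by (simp add: M_def[abs_def] field_simps)
  then have "summable (\<lambda>n. Md (Suc n))" by (simp add: Md_def summable_mult)
  then have sMd: "summable Md" by (subst (asm) summable_Suc_iff)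
  have deru: "(u n has_real_derivative ud n x) (at x within {0..r})"
    and derv: "(v n has_real_derivative vd n x) (at x within {0..r})" if "x \<in> {0..r}" for n x
  proof -
    have "(u (Suc k) has_real_derivative ud (Suc k) x) (at x within {0..r})"
      "(v (Suc k) has_real_derivative vd (Suc k) x) (at x within {0..r})" for k
      unfolding uS has_real_derivative_iff_has_vector_derivative
      by (intro integral_has_vector_derivative contd that)+
    moreover have "(u 0 has_real_derivative ud 0 x) (at x within {0..r})"
      "(v 0 has_real_derivative vd 0 x) (at x within {0..r})"
      unfolding u0 by (simp_all add: ud_def vd_def)
    ultimately show "(u n has_real_derivative ud n x) (at x within {0..r})"
      "(v n has_real_derivative vd n x) (at x within {0..r})" by (metis not0_implies_Suc)+
  qed
  have "u (Suc k) 0 = 0" "v (Suc k) 0 = 0" for k unfolding uS by simp_all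
  then have s0: "(\<lambda>n. u n 0) sums y0" "(\<lambda>n. v n 0) sums w0"
    using sums_Suc[of "\<lambda>n. u n 0" 0] sums_Suc[of "\<lambda>n. v n 0" 0] by (simp_all add: u0)
  have "\<exists>y. \<forall>x\<in>{0..r}. (\<lambda>n. u n x) sums y x \<and> (y has_field_derivative (\<Sum>n. ud n x)) (at x within {0..r})"
  proof (rule has_field_derivative_series[OF _ deru])
    show "uniform_limit {0..r} (\<lambda>n x. \<Sum>i<n. ud i x) (\<lambda>x. \<Sum>n. ud n x) sequentially"
      using Md sMd by (intro Weierstrass_m_test[where M = Md]) auto
    show "summable (\<lambda>n. u n 0)" using s0 by (auto simp: sums_iff)
  qed (use r in auto)
  then obtain y where y: "\<And>x. x \<in> {0..r} \<Longrightarrow> (\<lambda>n. u n x) sums y x"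
    "\<And>x. x \<in> {0..r} \<Longrightarrow> (y has_field_derivative (\<Sum>n. ud n x)) (at x within {0..r})" by blast
  have "\<exists>w. \<forall>x\<in>{0..r}. (\<lambda>n. v n x) sums w x \<and> (w has_field_derivative (\<Sum>n. vd n x)) (at x within {0..r})"
  proof (rule has_field_derivative_series[OF _ derv])
    show "uniform_limit {0..r} (\<lambda>n x. \<Sum>i<n. vd i x) (\<lambda>x. \<Sum>n. vd n x) sequentially"
      using Md sMd by (intro Weierstrass_m_test[where M = Md]) auto
    show "summable (\<lambda>n. v n 0)" using s0 by (auto simp: sums_iff)
  qed (use r in auto)
  then obtain w where w: "\<And>x. x \<in> {0..r} \<Longrightarrow> (\<lambda>n. v n x) sums w x"
    "\<And>x. x \<in> {0..r} \<Longrightarrow> (w has_field_derivative (\<Sum>n. vd n x)) (at x within {0..r})" by blast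
  have "y 0 = y0" "w 0 = w0"
    using y(1)[OF \<open>0 \<in> {0..r}\<close>] w(1)[OF \<open>0 \<in> {0..r}\<close>] s0 sums_unique2 by blast+
  have sums: "(\<Sum>n. ud n x) = a x * y x + b x * w x" "(\<Sum>n. vd n x) = c x * y x + d x * w x"
    if "x \<in> {0..r}" for x
  proof -
    have "(\<lambda>n. a x * u n x + b x * v n x) sums (a x * y x + b x * w x)"
      "(\<lambda>n. c x * u n x + d x * v n x) sums (c x * y x + d x * w x)"
      by (intro sums_add sums_mult y(1) w(1) that)+
    then have "(\<lambda>n. ud (Suc n) x) sums (a x * y x + b x * w x)" "(\<lambda>n. vd (Suc n) x) sums (c x * y x + d x * w x)"
      unfolding ud_def vd_def nat.case .
    from this[THEN sums_Suc] have "(\<lambda>n. ud n x) sums (a x * y x + b x * w x)"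
      "(\<lambda>n. vd n x) sums (c x * y x + d x * w x)"
      by (simp_all add: ud_def[of 0] vd_def[of 0])
    then show "(\<Sum>n. ud n x) = a x * y x + b x * w x" "(\<Sum>n. vd n x) = c x * y x + d x * w x"
      by (metis sums_unique)+
  qed
  show ?thesis
    using \<open>y 0 = y0\<close> \<open>w 0 = w0\<close> DERIV_cong[OF y(2) sums(1)] DERIV_cong[OF w(2) sums(2)] by blast
qed

section \<open>The regularised system\<close>

text \<open>The system for \<open>y\<close> and the quasi-derivative \<open>w = y' - Q y\<close>;
  the square of \<open>Q\<close> comes from eliminating \<open>y'\<close>.\<close>

definition sl_system :: "(real \<Rightarrow> real) \<Rightarrow> real \<Rightarrow> (real \<Rightarrow> real) \<Rightarrow> (real \<Rightarrow> real) \<Rightarrow> bool" where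
  "sl_system Q l y w \<longleftrightarrow> (\<forall>x\<in>{0..pi}.
     (y has_real_derivative Q x * y x + w x) (at x within {0..pi}) \<and>
     (w has_real_derivative - ((l + (Q x)\<^sup>2) * y x) - Q x * w x) (at x within {0..pi}))"

lemma solution_iff_sl_system:
  fixes l :: real
  assumes "q absolutely_integrable_on {0..pi}"
  shows "solution q l y y' \<longleftrightarrow> sl_system (potential q) l y (\<lambda>x. y' x - potential q x * y x)"
proof -
  have "potential q x * y x + (y' x - potential q x * y x) = y' x" for x by simp
  moreover have "- ((l + (potential q x)\<^sup>2) * y x) - potential q x * (y' x - potential q x * y x) =
    - (l * y x) - potential q x * y' x" for x
    by (simp add: power2_eq_square algebra_simps)
  ultimately show ?thesis
    unfolding solution_iff[OF assms] sl_system_def has_real_derivative_iff_has_vector_derivative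
    by (simp only: of_real_eq_id id_apply ball_conj_distrib)
qed

lemma sl_system_exists:
  assumes "continuous_on {0..pi} Q"
  shows "\<exists>y w. y 0 = y0 \<and> w 0 = w0 \<and> sl_system Q l y w"
proof -
  have "\<exists>y w. y 0 = y0 \<and> w 0 = w0 \<and> (\<forall>x\<in>{0..pi}.
      (y has_real_derivative Q x * y x + 1 * w x) (at x within {0..pi}) \<and>
      (w has_real_derivative - (l + (Q x)\<^sup>2) * y x + - Q x * w x) (at x within {0..pi}))"
    using assms by (intro linear_system_exists continuous_intros) auto
  moreover have "- (l + (Q x)\<^sup>2) * y + - Q x * w = - ((l + (Q x)\<^sup>2) * y) - Q x * w" for x y w
    by (simp add: algebra_simps)
  ultimately show ?thesis unfolding sl_system_def by (simp only: mult_1)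
qed

text \<open>Gronwall's inequality for the squared distance. The difference of the parameters acts as
  an inhomogeneity multiplied by \<open>y2\<close> only, so with the second solution fixed this
  gives continuity in \<open>l\<close>, uniformly in \<open>x\<close>.\<close>

lemma sl_system_stability:
  assumes sys1: "sl_system Q l1 y1 w1" and sys2: "sl_system Q l2 y2 w2"
    and Q: "\<And>x. x \<in> {0..pi} \<Longrightarrow> \<bar>Q x\<bar> \<le> K" and l1: "\<bar>l1\<bar> \<le> R" and y2: "\<And>x. x \<in> {0..pi} \<Longrightarrow> \<bar>y2 x\<bar> \<le> B"
    and x: "x \<in> {0..pi}"
  shows "(y1 x - y2 x)\<^sup>2 + (w1 x - w2 x)\<^sup>2 \<le>
    exp ((2 * K + 2 + K\<^sup>2 + R) * pi) * ((y1 0 - y2 0)\<^sup>2 + (w1 0 - w2 0)\<^sup>2 + (l1 - l2)\<^sup>2 * B\<^sup>2 * pi)"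
proof -
  \<comment> \<open>\<open>2 * K\<close> bounds the terms linear in \<open>Q\<close>,
    \<open>K\<^sup>2\<close> and \<open>R\<close> the mixed products with \<open>Q\<close> squared
    and \<open>l1\<close>; of the remaining 2, one part is the plain mixed product and one is the
    square split off from the inhomogeneity.\<close>
  define C where "C = 2 * K + 2 + K\<^sup>2 + R"
  define E where "E x = (y1 x - y2 x)\<^sup>2 + (w1 x - w2 x)\<^sup>2" for x
  define D where "D = (l1 - l2)\<^sup>2 * B\<^sup>2"
  have K0: "K \<ge> 0" using Q[OF x] by linarith
  have C0: "C \<ge> 0" using K0 l1 by (auto simp: C_def)
  have D0: "D \<ge> 0" by (simp add: D_def)
  define E' where "E' x = 2 * (y1 x - y2 x) * (Q x * y1 x + w1 x - (Q x * y2 x + w2 x)) +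
     2 * (w1 x - w2 x) * (- ((l1 + (Q x)\<^sup>2) * y1 x) - Q x * w1 x - (- ((l2 + (Q x)\<^sup>2) * y2 x) - Q x * w2 x))" for x
  have derE: "(E has_real_derivative E' t) (at t within {0..pi})" if "t \<in> {0..pi}" for t
  proof -
    note 1 = bspec[OF sys1[unfolded sl_system_def] that] and 2 = bspec[OF sys2[unfolded sl_system_def] that]
    show ?thesis
      unfolding E_def E'_def
      by (rule DERIV_cong[OF DERIV_add
          [OF DERIV_power[OF DERIV_diff[OF conjunct1[OF 1] conjunct1[OF 2]], of 2]
              DERIV_power[OF DERIV_diff[OF conjunct2[OF 1] conjunct2[OF 2]], of 2]]])
         (simp add: algebra_simps)
  qed
  have E': "E' t \<le> C * E t + D" if t: "t \<in> {0..pi}" for t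
  proof -
    define p s where "p = y1 t - y2 t" and "s = w1 t - w2 t"
    have eq: "E' t = 2 * (p * s) + 2 * (Q t * (p\<^sup>2 - s\<^sup>2)) - (Q t)\<^sup>2 * (2 * (p * s)) - l1 * (2 * (p * s))
        - 2 * s * ((l1 - l2) * y2 t)"
      unfolding E'_def p_def s_def by (simp add: power2_eq_square algebra_simps)
    have ps: "\<bar>2 * (p * s)\<bar> \<le> p\<^sup>2 + s\<^sup>2"
      using sum_squares_bound[of p s] sum_squares_bound[of p "- s"] by (simp add: abs_le_iff)
    have term_bound: "\<bar>a * z\<bar> \<le> A * (p\<^sup>2 + s\<^sup>2)"
      if "\<bar>a\<bar> \<le> A" "\<bar>z\<bar> \<le> p\<^sup>2 + s\<^sup>2" for a A z :: real
      unfolding abs_mult using that by (rule mult_mono) (use that abs_ge_zero[of a] in linarith, simp)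
    have "\<bar>p\<^sup>2 - s\<^sup>2\<bar> \<le> p\<^sup>2 + s\<^sup>2"
      using zero_le_power2[of p] zero_le_power2[of s] by linarith
    then have 1: "\<bar>Q t * (p\<^sup>2 - s\<^sup>2)\<bar> \<le> K * (p\<^sup>2 + s\<^sup>2)" by (rule term_bound[OF Q[OF t]])
    have "\<bar>(Q t)\<^sup>2\<bar> \<le> K\<^sup>2" using power_mono[OF Q[OF t] abs_ge_zero, of 2] by simp
    then have 2: "\<bar>(Q t)\<^sup>2 * (2 * (p * s))\<bar> \<le> K\<^sup>2 * (p\<^sup>2 + s\<^sup>2)" using ps by (rule term_bound)
    have 3: "\<bar>l1 * (2 * (p * s))\<bar> \<le> R * (p\<^sup>2 + s\<^sup>2)" using l1 ps by (rule term_bound)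
    have 4: "- (2 * s * ((l1 - l2) * y2 t)) \<le> s\<^sup>2 + D"
    proof -
      have "(y2 t)\<^sup>2 \<le> B\<^sup>2" using power_mono[OF y2[OF t] abs_ge_zero, of 2] by simp
      then have "((l1 - l2) * y2 t)\<^sup>2 \<le> D" unfolding D_def power_mult_distrib by (intro mult_left_mono) auto
      moreover have "- (2 * s * ((l1 - l2) * y2 t)) \<le> s\<^sup>2 + ((l1 - l2) * y2 t)\<^sup>2"
        using sum_squares_bound[of "- s" "(l1 - l2) * y2 t"] by simp
      ultimately show ?thesis by linarith
    qed
    have "s\<^sup>2 \<le> p\<^sup>2 + s\<^sup>2" by simp
    then have "E' t \<le> (p\<^sup>2 + s\<^sup>2) + 2 * (K * (p\<^sup>2 + s\<^sup>2)) + K\<^sup>2 * (p\<^sup>2 + s\<^sup>2) + R * (p\<^sup>2 + s\<^sup>2) + (p\<^sup>2 + s\<^sup>2) + D"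
      unfolding eq using 1 2 3 4 ps by linarith
    also have "\<dots> = C * E t + D" unfolding E_def C_def p_def s_def by (simp add: algebra_simps)
    finally show ?thesis .
  qed
  \<comment> \<open>Integrating factor together with the accumulated inhomogeneity; since
    \<open>E' \<le> C * E + D\<close>, this function does not increase.\<close>
  define G where "G x = exp (- (C * x)) * E x - D * x" for x
  have derG: "(G has_real_derivative (exp (- (C * t)) * (E' t - C * E t) - D)) (at t within {0..pi})"
    if "t \<in> {0..pi}" for t
    unfolding G_def using derE[OF that] by (auto intro!: derivative_eq_intros simp: algebra_simps)
  have "G x \<le> G 0"
  proof (cases "x = 0")
    case False
    then obtain t where t: "0 < t" "t < x" "G x - G 0 = (x - 0) * (exp (- (C * t)) * (E' t - C * E t) - D)"
      using increment_within[OF derG, of 0 x] x by auto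
    have "exp (- (C * t)) * (E' t - C * E t) \<le> 1 * D"
    proof (rule order_trans)
      show "exp (- (C * t)) * (E' t - C * E t) \<le> exp (- (C * t)) * D"
        using E'[of t] t x by (intro mult_left_mono) auto
      show "exp (- (C * t)) * D \<le> 1 * D" using C0 t D0 by (intro mult_right_mono) auto
    qed
    then have "(x - 0) * (exp (- (C * t)) * (E' t - C * E t) - D) \<le> 0"
      using x by (intro mult_nonneg_nonpos) auto
    then show ?thesis using t(3) by linarith
  qed simp
  then have "exp (- (C * x)) * E x \<le> E 0 + D * x" by (simp add: G_def)
  also have "\<dots> \<le> E 0 + D * pi" using D0 x by (auto intro!: mult_left_mono)
  finally have "exp (C * x) * (exp (- (C * x)) * E x) \<le> exp (C * x) * (E 0 + D * pi)"
    by (intro mult_left_mono) auto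
  then have "E x \<le> exp (C * x) * (E 0 + D * pi)"
    by (simp add: mult.assoc[symmetric] exp_add[symmetric])
  also have "\<dots> \<le> exp (C * pi) * (E 0 + D * pi)"
    using C0 x D0 by (intro mult_right_mono) (auto simp: E_def intro!: mult_left_mono)
  finally show ?thesis unfolding E_def C_def D_def .
qed

lemma sl_system_continuous:
  assumes "sl_system Q l y w"
  shows "continuous_on {0..pi} y" "continuous_on {0..pi} w"
  using assms unfolding sl_system_def by (auto intro: DERIV_continuous_on)

lemma continuous_on_pi_bounded:
  fixes g :: "real \<Rightarrow> real"
  assumes "continuous_on {0..pi} g"
  obtains K where "\<And>x. x \<in> {0..pi} \<Longrightarrow> \<bar>g x\<bar> \<le> K"
proof -
  obtain K where "\<forall>v\<in>g ` {0..pi}. norm v \<le> K"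
    using compact_imp_bounded[OF compact_continuous_image[OF assms compact_Icc]] unfolding bounded_iff by blast
  then show thesis using that[of K] by simp
qed

text \<open>The terms with \<open>Q\<close> cancel, so this is the usual Wronskian; written with
  quasi-derivatives it is visibly differentiable at every point.\<close>

lemma sl_system_wronskian:
  assumes "sl_system Q l1 y1 w1" "sl_system Q l2 y2 w2" "x \<in> {0..pi}"
  shows "((\<lambda>x. y1 x * w2 x - y2 x * w1 x) has_real_derivative (l1 - l2) * (y1 x * y2 x)) (at x within {0..pi})"
proof -
  have "((\<lambda>x. y1 x * w2 x - y2 x * w1 x) has_real_derivative
      ((Q x * y1 x + w1 x) * w2 x + (- ((l2 + (Q x)\<^sup>2) * y2 x) - Q x * w2 x) * y1 x) -
      ((Q x * y2 x + w2 x) * w1 x + (- ((l1 + (Q x)\<^sup>2) * y1 x) - Q x * w1 x) * y2 x)) (at x within {0..pi})"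
    using assms unfolding sl_system_def by (intro derivative_intros) auto
  then show ?thesis by (rule DERIV_cong) (simp add: algebra_simps)
qed

lemma sl_system_linear:
  assumes "sl_system Q l y1 w1" "sl_system Q l y2 w2"
  shows "sl_system Q l (\<lambda>x. \<alpha> * y1 x + \<beta> * y2 x) (\<lambda>x. \<alpha> * w1 x + \<beta> * w2 x)"
  unfolding sl_system_def
proof (intro ballI conjI)
  fix x assume x: "x \<in> {0..pi}"
  note 1 = bspec[OF assms(1)[unfolded sl_system_def] x] and 2 = bspec[OF assms(2)[unfolded sl_system_def] x]
  have
    "((\<lambda>x. \<alpha> * y1 x + \<beta> * y2 x) has_real_derivative \<alpha> * (Q x * y1 x + w1 x) + \<beta> * (Q x * y2 x + w2 x)) (at x within {0..pi})"
    by (intro DERIV_add DERIV_cmult conjunct1[OF 1] conjunct1[OF 2])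
  moreover have "((\<lambda>x. \<alpha> * w1 x + \<beta> * w2 x) has_real_derivative
      \<alpha> * (- ((l + (Q x)\<^sup>2) * y1 x) - Q x * w1 x) + \<beta> * (- ((l + (Q x)\<^sup>2) * y2 x) - Q x * w2 x)) (at x within {0..pi})"
    by (intro DERIV_add DERIV_cmult conjunct2[OF 1] conjunct2[OF 2])
  ultimately show
    "((\<lambda>x. \<alpha> * y1 x + \<beta> * y2 x) has_real_derivative Q x * (\<alpha> * y1 x + \<beta> * y2 x) + (\<alpha> * w1 x + \<beta> * w2 x)) (at x within {0..pi})"
    "((\<lambda>x. \<alpha> * w1 x + \<beta> * w2 x) has_real_derivative
      - ((l + (Q x)\<^sup>2) * (\<alpha> * y1 x + \<beta> * y2 x)) - Q x * (\<alpha> * w1 x + \<beta> * w2 x)) (at x within {0..pi})"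
    by (auto elim!: DERIV_cong simp: algebra_simps)
qed

section \<open>Solutions of the Sturm--Liouville equation\<close>

lemma continuous_on_potential:
  "q absolutely_integrable_on {0..pi} \<Longrightarrow> continuous_on {0..pi} (potential q)"
  by (intro indefinite_integral_continuous_1) (simp add: absolutely_integrable_on_def)

lemma solution_exists_at_0:
  fixes l :: real
  assumes q: "q absolutely_integrable_on {0..pi}"
  shows "\<exists>y y'. solution q l y y' \<and> y 0 = a \<and> y' 0 = b"
proof -
  obtain y w where yw: "y 0 = a" "w 0 = b" "sl_system (potential q) l y w"
    using sl_system_exists[OF continuous_on_potential[OF q]] by blast
  have "solution q l y (\<lambda>x. w x + potential q x * y x)"
    unfolding solution_iff_sl_system[OF q] using yw(3) by simp
  then show ?thesis using yw by (intro exI[of _ y] exI[of _ "\<lambda>x. w x + potential q x * y x"]) simp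
qed

lemma solution_deriv:
  fixes y :: "real \<Rightarrow> real"
  assumes "solution q l y y'" "x \<in> {0..pi}"
  shows "(y has_real_derivative y' x) (at x within {0..pi})"
  using assms by (auto simp: solution_def has_real_derivative_iff_has_vector_derivative)

lemma solution_continuous:
  fixes y :: "real \<Rightarrow> real"
  assumes "solution q l y y'"
  shows "continuous_on {0..pi} y"
  using solution_deriv[OF assms] by (rule DERIV_continuous_on)

lemma solution_deriv_continuous:
  fixes y :: "real \<Rightarrow> real"
  assumes q: "q absolutely_integrable_on {0..pi}" and s: "solution q l y y'"
  shows "continuous_on {0..pi} y'"
proof -
  have "continuous_on {0..pi} (\<lambda>x. y' x - potential q x * y x)"
    using s unfolding solution_iff_sl_system[OF q] by (rule sl_system_continuous)
  moreover have "continuous_on {0..pi} (\<lambda>x. potential q x * y x)"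
    using continuous_on_potential[OF q] solution_continuous[OF s] by (rule continuous_on_mult)
  ultimately have "continuous_on {0..pi} (\<lambda>x. (y' x - potential q x * y x) + potential q x * y x)"
    by (rule continuous_on_add)
  then show ?thesis by simp
qed

lemma solution_linear:
  fixes l :: real
  assumes q: "q absolutely_integrable_on {0..pi}" and "solution q l y1 y1'" "solution q l y2 y2'"
  shows "solution q l (\<lambda>x. \<alpha> * y1 x + \<beta> * y2 x) (\<lambda>x. \<alpha> * y1' x + \<beta> * y2' x)"
proof -
  have "(\<lambda>x. \<alpha> * y1' x + \<beta> * y2' x - potential q x * (\<alpha> * y1 x + \<beta> * y2 x)) =
      (\<lambda>x. \<alpha> * (y1' x - potential q x * y1 x) + \<beta> * (y2' x - potential q x * y2 x))"
    by (simp add: fun_eq_iff algebra_simps)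
  then show ?thesis
    using assms(2,3) unfolding solution_iff_sl_system[OF q] by (simp only: sl_system_linear)
qed

definition wronskian :: "(real \<Rightarrow> real) \<times> (real \<Rightarrow> real) \<Rightarrow> (real \<Rightarrow> real) \<times> (real \<Rightarrow> real) \<Rightarrow> real \<Rightarrow> real" where
  "wronskian y z x = fst y x * snd z x - fst z x * snd y x"

lemma wronskian_deriv:
  fixes l1 l2 :: real
  assumes q: "q absolutely_integrable_on {0..pi}"
    and "solution q l1 y1 y1'" "solution q l2 y2 y2'" "x \<in> {0..pi}"
  shows "(wronskian (y1, y1') (y2, y2') has_real_derivative (l1 - l2) * (y1 x * y2 x)) (at x within {0..pi})"
proof -
  have "wronskian (y1, y1') (y2, y2') =
      (\<lambda>x. y1 x * (y2' x - potential q x * y2 x) - y2 x * (y1' x - potential q x * y1 x))"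
    by (simp add: fun_eq_iff wronskian_def algebra_simps)
  then show ?thesis
    using sl_system_wronskian assms(2-4) unfolding solution_iff_sl_system[OF q] by simp
qed

lemma wronskian_constant:
  fixes l :: real
  assumes q: "q absolutely_integrable_on {0..pi}"
    and "solution q l y1 y1'" "solution q l y2 y2'" "x \<in> {0..pi}"
  shows "wronskian (y1, y1') (y2, y2') x = wronskian (y1, y1') (y2, y2') 0"
proof -
  have "(wronskian (y1, y1') (y2, y2') has_vector_derivative 0) (at x within {0..pi})"
    if "x \<in> {0..pi}" for x
    using wronskian_deriv[OF q assms(2,3) that] by (simp add: has_real_derivative_iff_has_vector_derivative)
  from zero_derivative_constant[OF this assms(4)] show ?thesis .
qed

text \<open>The Wronskians of \<open>y\<close> with the fundamental pair \<open>C\<close>,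
  \<open>S\<close> are constant and vanish at \<open>x0\<close>. As the pair itself has Wronskian 1,
  Cramer's rule gives \<open>y = y' = 0\<close> everywhere.\<close>

lemma solution_zero_data:
  fixes l :: real
  assumes q: "q absolutely_integrable_on {0..pi}" and s: "solution q l y y'"
    and x0: "x0 \<in> {0..pi}" "y x0 = 0" "y' x0 = 0" and x: "x \<in> {0..pi}"
  shows "y x = 0" "y' x = 0"
proof -
  obtain C C' where C: "solution q l C C'" "C 0 = 1" "C' 0 = 0"
    using solution_exists_at_0[OF q] by blast
  obtain S S' where S: "solution q l S S'" "S 0 = 0" "S' 0 = 1"
    using solution_exists_at_0[OF q] by blast
  have "wronskian (y, y') (C, C') x0 = 0" "wronskian (y, y') (S, S') x0 = 0"
    using x0(2,3) by (simp_all add: wronskian_def)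
  then have "wronskian (y, y') (C, C') x = 0" "wronskian (y, y') (S, S') x = 0"
    using wronskian_constant[OF q s C(1) x] wronskian_constant[OF q s C(1) x0(1)]
      wronskian_constant[OF q s S(1) x] wronskian_constant[OF q s S(1) x0(1)] by simp_all
  moreover have "wronskian (C, C') (S, S') x = 1"
    using wronskian_constant[OF q C(1) S(1) x] C S by (simp add: wronskian_def)
  ultimately have *: "y x * C' x = C x * y' x" "y x * S' x = S x * y' x" "C x * S' x - S x * C' x = 1"
    by (simp_all add: wronskian_def)
  have "y x = y x * (C x * S' x - S x * C' x)" unfolding *(3) by simp
  also have "\<dots> = C x * (y x * S' x) - S x * (y x * C' x)" by (simp add: algebra_simps)
  also have "\<dots> = 0" unfolding *(1,2) by simp
  finally show "y x = 0" .
  have "y' x = y' x * (C x * S' x - S x * C' x)" unfolding *(3) by simp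
  also have "\<dots> = (C x * y' x) * S' x - (S x * y' x) * C' x" by (simp add: algebra_simps)
  also have "\<dots> = 0" unfolding *(1,2)[symmetric] by simp
  finally show "y' x = 0" .
qed

lemma solution_unique:
  fixes l :: real
  assumes q: "q absolutely_integrable_on {0..pi}" and "solution q l y y'" "solution q l z z'"
    and x0: "x0 \<in> {0..pi}" "y x0 = z x0" "y' x0 = z' x0" and x: "x \<in> {0..pi}"
  shows "y x = z x" "y' x = z' x"
proof -
  have "solution q l (\<lambda>x. 1 * y x + (-1) * z x) (\<lambda>x. 1 * y' x + (-1) * z' x)"
    using assms(1-3) by (rule solution_linear)
  from solution_zero_data[OF q this x0(1) _ _ x] show "y x = z x" "y' x = z' x"
    using x0 by simp_all
qed

text \<open>Existence was obtained from the left end; the combination of \<open>C\<close> and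
  \<open>S\<close> with given data at \<open>pi\<close> is found by Cramer's rule with determinant
  1.\<close>

lemma solution_exists_at_pi:
  fixes l :: real
  assumes q: "q absolutely_integrable_on {0..pi}"
  shows "\<exists>y y'. solution q l y y' \<and> y pi = a \<and> y' pi = b"
proof -
  obtain C C' where C: "solution q l C C'" "C 0 = 1" "C' 0 = 0"
    using solution_exists_at_0[OF q] by blast
  obtain S S' where S: "solution q l S S'" "S 0 = 0" "S' 0 = 1"
    using solution_exists_at_0[OF q] by blast
  have "pi \<in> {0..pi}" by simp
  then have W: "C pi * S' pi - S pi * C' pi = 1"
    using wronskian_constant[OF q C(1) S(1)] C S by (simp add: wronskian_def)
  define \<alpha> \<beta> where "\<alpha> = a * S' pi - b * S pi" and "\<beta> = b * C pi - a * C' pi"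
  have "solution q l (\<lambda>x. \<alpha> * C x + \<beta> * S x) (\<lambda>x. \<alpha> * C' x + \<beta> * S' x)"
    using q C(1) S(1) by (rule solution_linear)
  moreover have "\<alpha> * C pi + \<beta> * S pi = a * (C pi * S' pi - S pi * C' pi)"
    "\<alpha> * C' pi + \<beta> * S' pi = b * (C pi * S' pi - S pi * C' pi)"
    by (simp_all add: \<alpha>_def \<beta>_def algebra_simps)
  ultimately show ?thesis unfolding W
    by (intro exI[of _ "\<lambda>x. \<alpha> * C x + \<beta> * S x"] exI[of _ "\<lambda>x. \<alpha> * C' x + \<beta> * S' x"]) simp
qed

lemma cauchy_solution_spec:
  assumes q: "q absolutely_integrable_on {0..pi}" and x0: "x0 = 0 \<or> x0 = pi"
  shows "solution q l (fst (cauchy_solution q l x0 a b)) (snd (cauchy_solution q l x0 a b))"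
    and "fst (cauchy_solution q l x0 a b) x0 = a" "snd (cauchy_solution q l x0 a b) x0 = b"
proof -
  have "\<exists>p. case p of (y, y') \<Rightarrow> solution q l y y' \<and> y x0 = a \<and> y' x0 = b"
    using solution_exists_at_0[OF q, of l a b] solution_exists_at_pi[OF q, of l a b] x0 by auto
  then have "case cauchy_solution q l x0 a b of (y, y') \<Rightarrow> solution q l y y' \<and> y x0 = a \<and> y' x0 = b"
    unfolding cauchy_solution_def by (rule someI_ex)
  then show "solution q l (fst (cauchy_solution q l x0 a b)) (snd (cauchy_solution q l x0 a b))"
    and "fst (cauchy_solution q l x0 a b) x0 = a" "snd (cauchy_solution q l x0 a b) x0 = b"
    by (auto split: prod.splits)
qed

lemma phi_spec:
  assumes "q absolutely_integrable_on {0..pi}"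
  shows "solution q l (fst (phi q f l)) (snd (phi q f l))"
    and "fst (phi q f l) 0 = poly (down f) l" "snd (phi q f l) 0 = - poly (up f) l"
  unfolding phi_def using cauchy_solution_spec[OF assms, of 0] by simp_all

lemma psi_spec:
  assumes "q absolutely_integrable_on {0..pi}"
  shows "solution q l (fst (psi q F l)) (snd (psi q F l))"
    and "fst (psi q F l) pi = poly (down F) l" "snd (psi q F l) pi = poly (up F) l"
  unfolding psi_def using cauchy_solution_spec[OF assms, of pi] by simp_all

lemma wronskian_phi_psi_constant:
  assumes "q absolutely_integrable_on {0..pi}" "x \<in> {0..pi}"
  shows "wronskian (phi q f l) (psi q F l) x = wronskian (phi q f l) (psi q F l) 0"
  using wronskian_constant[OF assms(1) phi_spec(1)[OF assms(1)] psi_spec(1)[OF assms(1)] assms(2)] by simp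

text \<open>The characteristic function, minus the Wronskian of \<phi> and \<psi>. With this sign it
  is positive below the spectrum.\<close>

definition chi :: "(real \<Rightarrow> real) \<Rightarrow> ratfun \<Rightarrow> ratfun \<Rightarrow> real \<Rightarrow> real" where
  "chi q f F l = poly (down F) l * snd (phi q f l) pi - poly (up F) l * fst (phi q f l) pi"

lemma wronskian_phi_psi:
  assumes "q absolutely_integrable_on {0..pi}" "x \<in> {0..pi}"
  shows "wronskian (phi q f l) (psi q F l) x = - chi q f F l"
proof -
  have "pi \<in> {0..pi}" by simp
  then have "wronskian (phi q f l) (psi q F l) x = wronskian (phi q f l) (psi q F l) pi"
    using wronskian_phi_psi_constant[OF assms(1)] assms(2) by metis
  also have "\<dots> = - chi q f F l"
    by (simp add: wronskian_def chi_def psi_spec[OF assms(1)] mult.commute)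
  finally show ?thesis .
qed

text \<open>Also for complex parameters. It serves to show that the transformation
  \<open>y' - v y\<close> annihilates no non-trivial solution with
  \<open>l \<noteq> L\<close>.\<close>

lemma solution_vanishing:
  fixes l :: "'a::{real_normed_field,euclidean_space}"
  assumes s: "solution q l y y'" and 0: "\<And>x. x \<in> {0..pi} \<Longrightarrow> y x = 0" and x: "x \<in> {0..pi}"
  shows "y' x = 0"
proof -
  have "(y has_vector_derivative y' x) (at x within {0..pi})" using s x by (simp add: solution_def)
  moreover have "((\<lambda>x. 0) has_vector_derivative 0) (at x within {0..pi})" by (rule has_vector_derivative_const)
  then have "(y has_vector_derivative 0) (at x within {0..pi})"
    using has_vector_derivative_transform[of x "{0..pi}" y "\<lambda>x. 0" 0] x 0 by simp
  ultimately show ?thesis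
    using vector_derivative_unique_within_closed_interval[of 0 pi x y "y' x" 0] x by simp
qed

lemma phi_nonzero:
  assumes q: "q absolutely_integrable_on {0..pi}" and f: "f \<in> herglotz" and x: "x \<in> {0..pi}"
  shows "fst (phi q f l) x \<noteq> 0 \<or> snd (phi q f l) x \<noteq> 0"
proof (rule ccontr)
  assume *: "\<not> ?thesis"
  have "(0 :: real) \<in> {0..pi}" by simp
  then have "fst (phi q f l) 0 = 0" "snd (phi q f l) 0 = 0"
    using solution_zero_data[OF q phi_spec(1)[OF q] x, of f l 0] * by auto
  then show False using down_up_not_both_zero[OF f, of l] phi_spec(2,3)[OF q, of f l] by auto
qed

lemma psi_nonzero:
  assumes q: "q absolutely_integrable_on {0..pi}" and F: "F \<in> herglotz" and x: "x \<in> {0..pi}"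
  shows "fst (psi q F l) x \<noteq> 0 \<or> snd (psi q F l) x \<noteq> 0"
proof (rule ccontr)
  assume *: "\<not> ?thesis"
  have "pi \<in> {0..pi}" by simp
  then have "fst (psi q F l) pi = 0" "snd (psi q F l) pi = 0"
    using solution_zero_data[OF q psi_spec(1)[OF q] x, of F l pi] * by auto
  then show False using down_up_not_both_zero[OF F, of l] psi_spec(2,3)[OF q, of F l] by auto
qed

lemma phi_not_identically_zero:
  assumes q: "q absolutely_integrable_on {0..pi}" and f: "f \<in> herglotz"
  shows "\<exists>x\<in>{0..pi}. fst (phi q f l) x \<noteq> 0"
proof (rule ccontr)
  assume "\<not> ?thesis"
  then have 0: "\<And>x. x \<in> {0..pi} \<Longrightarrow> fst (phi q f l) x = 0" by blast
  have "(0 :: real) \<in> {0..pi}" by simp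
  then show False
    using solution_vanishing[OF phi_spec(1)[OF q] 0] 0 phi_nonzero[OF q f] by metis
qed

lemma solution_of_real:
  assumes q: "q absolutely_integrable_on {0..pi}" and s: "solution q l y y'"
  shows "solution q (complex_of_real l) (\<lambda>x. of_real (y x)) (\<lambda>x. of_real (y' x))"
  unfolding solution_iff[OF q]
proof (intro conjI ballI)
  fix x assume x: "x \<in> {0..pi}"
  have 1: "(y has_vector_derivative y' x) (at x within {0..pi})"
    and 2: "((\<lambda>x. y' x - potential q x * y x) has_vector_derivative - (l * y x) - potential q x * y' x)
      (at x within {0..pi})"
    using s x unfolding solution_iff[OF q] by simp_all
  show "((\<lambda>x. complex_of_real (y x)) has_vector_derivative of_real (y' x)) (at x within {0..pi})"
    using bounded_linear.has_vector_derivative[OF bounded_linear_of_real 1] .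
  show "((\<lambda>x. complex_of_real (y' x) - of_real (potential q x) * of_real (y x)) has_vector_derivative
      - (of_real l * of_real (y x)) - of_real (potential q x) * of_real (y' x)) (at x within {0..pi})"
    using bounded_linear.has_vector_derivative[OF bounded_linear_of_real[where 'a = complex] 2] by simp
qed

lemma solution_Re_Im:
  assumes q: "q absolutely_integrable_on {0..pi}" and s: "solution q (complex_of_real l) y y'"
  shows "solution q l (\<lambda>x. Re (y x)) (\<lambda>x. Re (y' x))" "solution q l (\<lambda>x. Im (y x)) (\<lambda>x. Im (y' x))"
  unfolding solution_iff[OF q]
proof (safe)
  fix x assume x: "x \<in> {0..pi}"
  have 1: "(y has_vector_derivative y' x) (at x within {0..pi})"
    and 2: "((\<lambda>x. y' x - of_real (potential q x) * y x) has_vector_derivative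
      - (of_real l * y x) - of_real (potential q x) * y' x) (at x within {0..pi})"
    using s x unfolding solution_iff[OF q] by simp_all
  show "((\<lambda>x. Re (y x)) has_vector_derivative Re (y' x)) (at x within {0..pi})"
    using bounded_linear.has_vector_derivative[OF bounded_linear_Re 1] .
  show "((\<lambda>x. Im (y x)) has_vector_derivative Im (y' x)) (at x within {0..pi})"
    using bounded_linear.has_vector_derivative[OF bounded_linear_Im 1] .
  show "((\<lambda>x. Re (y' x) - of_real (potential q x) * Re (y x)) has_vector_derivative
      - (l * Re (y x)) - of_real (potential q x) * Re (y' x)) (at x within {0..pi})"
    using bounded_linear.has_vector_derivative[OF bounded_linear_Re 2] by simp
  show "((\<lambda>x. Im (y' x) - of_real (potential q x) * Im (y x)) has_vector_derivative
      - (l * Im (y x)) - of_real (potential q x) * Im (y' x)) (at x within {0..pi})"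
    using bounded_linear.has_vector_derivative[OF bounded_linear_Im 2] by simp
qed

text \<open>At a real point the real or the imaginary part of an eigenfunction is a non-trivial real
  one. Its condition at 0 says that its Wronskian with \<phi> vanishes; combined with the condition
  at \<open>pi\<close> this makes \<open>chi\<close> annihilate both of its end values there, which
  are not both zero.\<close>

lemma is_eigenvalue_of_real_iff:
  assumes q: "q absolutely_integrable_on {0..pi}" and f: "f \<in> herglotz"
  shows "is_eigenvalue q f F (complex_of_real l) \<longleftrightarrow> chi q f F l = 0"
proof
  assume "chi q f F l = 0"
  then have c: "poly (down F) l * snd (phi q f l) pi - poly (up F) l * fst (phi q f l) pi = 0"
    by (simp add: chi_def)
  let ?y = "\<lambda>x. complex_of_real (fst (phi q f l) x)" and ?y' = "\<lambda>x. complex_of_real (snd (phi q f l) x)"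
  have "solution q (complex_of_real l) ?y ?y'"
    using q phi_spec(1)[OF q] by (rule solution_of_real)
  moreover have "\<exists>x\<in>{0..pi}. ?y x \<noteq> 0" using phi_not_identically_zero[OF q f] by simp
  moreover have "cpoly (down f) (of_real l) * ?y' 0 + cpoly (up f) (of_real l) * ?y 0 = 0"
    unfolding phi_spec(2,3)[OF q] by simp
  moreover have "cpoly (down F) (of_real l) * ?y' pi - cpoly (up F) (of_real l) * ?y pi = 0"
    using c by (simp flip: of_real_mult of_real_diff)
  ultimately show "is_eigenvalue q f F (complex_of_real l)" unfolding is_eigenvalue_def by blast
next
  assume "is_eigenvalue q f F (complex_of_real l)"
  then obtain y y' where s: "solution q (complex_of_real l) y y'" and nz: "\<exists>x\<in>{0..pi}. y x \<noteq> 0"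
    and b0: "of_real (poly (down f) l) * y' 0 + of_real (poly (up f) l) * y 0 = 0"
    and b1: "of_real (poly (down F) l) * y' pi - of_real (poly (up F) l) * y pi = 0"
    unfolding is_eigenvalue_def by auto
  have "\<exists>z z'. solution q l z z' \<and> (\<exists>x\<in>{0..pi}. z x \<noteq> 0) \<and>
      poly (down f) l * z' 0 + poly (up f) l * z 0 = 0 \<and> poly (down F) l * z' pi - poly (up F) l * z pi = 0"
  proof (cases "\<exists>x\<in>{0..pi}. Re (y x) \<noteq> 0")
    case True
    moreover have "poly (down f) l * Re (y' 0) + poly (up f) l * Re (y 0) = 0"
      "poly (down F) l * Re (y' pi) - poly (up F) l * Re (y pi) = 0"
      using arg_cong[OF b0, of Re] arg_cong[OF b1, of Re] by simp_all
    ultimately show ?thesis using solution_Re_Im(1)[OF q s] by blast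
  next
    case False
    then have "\<exists>x\<in>{0..pi}. Im (y x) \<noteq> 0" using nz by (auto simp: complex_eq_iff)
    moreover have "poly (down f) l * Im (y' 0) + poly (up f) l * Im (y 0) = 0"
      "poly (down F) l * Im (y' pi) - poly (up F) l * Im (y pi) = 0"
      using arg_cong[OF b0, of Im] arg_cong[OF b1, of Im] by simp_all
    ultimately show ?thesis using solution_Re_Im(2)[OF q s] by blast
  qed
  then obtain z z' where z: "solution q l z z'" "\<exists>x\<in>{0..pi}. z x \<noteq> 0"
    and b0: "poly (down f) l * z' 0 + poly (up f) l * z 0 = 0"
    and b1: "poly (down F) l * z' pi - poly (up F) l * z pi = 0" by blast
  have pi: "pi \<in> {0..pi}" by simp
  have "wronskian (phi q f l) (z, z') pi = wronskian (phi q f l) (z, z') 0"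
    using wronskian_constant[OF q phi_spec(1)[OF q] z(1) pi] by simp
  also have "\<dots> = 0" using b0 by (simp add: wronskian_def phi_spec[OF q] mult.commute)
  finally have W: "fst (phi q f l) pi * z' pi = z pi * snd (phi q f l) pi" by (simp add: wronskian_def)
  have b1': "poly (down F) l * z' pi = poly (up F) l * z pi" using b1 by simp
  have "chi q f F l * z pi = poly (down F) l * (z pi * snd (phi q f l) pi) - fst (phi q f l) pi * (poly (up F) l * z pi)"
    by (simp add: chi_def algebra_simps)
  also have "\<dots> = 0" unfolding W[symmetric] b1'[symmetric] by simp
  finally have 1: "chi q f F l * z pi = 0" .
  have "chi q f F l * z' pi = snd (phi q f l) pi * (poly (down F) l * z' pi) - poly (up F) l * (fst (phi q f l) pi * z' pi)"
    by (simp add: chi_def algebra_simps)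
  also have "\<dots> = 0" unfolding W b1' by simp
  finally have 2: "chi q f F l * z' pi = 0" .
  have "z pi \<noteq> 0 \<or> z' pi \<noteq> 0" using solution_zero_data(1)[OF q z(1) pi] z(2) by blast
  then show "chi q f F l = 0" using 1 2 by auto
qed

lemma psi_eq_beta_phi:
  assumes q: "q absolutely_integrable_on {0..pi}" and f: "f \<in> herglotz" and F: "F \<in> herglotz"
    and chi: "chi q f F l = 0"
  shows "beta q f F l \<noteq> 0" "x \<in> {0..pi} \<Longrightarrow> fst (psi q F l) x = beta q f F l * fst (phi q f l) x"
    "x \<in> {0..pi} \<Longrightarrow> snd (psi q F l) x = beta q f F l * snd (phi q f l) x"
proof -
  have z: "(0::real) \<in> {0..pi}" by simp
  have W: "fst (phi q f l) 0 * snd (psi q F l) 0 = fst (psi q F l) 0 * snd (phi q f l) 0"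
    using wronskian_phi_psi[OF q z, of f l F] chi by (simp add: wronskian_def)
  have "\<exists>b. fst (psi q F l) 0 = b * fst (phi q f l) 0 \<and> snd (psi q F l) 0 = b * snd (phi q f l) 0"
  proof (cases "fst (phi q f l) 0 = 0")
    \<comment> \<open>At a zero of \<open>down f\<close>, in particular for a Dirichlet condition,
      the factor has to be read off from the derivatives.\<close>
    case True
    then show ?thesis using phi_nonzero[OF q f z, of l] W
      by (intro exI[of _ "snd (psi q F l) 0 / snd (phi q f l) 0"]) auto
  next
    case False
    then show ?thesis using W
      by (intro exI[of _ "fst (psi q F l) 0 / fst (phi q f l) 0"]) (simp add: field_simps)
  qed
  then obtain b where b: "fst (psi q F l) 0 = b * fst (phi q f l) 0" "snd (psi q F l) 0 = b * snd (phi q f l) 0"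
    by blast
  have "solution q l (\<lambda>x. b * fst (phi q f l) x + 0 * fst (phi q f l) x) (\<lambda>x. b * snd (phi q f l) x + 0 * snd (phi q f l) x)"
    using q phi_spec(1)[OF q] phi_spec(1)[OF q] by (rule solution_linear)
  then have s: "solution q l (\<lambda>x. b * fst (phi q f l) x) (\<lambda>x. b * snd (phi q f l) x)" by simp
  have eq: "fst (psi q F l) x = b * fst (phi q f l) x" "snd (psi q F l) x = b * snd (phi q f l) x" if "x \<in> {0..pi}" for x
    using solution_unique[OF q psi_spec(1)[OF q] s z b that] by simp_all
  have b0: "b \<noteq> 0" using eq[OF z] psi_nonzero[OF q F z, of l] by auto
  obtain x0 where x0: "x0 \<in> {0..pi}" "fst (phi q f l) x0 \<noteq> 0" using phi_not_identically_zero[OF q f] by blast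
  have "beta q f F l = b" unfolding beta_def
  proof (rule the_equality)
    fix b' assume "b' \<noteq> 0 \<and> (\<forall>x\<in>{0..pi}. fst (psi q F l) x = b' * fst (phi q f l) x)"
    then have "b' * fst (phi q f l) x0 = b * fst (phi q f l) x0" using x0(1) eq(1) by metis
    then show "b' = b" using x0(2) by simp
  qed (use b0 eq(1) in blast)
  then show "beta q f F l \<noteq> 0" "x \<in> {0..pi} \<Longrightarrow> fst (psi q F l) x = beta q f F l * fst (phi q f l) x"
    "x \<in> {0..pi} \<Longrightarrow> snd (psi q F l) x = beta q f F l * snd (phi q f l) x"
    using b0 eq by simp_all
qed

section \<open>Positivity below the smallest eigenvalue\<close>

text \<open>These properties are propagated in \<open>l\<close> together, since keeping one of them
  in a limit uses the others. The point 0 is left out because \<phi> vanishes there under a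
  Dirichlet condition.\<close>

definition oscillation_free :: "(real \<Rightarrow> real) \<Rightarrow> ratfun \<Rightarrow> ratfun \<Rightarrow> real \<Rightarrow> bool" where
  "oscillation_free q f F l \<longleftrightarrow> below_poles f l \<and> below_poles F l \<and>
     (\<forall>x\<in>{0<..pi}. fst (phi q f l) x > 0) \<and> chi q f F l > 0"

lemma nonvanishing_positive:
  fixes h :: "real \<Rightarrow> real"
  assumes "continuous_on {0..pi} h" "h 0 > 0" "\<And>x. x \<in> {0<..pi} \<Longrightarrow> h x \<noteq> 0" "x \<in> {0..pi}"
  shows "h x > 0"
proof (rule ccontr)
  assume neg: "\<not> h x > 0"
  have "continuous_on {0..x} h" using assms(4) by (intro continuous_on_subset[OF assms(1)]) auto
  then obtain t where "0 \<le> t" "t \<le> x" "h t = 0"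
    using IVT2'[of h x 0 0] neg assms(2,4) by auto
  then show False using assms(2,3,4) by (cases "t = 0") auto
qed

text \<open>
  For \<open>l\<close> very negative the region \<open>y > 0\<close>, \<open>g := w - m y > 0\<close>, where \<open>m\<close> increases linearly from
  \<open>- c\<close> to \<open>c\<close>, is invariant: \<open>(y g)' = g\<^sup>2 + b y\<^sup>2\<close> with \<open>b = - l - m' - (Q + m)\<^sup>2 > 0\<close>.
\<close>

lemma oscillation_free_at_minus_infinity:
  assumes q: "q absolutely_integrable_on {0..pi}" and f: "f \<in> herglotz" and F: "F \<in> herglotz"
  shows "\<exists>M. \<forall>l\<le>M. oscillation_free q f F l"
proof -
  let ?Q = "potential q"
  obtain K where K: "\<And>x. x \<in> {0..pi} \<Longrightarrow> \<bar>?Q x\<bar> \<le> K"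
    using continuous_on_pi_bounded[OF continuous_on_potential[OF q]] by blast
  obtain cf Mf where cf: "\<forall>x\<le>Mf. below_poles f x \<and> (f \<noteq> None \<longrightarrow> poly (up f) x \<le> cf * poly (down f) x)"
    using herglotz_bounded_at_minus_infinity[OF f] by blast
  obtain cF MF where cF: "\<forall>x\<le>MF. below_poles F x \<and> (F \<noteq> None \<longrightarrow> poly (up F) x \<le> cF * poly (down F) x)"
    using herglotz_bounded_at_minus_infinity[OF F] by blast
  have z: "(0::real) \<in> {0..pi}" and pi: "pi \<in> {0..pi}" by simp_all
  have K0: "K \<ge> 0" using K[OF z] by linarith
  \<comment> \<open>\<open>c \<ge> cf\<close> gives \<open>g 0 \<ge> 0\<close> at the left end;
    \<open>c \<ge> K + cF\<close> turns \<open>g pi > 0\<close> into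
    \<open>y' pi > cF * y pi\<close>, which is what \<open>chi > 0\<close> requires.\<close>
  define c where "c = max \<bar>cf\<bar> (K + \<bar>cF\<bar>)"
  have c: "cf \<le> c" "K + cF \<le> c" "c \<ge> 0" using K0 by (auto simp: c_def le_max_iff_disj)
  \<comment> \<open>The last entry makes \<open>b\<close> positive: the slope of \<open>m\<close> is
    \<open>2 * c / pi \<le> c\<close>, the square is at most \<open>(K + c)\<^sup>2\<close>, and 1
    remains.\<close>
  define M where "M = min (min Mf MF) (- (c + (K + c)\<^sup>2) - 1)"
  have "oscillation_free q f F l" if l: "l \<le> M" for l
  proof -
    have bf: "below_poles f l" and upf: "f \<noteq> None \<Longrightarrow> poly (up f) l \<le> cf * poly (down f) l"
      and bF: "below_poles F l" and upF: "F \<noteq> None \<Longrightarrow> poly (up F) l \<le> cF * poly (down F) l"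
      using l cf cF by (auto simp: M_def)
    define y y' where "y = fst (phi q f l)" and "y' = snd (phi q f l)"
    have sol: "solution q l y y'" and y0: "y 0 = poly (down f) l" and y'0: "y' 0 = - poly (up f) l"
      using phi_spec[OF q, where f = f and l = l] by (simp_all add: y_def y'_def)
    define w where "w x = y' x - ?Q x * y x" for x
    have sys: "sl_system ?Q l y w" using sol unfolding solution_iff_sl_system[OF q] w_def[abs_def] .
    define m where "m x = c * (2 * x / pi - 1)" for x
    define g where "g x = w x - m x * y x" for x
    define b where "b x = - l - 2 * c / pi - (?Q x + m x)\<^sup>2" for x
    have b: "b x > 0" if x: "x \<in> {0..pi}" for x
    proof -
      have "\<bar>2 * x / pi - 1\<bar> \<le> 1" using x by (auto simp: abs_le_iff field_simps)
      then have "\<bar>m x\<bar> \<le> c" unfolding m_def abs_mult using c(3) mult_left_le[of "\<bar>2 * x / pi - 1\<bar>" c] by simp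
      then have "\<bar>?Q x + m x\<bar> \<le> K + c" using K[OF x] by linarith
      then have "(?Q x + m x)\<^sup>2 \<le> (K + c)\<^sup>2" using power_mono[OF _ abs_ge_zero, of "?Q x + m x" "K + c" 2] by simp
      moreover have "2 * c / pi \<le> c"
        using c(3) pi_ge_two mult_left_mono[of 2 pi c] by (simp add: divide_le_eq mult.commute)
      moreover have "l \<le> - (c + (K + c)\<^sup>2) - 1" using l by (simp add: M_def)
      ultimately show ?thesis unfolding b_def by linarith
    qed
    have der: "((\<lambda>x. y x * g x) has_real_derivative (g x)\<^sup>2 + b x * (y x)\<^sup>2) (at x within {0..pi})"
      if x: "x \<in> {0..pi}" for x
    proof -
      have dy: "(y has_real_derivative ?Q x * y x + w x) (at x within {0..pi})"
        and dw: "(w has_real_derivative - ((l + (?Q x)\<^sup>2) * y x) - ?Q x * w x) (at x within {0..pi})"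
        using sys x by (auto simp: sl_system_def)
      have dm: "(m has_real_derivative 2 * c / pi) (at x within {0..pi})"
        unfolding m_def by (auto intro!: derivative_eq_intros simp: mult.commute)
      have dg: "(g has_real_derivative (- ((l + (?Q x)\<^sup>2) * y x) - ?Q x * w x)
          - (2 * c / pi * y x + (?Q x * y x + w x) * m x)) (at x within {0..pi})"
        unfolding g_def by (rule DERIV_diff[OF dw DERIV_mult[OF dm dy]])
      have w: "w x = g x + m x * y x" by (simp add: g_def)
      show ?thesis
        by (rule DERIV_cong[OF DERIV_mult[OF dy dg]])
           (simp add: w b_def power2_eq_square algebra_simps)
    qed
    have g0: "g 0 = - poly (up f) l + c * poly (down f) l"
      by (simp add: g_def m_def w_def y0 y'0)
    have start: "y 0 \<ge> 0" "g 0 \<ge> 0" "y 0 > 0 \<or> g 0 > 0"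
    proof -
      have "y 0 \<ge> 0 \<and> g 0 \<ge> 0 \<and> (y 0 > 0 \<or> g 0 > 0)"
      proof (cases f)
        case None
        then show ?thesis by (simp add: y0 g0)
      next
        case (Some r)
        then have "poly (down f) l > 0" using down_pos[OF f _ bf] by simp
        moreover have "poly (up f) l \<le> c * poly (down f) l"
          using upf Some mult_right_mono[OF c(1), of "poly (down f) l"] calculation by force
        ultimately show ?thesis by (simp add: y0 g0)
      qed
      then show "y 0 \<ge> 0" "g 0 \<ge> 0" "y 0 > 0 \<or> g 0 > 0" by blast+
    qed
    \<comment> \<open>At the intermediate point \<open>y\<close> and \<open>g\<close> cannot both
      vanish, as that would be zero Cauchy data; so the derivative of the product is strictly
      positive there.\<close>
    have prod_pos: "y x * g x > 0" if x: "x \<in> {0<..pi}" for x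
    proof -
      obtain t where t: "0 < t" "t < x" "y x * g x - y 0 * g 0 = (x - 0) * ((g t)\<^sup>2 + b t * (y t)\<^sup>2)"
        using increment_within[OF der, of 0 x] x by auto
      have tt: "t \<in> {0..pi}" using t x by auto
      have "y t \<noteq> 0 \<or> y' t \<noteq> 0" using phi_nonzero[OF q f tt, of l] by (simp add: y_def y'_def)
      then have "y t \<noteq> 0 \<or> g t \<noteq> 0" by (auto simp: g_def w_def)
      then have "(g t)\<^sup>2 + b t * (y t)\<^sup>2 > 0"
        using b[OF tt] by (cases "y t = 0") (auto intro!: add_nonneg_pos)
      then have "(x - 0) * ((g t)\<^sup>2 + b t * (y t)\<^sup>2) > 0" using x by simp
      moreover have "y 0 * g 0 \<ge> 0" using start by simp
      ultimately show ?thesis using t(3) by linarith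
    qed
    have cont_y: "continuous_on {0..pi} y" using sol by (rule solution_continuous)
    have cont_w: "continuous_on {0..pi} w" using sys by (rule sl_system_continuous)
    have cont_g: "continuous_on {0..pi} g"
      unfolding g_def m_def using cont_y cont_w by (intro continuous_intros) auto
    \<comment> \<open>The product only shows that \<open>y\<close> and \<open>g\<close> have equal
      signs without zeros. Whichever of them starts positive stays positive: \<open>y\<close> for a
      finite boundary function, \<open>g\<close> in the Dirichlet case.\<close>
    have pos: "y x > 0" if x: "x \<in> {0<..pi}" for x
    proof (cases "y 0 > 0")
      case True
      then show ?thesis using nonvanishing_positive[OF cont_y, of x] prod_pos x by force
    next
      case False
      then have "g 0 > 0" using start by blast
      then have "g x > 0" using nonvanishing_positive[OF cont_g, of x] prod_pos x by force
      then show ?thesis using prod_pos[OF x] by (simp add: zero_less_mult_iff)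
    qed
    have ypi: "y pi > 0" using pos[of pi] by simp
    then have "g pi > 0" using prod_pos[of pi] by (simp add: zero_less_mult_iff)
    then have "y' pi > (c + ?Q pi) * y pi" by (simp add: g_def m_def w_def algebra_simps)
    moreover have "(c + ?Q pi) * y pi \<ge> cF * y pi"
      using K[OF pi] c(2) ypi by (intro mult_right_mono) auto
    ultimately have y'pi: "y' pi > cF * y pi" by linarith
    have "chi q f F l > 0"
    proof (cases F)
      case None
      then show ?thesis using ypi by (simp add: chi_def y_def)
    next
      case (Some r)
      then have d: "poly (down F) l > 0" using down_pos[OF F _ bF] by simp
      have "poly (up F) l * y pi \<le> cF * poly (down F) l * y pi"
        using upF Some ypi by (intro mult_right_mono) auto
      also have "\<dots> = poly (down F) l * (cF * y pi)" by simp
      also have "\<dots> < poly (down F) l * y' pi" using y'pi d by simp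
      finally show ?thesis by (simp add: chi_def y_def y'_def)
    qed
    then show ?thesis using bf bF pos by (simp add: oscillation_free_def y_def)
  qed
  then show ?thesis by blast
qed

text \<open>Closeness uniform in \<open>x\<close>, as needed to preserve positivity on a whole
  interval.\<close>

lemma phi_eventually_close:
  assumes q: "q absolutely_integrable_on {0..pi}" and "\<epsilon> > 0"
  shows "eventually (\<lambda>l. \<forall>x\<in>{0..pi}. \<bar>fst (phi q f l) x - fst (phi q f s) x\<bar> < \<epsilon> \<and>
    \<bar>snd (phi q f l) x - snd (phi q f s) x\<bar> < \<epsilon>) (nhds s)"
proof -
  let ?Q = "potential q"
  define y y' where "y l = fst (phi q f l)" and "y' l = snd (phi q f l)" for l
  define w where "w l x = y' l x - ?Q x * y l x" for l x
  have sys: "sl_system ?Q l (y l) (w l)" for l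
    using phi_spec(1)[OF q, where f = f and l = l] unfolding solution_iff_sl_system[OF q] w_def y_def y'_def .
  obtain K where K: "\<And>x. x \<in> {0..pi} \<Longrightarrow> \<bar>?Q x\<bar> \<le> K"
    using continuous_on_pi_bounded[OF continuous_on_potential[OF q]] by blast
  obtain B where B: "\<And>x. x \<in> {0..pi} \<Longrightarrow> \<bar>y s x\<bar> \<le> B"
    using continuous_on_pi_bounded[OF sl_system_continuous(1)[OF sys]] by blast
  have K0: "K \<ge> 0" using K[of 0] by simp
  \<comment> \<open>Closeness \<eta> of \<open>y\<close> and \<open>w\<close> yields closeness
    \<open>(1 + K) * \<eta>\<close> of \<open>y' = w + Q y\<close>.\<close>
  define \<eta> where "\<eta> = \<epsilon> / (1 + K)"
  have \<eta>: "\<eta> > 0" "(1 + K) * \<eta> = \<epsilon>" "\<eta> \<le> \<epsilon>"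
    using assms(2) K0 by (auto simp: \<eta>_def divide_le_eq mult_left_le)
  \<comment> \<open>The right side of the stability estimate with \<open>\<bar>s\<bar> + 1\<close>
    as bound for the parameter near \<open>s\<close>; it is continuous in \<open>l\<close> and
    vanishes at \<open>l = s\<close>.\<close>
  define bnd where "bnd l = exp ((2 * K + 2 + K\<^sup>2 + (\<bar>s\<bar> + 1)) * pi) *
    ((poly (down f) l - poly (down f) s)\<^sup>2 + (- poly (up f) l - - poly (up f) s)\<^sup>2 + (l - s)\<^sup>2 * B\<^sup>2 * pi)" for l
  have "isCont bnd s" unfolding bnd_def by (intro continuous_intros) 
  then have "(bnd \<longlongrightarrow> bnd s) (nhds s)" by (simp add: tendsto_at_iff_tendsto_nhds[symmetric] isCont_def)
  then have "(bnd \<longlongrightarrow> 0) (nhds s)" by (simp add: bnd_def)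
  then have "eventually (\<lambda>l. bnd l < \<eta>\<^sup>2) (nhds s)" using \<eta>(1) by (intro order_tendstoD) auto
  moreover have "eventually (\<lambda>l. l \<in> ball s 1) (nhds s)" by (intro eventually_nhds_in_open) auto
  ultimately show ?thesis
  proof eventually_elim
    case (elim l)
    then have l: "\<bar>l\<bar> \<le> \<bar>s\<bar> + 1" by (auto simp: dist_real_def)
    show ?case
    proof
      fix x assume x: "x \<in> {0..pi}"
      have w0: "y l 0 = poly (down f) l" "w l 0 = - poly (up f) l" for l
        using phi_spec[OF q, where f = f and l = l] by (simp_all add: w_def y_def y'_def)
      have "(y l x - y s x)\<^sup>2 + (w l x - w s x)\<^sup>2 \<le> bnd l"
        using sl_system_stability[OF sys sys K l B x] unfolding bnd_def w0 .
      then have lt: "(y l x - y s x)\<^sup>2 + (w l x - w s x)\<^sup>2 < \<eta>\<^sup>2" using elim by linarith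
      have "(y l x - y s x)\<^sup>2 < \<eta>\<^sup>2" "(w l x - w s x)\<^sup>2 < \<eta>\<^sup>2"
        using lt zero_le_power2[of "y l x - y s x"] zero_le_power2[of "w l x - w s x"] by linarith+
      then have d: "\<bar>y l x - y s x\<bar> < \<eta>" "\<bar>w l x - w s x\<bar> < \<eta>"
        using \<eta>(1) power2_less_imp_less[of "\<bar>y l x - y s x\<bar>" \<eta>] power2_less_imp_less[of "\<bar>w l x - w s x\<bar>" \<eta>]
        by simp_all
      have "y' l x - y' s x = (w l x - w s x) + ?Q x * (y l x - y s x)" by (simp add: w_def algebra_simps)
      moreover have "\<bar>?Q x * (y l x - y s x)\<bar> \<le> K * \<eta>"
        unfolding abs_mult using K[OF x] d K0 by (intro mult_mono) auto
      ultimately have "\<bar>y' l x - y' s x\<bar> < \<eta> + K * \<eta>" using d(2) by linarith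
      then have "\<bar>y' l x - y' s x\<bar> < \<epsilon>" using \<eta>(2) by (simp add: algebra_simps)
      then show "\<bar>fst (phi q f l) x - fst (phi q f s) x\<bar> < \<epsilon> \<and> \<bar>snd (phi q f l) x - snd (phi q f s) x\<bar> < \<epsilon>"
        using d(1) \<eta>(3) by (simp add: y_def y'_def)
    qed
  qed
qed

lemma phi_tendsto:
  assumes q: "q absolutely_integrable_on {0..pi}" and x: "x \<in> {0..pi}"
  shows "((\<lambda>l. fst (phi q f l) x) \<longlongrightarrow> fst (phi q f s) x) (nhds s)"
    and "((\<lambda>l. snd (phi q f l) x) \<longlongrightarrow> snd (phi q f s) x) (nhds s)"
  using x by (auto intro!: tendstoI eventually_mono[OF phi_eventually_close[OF q]] simp: dist_real_def)

lemma poly_tendsto_nhds: "(poly p \<longlongrightarrow> poly p (s::real)) (nhds s)"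
  using DERIV_isCont[OF poly_DERIV[of p s]] by (simp add: tendsto_at_iff_tendsto_nhds[symmetric] isCont_def)

lemma chi_tendsto:
  assumes q: "q absolutely_integrable_on {0..pi}"
  shows "(chi q f F \<longlongrightarrow> chi q f F s) (nhds s)"
  unfolding chi_def[abs_def] by (intro tendsto_intros phi_tendsto[OF q] poly_tendsto_nhds) auto

lemma eventually_below_poles:
  assumes "f \<in> herglotz" "below_poles f s"
  shows "eventually (below_poles f) (nhds s)"
proof -
  obtain e where e: "e > 0" "below_poles f (s + e)" using below_poles_open[OF assms] by blast
  then have "eventually (\<lambda>l. l \<in> {..<s + e}) (nhds s)" by (intro eventually_nhds_in_open) auto
  then show ?thesis using below_poles_mono[OF e(2)] by (rule eventually_mono) auto
qed

lemma continuous_positive_min: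
  fixes h :: "real \<Rightarrow> real"
  assumes "continuous_on {a..b} h" "\<And>x. x \<in> {a..b} \<Longrightarrow> h x > 0"
  shows "\<exists>m>0. \<forall>x\<in>{a..b}. m \<le> h x"
proof (cases "a \<le> b")
  case True
  then obtain x where "x \<in> {a..b}" "\<forall>y\<in>{a..b}. h x \<le> h y"
    using continuous_attains_inf[OF compact_Icc _ assms(1)] by auto
  then show ?thesis using assms(2) by blast
qed (auto intro: exI[of _ 1])

text \<open>If \<phi> is positive at 0, it has a positive minimum on the closed interval, which
  survives small changes. In the Dirichlet case it vanishes at 0 for every \<open>l\<close>, and
  near 0 positivity is kept through the derivative.\<close>

lemma oscillation_free_open:
  assumes q: "q absolutely_integrable_on {0..pi}" and f: "f \<in> herglotz" and F: "F \<in> herglotz"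
    and good: "oscillation_free q f F s"
  shows "eventually (oscillation_free q f F) (nhds s)"
proof -
  have bf: "below_poles f s" and bF: "below_poles F s" and chi: "chi q f F s > 0"
    and pos: "\<And>x. x \<in> {0<..pi} \<Longrightarrow> fst (phi q f s) x > 0"
    using good by (auto simp: oscillation_free_def)
  have cont: "continuous_on {0..pi} (fst (phi q f s))"
    using phi_spec(1)[OF q] by (rule solution_continuous)
  have cont': "continuous_on {0..pi} (snd (phi q f s))"
    using q phi_spec(1)[OF q] by (rule solution_deriv_continuous)
  have "eventually (\<lambda>l. \<forall>x\<in>{0<..pi}. fst (phi q f l) x > 0) (nhds s)"
  proof (cases f)
    case (Some r)
    then have "fst (phi q f s) 0 > 0" using down_pos[OF f _ bf] phi_spec(2)[OF q] by simp
    then have "fst (phi q f s) x > 0" if "x \<in> {0..pi}" for x using pos that by (cases "x = 0") auto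
    then obtain m where m: "m > 0" "\<forall>x\<in>{0..pi}. m \<le> fst (phi q f s) x"
      using continuous_positive_min[OF cont] by blast
    from phi_eventually_close[OF q m(1), where f = f and s = s] show ?thesis
    proof (rule eventually_mono, intro ballI)
      fix l x assume close: "\<forall>x\<in>{0..pi}. \<bar>fst (phi q f l) x - fst (phi q f s) x\<bar> < m \<and>
        \<bar>snd (phi q f l) x - snd (phi q f s) x\<bar> < m" and "x \<in> {0<..pi}"
      then have x: "x \<in> {0..pi}" by simp
      show "fst (phi q f l) x > 0" using bspec[OF close x] bspec[OF m(2) x] by linarith
    qed
  next
    case None
    have init: "fst (phi q f l) 0 = 0" "snd (phi q f l) 0 = 1" for l
      using phi_spec(2,3)[OF q] None by simp_all
    have "(snd (phi q f s) \<longlongrightarrow> snd (phi q f s) 0) (at 0 within {0..pi})"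
      using cont' by (simp add: continuous_on)
    then have "eventually (\<lambda>x. snd (phi q f s) x > 1 / 2) (at 0 within {0..pi})"
      unfolding init by (rule order_tendstoD) simp
    then obtain d where d: "d > 0" "\<And>x. x \<in> {0..pi} \<Longrightarrow> x \<noteq> 0 \<Longrightarrow> \<bar>x\<bar> < d \<Longrightarrow> snd (phi q f s) x > 1 / 2"
      unfolding eventually_at by (auto simp: dist_real_def)
    \<comment> \<open>To the left of \<eta> the derivative exceeds 1/2 at \<open>s\<close>, hence is
      positive for nearby \<open>l\<close>; from \<eta> on a positive minimum of the function is
      available.\<close>
    define \<eta> where "\<eta> = min (d / 2) pi"
    have \<eta>: "0 < \<eta>" "\<eta> \<le> pi" "\<eta> < d" using d(1) by (auto simp: \<eta>_def)
    have "continuous_on {\<eta>..pi} (fst (phi q f s))" using cont \<eta> by (intro continuous_on_subset[OF cont]) auto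
    moreover have "fst (phi q f s) x > 0" if "x \<in> {\<eta>..pi}" for x
      using that \<eta>(1) by (intro pos) simp
    ultimately obtain m where m: "m > 0" "\<forall>x\<in>{\<eta>..pi}. m \<le> fst (phi q f s) x"
      using continuous_positive_min[of \<eta> pi "fst (phi q f s)"] by blast
    have "min m (1 / 2) > 0" using m by simp
    from phi_eventually_close[OF q this, where f = f and s = s] show ?thesis
    proof (rule eventually_mono)
      fix l assume close: "\<forall>x\<in>{0..pi}. \<bar>fst (phi q f l) x - fst (phi q f s) x\<bar> < min m (1 / 2) \<and>
        \<bar>snd (phi q f l) x - snd (phi q f s) x\<bar> < min m (1 / 2)"
      show "\<forall>x\<in>{0<..pi}. fst (phi q f l) x > 0"
      proof
        fix x assume x: "x \<in> {0<..pi}"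
        show "fst (phi q f l) x > 0"
        proof (cases "\<eta> \<le> x")
          case True
          then have "m \<le> fst (phi q f s) x" using m x by simp
          then show ?thesis using bspec[OF close, of x] x by auto
        next
          case False
          obtain t where t: "0 < t" "t < x" "fst (phi q f l) x - fst (phi q f l) 0 = (x - 0) * snd (phi q f l) t"
            using increment_within[OF solution_deriv[OF phi_spec(1)[OF q, where f = f and l = l]], of 0 x] x by auto
          have "snd (phi q f s) t > 1 / 2" using d(2)[of t] t x False \<eta> by auto
          moreover have "\<bar>snd (phi q f l) t - snd (phi q f s) t\<bar> < 1 / 2" using bspec[OF close, of t] t x by auto
          ultimately have "snd (phi q f l) t > 0" by linarith
          then show ?thesis using t(3) x unfolding init by simp
        qed
      qed
    qed
  qed
  moreover have "eventually (\<lambda>l. chi q f F l > 0) (nhds s)"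
    using chi_tendsto[OF q] chi by (rule order_tendstoD)
  moreover note eventually_below_poles[OF f bf] eventually_below_poles[OF F bF]
  ultimately show ?thesis unfolding oscillation_free_def by eventually_elim blast
qed

text \<open>The limit leaves weak inequalities only. Equality in one of them would make \<phi>
  negative somewhere nearby, make \<open>chi\<close> negative, or make \<phi> trivial.\<close>

lemma oscillation_free_limit:
  assumes q: "q absolutely_integrable_on {0..pi}" and f: "f \<in> herglotz" and F: "F \<in> herglotz"
    and good: "\<And>l. l < s \<Longrightarrow> oscillation_free q f F l" and chi: "chi q f F s \<noteq> 0"
  shows "oscillation_free q f F s"
proof -
  define y y' where "y = fst (phi q f s)" and "y' = snd (phi q f s)"
  have sol: "solution q s y y'" and y0: "y 0 = poly (down f) s" and y'0: "y' 0 = - poly (up f) s"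
    using phi_spec[OF q, where f = f and l = s] by (simp_all add: y_def y'_def)
  have pi: "pi \<in> {0..pi}" by simp
  have left: "at_left s \<le> nhds s" by (simp add: at_within_le_nhds)
  have ev: "eventually (\<lambda>l. l < s) (at_left s)" by (simp add: eventually_at_filter)
  have nonneg: "y x \<ge> 0" if "x \<in> {0<..pi}" for x
  proof -
    have "((\<lambda>l. fst (phi q f l) x) \<longlongrightarrow> y x) (at_left s)"
      unfolding y_def by (rule tendsto_mono[OF left phi_tendsto(1)[OF q]]) (use that in auto)
    then show ?thesis
    proof (rule tendsto_lowerbound)
      show "eventually (\<lambda>l. 0 \<le> fst (phi q f l) x) (at_left s)"
        using ev by (rule eventually_mono) (use good that in \<open>auto simp: oscillation_free_def intro: less_imp_le\<close>)
    qed simp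
  qed
  have "chi q f F s \<ge> 0"
    using tendsto_mono[OF left chi_tendsto[OF q]]
  proof (rule tendsto_lowerbound)
    show "eventually (\<lambda>l. 0 \<le> chi q f F l) (at_left s)"
      using ev by (rule eventually_mono) (use good in \<open>auto simp: oscillation_free_def intro: less_imp_le\<close>)
  qed simp
  then have chi_pos: "chi q f F s > 0" using chi by simp
  have limF: "below_poles F s \<or> poly (down F) s = 0 \<and> poly (up F) s > 0"
    using good by (intro below_poles_limit[OF F]) (simp add: oscillation_free_def)
  have limf: "below_poles f s \<or> poly (down f) s = 0 \<and> poly (up f) s > 0"
    using good by (intro below_poles_limit[OF f]) (simp add: oscillation_free_def)
  have dy: "(y has_real_derivative y' x) (at x within {0..pi})" if "x \<in> {0..pi}" for x
    using sol that by (rule solution_deriv)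
  have cont': "continuous_on {0..pi} y'" using q sol by (rule solution_deriv_continuous)
  \<comment> \<open>At the smallest pole of \<open>f\<close> the solution would start from 0 with
    negative slope.\<close>
  have bf: "below_poles f s"
  proof (rule ccontr)
    assume "\<not> below_poles f s"
    then have y00: "y 0 = 0" and "y' 0 < 0" using limf y0 y'0 by auto
    have "(y' \<longlongrightarrow> y' 0) (at 0 within {0..pi})" using cont' by (simp add: continuous_on)
    then have "eventually (\<lambda>x. y' x < 0) (at 0 within {0..pi})" using \<open>y' 0 < 0\<close> by (rule order_tendstoD)
    then obtain d where d: "d > 0" "\<And>x. x \<in> {0..pi} \<Longrightarrow> x \<noteq> 0 \<Longrightarrow> \<bar>x\<bar> < d \<Longrightarrow> y' x < 0"
      unfolding eventually_at by (auto simp: dist_real_def)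
    define x where "x = min (d / 2) pi"
    have x: "0 < x" "x \<le> pi" "x < d" using d(1) by (auto simp: x_def)
    obtain t where t: "0 < t" "t < x" "y x - y 0 = (x - 0) * y' t"
      using increment_within[OF dy, of 0 x] x by auto
    have "y' t < 0" using d(2)[of t] t x by auto
    then have "y x < 0" using t(3) x(1) y00 by (simp add: mult_pos_neg)
    then show False using nonneg[of x] x by simp
  qed
  have nz: "y x \<noteq> 0 \<or> y' x \<noteq> 0" if "x \<in> {0..pi}" for x
    using phi_nonzero[OF q f that, of s] by (simp add: y_def y'_def)
  \<comment> \<open>If \<open>y pi = 0\<close>, then \<open>chi > 0\<close> forces a positive slope
    at \<open>pi\<close>, so \<open>y\<close> would be negative just before.\<close>
  have ypi: "y pi > 0"
  proof (rule ccontr)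
    assume "\<not> y pi > 0"
    then have 0: "y pi = 0" using nonneg[of pi] by simp
    then have chi_eq: "chi q f F s = poly (down F) s * y' pi" by (simp add: chi_def y_def y'_def)
    then have dF: "poly (down F) s \<noteq> 0" using chi by auto
    then have "F \<noteq> None" by (cases F) simp_all
    moreover have "below_poles F s" using limF dF by blast
    ultimately have "poly (down F) s > 0" by (intro down_pos[OF F])
    then have "y' pi > 0" using chi_pos chi_eq by (simp add: zero_less_mult_iff)
    have "(y' \<longlongrightarrow> y' pi) (at pi within {0..pi})" using cont' by (simp add: continuous_on)
    then have "eventually (\<lambda>x. y' x > 0) (at pi within {0..pi})" using \<open>y' pi > 0\<close> by (rule order_tendstoD)
    then obtain d where d: "d > 0" "\<And>x. x \<in> {0..pi} \<Longrightarrow> x \<noteq> pi \<Longrightarrow> \<bar>x - pi\<bar> < d \<Longrightarrow> y' x > 0"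
      unfolding eventually_at by (auto simp: dist_real_def)
    define x where "x = max (pi - d / 2) (pi / 2)"
    have x: "0 < x" "x < pi" "pi - x < d" using d(1) by (auto simp: x_def max_def)
    obtain t where t: "x < t" "t < pi" "y pi - y x = (pi - x) * y' t"
      using increment_within[OF dy, of x pi] x by auto
    have "y' t > 0" using d(2)[of t] t x by auto
    then have "(pi - x) * y' t > 0" using x by simp
    then have "y x < 0" using t(3) 0 by linarith
    then show False using nonneg[of x] x by simp
  qed
  \<comment> \<open>At the smallest pole of \<open>F\<close> the characteristic function is
    \<open>- up F * y pi\<close>, which is negative now that \<open>y pi > 0\<close> is
    known.\<close>
  have bF: "below_poles F s"
  proof (rule ccontr)
    assume "\<not> below_poles F s"
    then have "poly (down F) s = 0" "poly (up F) s > 0" using limF by auto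
    then have "chi q f F s < 0" using ypi by (simp add: chi_def y_def)
    then show False using chi_pos by simp
  qed
  have "y x > 0" if x: "x \<in> {0<..pi}" for x
  proof (cases "x = pi")
    case False
    then have x': "0 < x" "x < pi" using x by auto
    show ?thesis
    proof (rule ccontr)
      assume "\<not> y x > 0"
      then have 0: "y x = 0" using nonneg[OF x] by simp
      \<comment> \<open>An interior zero would be a local minimum, hence a double zero.\<close>
      have "(y has_real_derivative y' x) (at x)" using dy[of x] x' by (simp add: at_within_Icc_at)
      moreover have "\<forall>t. \<bar>x - t\<bar> < min x (pi - x) \<longrightarrow> y x \<le> y t"
      proof (intro allI impI)
        fix t assume "\<bar>x - t\<bar> < min x (pi - x)"
        then have "t \<in> {0<..pi}" by (auto simp: abs_less_iff)
        then show "y x \<le> y t" unfolding 0 by (rule nonneg)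
      qed
      ultimately have "y' x = 0" using DERIV_local_min[of y "y' x" x "min x (pi - x)"] x' by simp
      then show False using nz[of x] 0 x' by simp
    qed
  qed (use ypi in simp)
  then show ?thesis using bf bF chi_pos by (simp add: oscillation_free_def y_def)
qed

text \<open>Continuity method: at the infimum of the bad parameters the property holds by the limit
  lemma, and openness then moves the infimum strictly to the right.\<close>

lemma oscillation_free_below_spectrum:
  assumes q: "q absolutely_integrable_on {0..pi}" and f: "f \<in> herglotz" and F: "F \<in> herglotz"
    and no: "\<And>l. l \<le> \<mu> \<Longrightarrow> \<not> is_eigenvalue q f F (complex_of_real l)"
  shows "oscillation_free q f F \<mu>"
proof (rule ccontr)
  assume bad: "\<not> oscillation_free q f F \<mu>"
  define B where "B = {l. l \<le> \<mu> \<and> \<not> oscillation_free q f F l}"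
  obtain M where M: "\<forall>l\<le>M. oscillation_free q f F l"
    using oscillation_free_at_minus_infinity[OF q f F] by blast
  have ne: "B \<noteq> {}" using bad by (auto simp: B_def)
  have "M \<le> l" if "l \<in> B" for l
  proof (rule ccontr)
    assume "\<not> M \<le> l"
    then show False using M that by (simp add: B_def)
  qed
  then have bdd: "bdd_below B" by (rule bdd_belowI)
  define s where "s = Inf B"
  have "\<mu> \<in> B" using bad by (simp add: B_def)
  then have s: "s \<le> \<mu>" unfolding s_def using bdd by (rule cInf_lower)
  have low: "oscillation_free q f F l" if "l < s" for l
  proof (rule ccontr)
    assume "\<not> oscillation_free q f F l"
    then have "l \<in> B" using that s by (simp add: B_def)
    then have "s \<le> l" unfolding s_def using bdd by (rule cInf_lower)
    then show False using that by simp
  qed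
  have "chi q f F s \<noteq> 0" using no[OF s] unfolding is_eigenvalue_of_real_iff[OF q f] .
  from oscillation_free_limit[OF q f F low this] have "oscillation_free q f F s" .
  from oscillation_free_open[OF q f F this] obtain e where
    e: "e > 0" "\<And>l. \<bar>l - s\<bar> < e \<Longrightarrow> oscillation_free q f F l"
    unfolding eventually_nhds_metric by (auto simp: dist_real_def)
  have lower: "s + e \<le> l" if "l \<in> B" for l
  proof (rule ccontr)
    assume "\<not> s + e \<le> l"
    moreover have "s \<le> l" unfolding s_def using that bdd by (rule cInf_lower)
    ultimately have "\<bar>l - s\<bar> < e" by linarith
    then have "oscillation_free q f F l" by (rule e(2))
    then show False using that by (simp add: B_def)
  qed
  have "s + e \<le> Inf B" using ne lower by (rule cInf_greatest)
  then show False using e(1) by (simp add: s_def)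
qed

section \<open>The Darboux transformation\<close>

text \<open>\<open>g\<close> may be any representative of the derivative of \<open>u' / u\<close>,
  in accordance with the choice in \<open>transform\<close>.\<close>

definition darboux :: "(real \<Rightarrow> real) \<Rightarrow> real \<Rightarrow> (real \<Rightarrow> real) \<Rightarrow> (real \<Rightarrow> real) \<Rightarrow> (real \<Rightarrow> real) \<Rightarrow> bool" where
  "darboux q L u u' g \<longleftrightarrow> q absolutely_integrable_on {0..pi} \<and> solution q L u u' \<and>
     (\<forall>x\<in>{0..pi}. u x \<noteq> 0) \<and> abs_cont_deriv (\<lambda>x. u' x / u x) g"

text \<open>The Riccati equation \<open>v' = q - L - v\<^sup>2\<close> with the merely integrable
  \<open>q\<close> moved into the differentiated function, so that it holds at every point.\<close>

lemma riccati:
  fixes L :: real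
  assumes q: "q absolutely_integrable_on {0..pi}" and s: "solution q L u u'"
    and nz: "\<forall>x\<in>{0..pi}. u x \<noteq> 0" and x: "x \<in> {0..pi}"
  shows "((\<lambda>x. u' x / u x - potential q x) has_real_derivative - L - (u' x / u x)\<^sup>2) (at x within {0..pi})"
proof -
  let ?Q = "potential q"
  define w where "w x = u' x - ?Q x * u x" for x
  have sys: "sl_system ?Q L u w" using s unfolding solution_iff_sl_system[OF q] w_def[abs_def] .
  then have du: "(u has_real_derivative ?Q x * u x + w x) (at x within {0..pi})"
    and dw: "(w has_real_derivative - ((L + (?Q x)\<^sup>2) * u x) - ?Q x * w x) (at x within {0..pi})"
    using x by (auto simp: sl_system_def)
  have ux: "u x \<noteq> 0" using nz x by blast
  have "((\<lambda>x. w x / u x) has_real_derivative - L - (u' x / u x)\<^sup>2) (at x within {0..pi})"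
  proof (rule DERIV_cong[OF DERIV_divide[OF dw du ux]])
    have u': "u' x = w x + ?Q x * u x" by (simp add: w_def)
    show "((- ((L + (?Q x)\<^sup>2) * u x) - ?Q x * w x) * u x - w x * (?Q x * u x + w x)) / (u x * u x) =
        - L - (u' x / u x)\<^sup>2"
      unfolding u' using ux by (simp add: field_simps power2_eq_square)
  qed
  then have der: "((\<lambda>x. w x / u x) has_vector_derivative - L - (u' x / u x)\<^sup>2) (at x within {0..pi})"
    unfolding has_real_derivative_iff_has_vector_derivative .
  have eq: "u' t / u t - ?Q t = w t / u t" if "t \<in> {0..pi}" for t
    using nz that by (simp add: w_def diff_divide_distrib)
  show ?thesis
    unfolding has_real_derivative_iff_has_vector_derivative
    by (rule has_vector_derivative_transform[OF x _ der]) (rule eq)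
qed

lemma log_derivative_absolutely_continuous:
  fixes L :: real
  assumes q: "q absolutely_integrable_on {0..pi}" and s: "solution q L u u'"
    and nz: "\<forall>x\<in>{0..pi}. u x \<noteq> 0"
  shows "\<exists>g. abs_cont_deriv (\<lambda>x. u' x / u x) g"
proof -
  let ?Q = "potential q" and ?v = "\<lambda>x. u' x / u x"
  have "continuous_on {0..pi} ?v"
    using solution_deriv_continuous[OF q s] solution_continuous[OF s] nz by (intro continuous_on_divide)
  then have cont: "continuous_on {0..pi} (\<lambda>x. - L - (?v x)\<^sup>2)"
    by (intro continuous_on_diff continuous_on_const continuous_on_power)
  \<comment> \<open>The derivative of \<open>u' / u\<close> according to the Riccati
    equation.\<close>
  define g where "g x = q x + (- L - (?v x)\<^sup>2)" for x
  have ai: "(\<lambda>x. - L - (?v x)\<^sup>2) absolutely_integrable_on {0..pi}"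
    using cont by (rule absolutely_integrable_continuous_real)
  have gai: "g absolutely_integrable_on {0..pi}"
    unfolding g_def[abs_def] using set_integral_add(1)[OF q ai] .
  have "?v x = ?v 0 + integral {0..x} g" if x: "x \<in> {0..pi}" for x
  proof -
    have sub: "{0..x} \<subseteq> {0..pi}" using x by auto
    have "((\<lambda>t. - L - (?v t)\<^sup>2) has_integral (?v x - ?Q x) - (?v 0 - ?Q 0)) {0..x}"
    proof (rule fundamental_theorem_of_calculus)
      fix t assume "t \<in> {0..x}"
      then have "t \<in> {0..pi}" using sub by blast
      from riccati[OF q s nz this]
      show "((\<lambda>x. ?v x - ?Q x) has_vector_derivative - L - (?v t)\<^sup>2) (at t within {0..x})"
        unfolding has_real_derivative_iff_has_vector_derivative
        by (rule has_vector_derivative_within_subset) (rule sub)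
    qed (use x in simp)
    moreover have "q integrable_on {0..x}"
      using q sub unfolding absolutely_integrable_on_def by (blast intro: integrable_on_subinterval)
    then have "(q has_integral ?Q x) {0..x}" by (rule integrable_integral)
    ultimately have "(g has_integral ?Q x + ((?v x - ?Q x) - (?v 0 - ?Q 0))) {0..x}"
      unfolding g_def[abs_def] by (intro has_integral_add)
    then show ?thesis by (simp add: integral_unique)
  qed
  then show ?thesis using gai unfolding abs_cont_deriv_def by blast
qed

lemma darboux_potential:
  assumes d: "darboux q L u u' g"
  shows "(\<lambda>x. q x - 2 * g x) absolutely_integrable_on {0..pi}"
    and "x \<in> {0..pi} \<Longrightarrow> potential (\<lambda>x. q x - 2 * g x) x = potential q x - 2 * (u' x / u x - u' 0 / u 0)"
proof -
  have q: "q absolutely_integrable_on {0..pi}" and g: "g absolutely_integrable_on {0..pi}"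
    and v: "\<And>x. x \<in> {0..pi} \<Longrightarrow> u' x / u x = u' 0 / u 0 + integral {0..x} g"
    using d unfolding darboux_def abs_cont_deriv_def by blast+
  have "(\<lambda>x. 2 * g x) absolutely_integrable_on {0..pi}" using g by (rule set_integrable_mult_right)
  from set_integral_diff(1)[OF q this]
  show "(\<lambda>x. q x - 2 * g x) absolutely_integrable_on {0..pi}" .
  assume x: "x \<in> {0..pi}"
  then have sub: "{0..x} \<subseteq> {0..pi}" by auto
  have "q integrable_on {0..x}" "g integrable_on {0..x}"
    using q g sub unfolding absolutely_integrable_on_def by (blast intro: integrable_on_subinterval)+
  then have "((\<lambda>x. q x - 2 * g x) has_integral potential q x - 2 * integral {0..x} g) {0..x}"
    by (intro has_integral_diff has_integral_mult_right integrable_integral)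
  then show "potential (\<lambda>x. q x - 2 * g x) x = potential q x - 2 * (u' x / u x - u' 0 / u 0)"
    unfolding v[OF x] by (simp add: integral_unique)
qed

text \<open>Since \<open>z = (y' - Q y) - (v - Q) y\<close>, the antiderivative cancels and
  \<open>z\<close> is differentiable at every point with the stated derivative. The new
  antiderivative is \<open>Q - 2 (v - v 0)\<close>, and with it the regularised equation for
  \<open>z\<close> is an algebraic identity.\<close>

lemma darboux_solution:
  fixes y y' :: "real \<Rightarrow> 'a::{real_normed_field,euclidean_space}"
  assumes d: "darboux q L u u' g" and y: "solution q l y y'"
  defines "v \<equiv> \<lambda>x. of_real (u' x / u x)"
  defines "z \<equiv> \<lambda>x. y' x - v x * y x"
  shows "solution (\<lambda>x. q x - 2 * g x) l z (\<lambda>x. (of_real L - l) * y x - v x * z x)"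
proof -
  let ?Q = "\<lambda>x. of_real (potential q x) :: 'a"
  have q: "q absolutely_integrable_on {0..pi}" and s: "solution q L u u'" and nz: "\<forall>x\<in>{0..pi}. u x \<noteq> 0"
    using d by (auto simp: darboux_def)
  have dy: "(y has_vector_derivative y' x) (at x within {0..pi})"
    and dw: "((\<lambda>x. y' x - ?Q x * y x) has_vector_derivative - (l * y x) - ?Q x * y' x) (at x within {0..pi})"
    if "x \<in> {0..pi}" for x
    using y that unfolding solution_iff[OF q] by blast+
  have dv: "((\<lambda>x. v x - ?Q x) has_vector_derivative - of_real L - (v x)\<^sup>2) (at x within {0..pi})"
    if x: "x \<in> {0..pi}" for x
    using bounded_linear.has_vector_derivative[OF bounded_linear_of_real[where 'a = 'a]
        riccati[OF q s nz x, unfolded has_real_derivative_iff_has_vector_derivative]]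
    by (simp add: v_def)
  have dz: "(z has_vector_derivative (of_real L - l) * y x - v x * z x) (at x within {0..pi})"
    if x: "x \<in> {0..pi}" for x
  proof -
    have "((\<lambda>x. (y' x - ?Q x * y x) - (v x - ?Q x) * y x) has_vector_derivative
        (- (l * y x) - ?Q x * y' x) - ((v x - ?Q x) * y' x + (- of_real L - (v x)\<^sup>2) * y x)) (at x within {0..pi})"
      by (rule has_vector_derivative_diff[OF dw[OF x] has_vector_derivative_mult[OF dv[OF x] dy[OF x]]])
    moreover have "(\<lambda>x. (y' x - ?Q x * y x) - (v x - ?Q x) * y x) = z"
      by (simp add: z_def fun_eq_iff algebra_simps)
    moreover have "(- (l * y x) - ?Q x * y' x) - ((v x - ?Q x) * y' x + (- of_real L - (v x)\<^sup>2) * y x) =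
        (of_real L - l) * y x - v x * z x"
      by (simp add: z_def power2_eq_square algebra_simps)
    ultimately show ?thesis by (simp only:)
  qed
  let ?R = "\<lambda>x. of_real (potential (\<lambda>x. q x - 2 * g x) x) :: 'a"
  have R: "?R x = ?Q x - 2 * (v x - v 0)" if "x \<in> {0..pi}" for x
    unfolding darboux_potential(2)[OF d that] by (simp add: v_def)
  show ?thesis
    unfolding solution_iff[OF darboux_potential(1)[OF d]]
  proof (intro conjI ballI dz)
    fix x assume x: "x \<in> {0..pi}"
    let ?zd = "\<lambda>x. (of_real L - l) * y x - v x * z x"
    have der: "((\<lambda>x. (of_real L - l) * y x + (v x - ?Q x) * z x - (2 * v 0) * z x) has_vector_derivative
        (of_real L - l) * y' x + ((v x - ?Q x) * ?zd x + (- of_real L - (v x)\<^sup>2) * z x) - (2 * v 0) * ?zd x)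
        (at x within {0..pi})"
      by (rule has_vector_derivative_diff[OF has_vector_derivative_add[OF
            has_vector_derivative_mult_right[OF dy[OF x]] has_vector_derivative_mult[OF dv[OF x] dz[OF x]]]
            has_vector_derivative_mult_right[OF dz[OF x]]])
    have eq: "?zd t - ?R t * z t = (of_real L - l) * y t + (v t - ?Q t) * z t - (2 * v 0) * z t"
      if "t \<in> {0..pi}" for t
      unfolding R[OF that] by (simp add: algebra_simps)
    have "((\<lambda>x. ?zd x - ?R x * z x) has_vector_derivative
        (of_real L - l) * y' x + ((v x - ?Q x) * ?zd x + (- of_real L - (v x)\<^sup>2) * z x) - (2 * v 0) * ?zd x)
        (at x within {0..pi})"
      by (rule has_vector_derivative_transform[OF x _ der]) (rule eq)
    moreover have "(of_real L - l) * y' x + ((v x - ?Q x) * ?zd x + (- of_real L - (v x)\<^sup>2) * z x) - (2 * v 0) * ?zd x =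
        - (l * z x) - ?R x * ?zd x"
      unfolding R[OF x] by (simp add: z_def power2_eq_square algebra_simps)
    ultimately show "((\<lambda>x. ?zd x - ?R x * z x) has_vector_derivative - (l * z x) - ?R x * ?zd x)
        (at x within {0..pi})"
      by (simp only:)
  qed
qed

text \<open>The inverse step. The logarithmic derivative of \<open>1 / u\<close> is
  \<open>- v\<close>, so a second transformation with it adds \<open>2 * g\<close> back to the
  potential.\<close>

lemma darboux_dual:
  assumes d: "darboux q L u u' g"
  shows "darboux (\<lambda>x. q x - 2 * g x) L (\<lambda>x. 1 / u x) (\<lambda>x. - (u' x / u x) / u x) (\<lambda>x. - g x)"
proof -
  let ?Q = "potential q" and ?v = "\<lambda>x. u' x / u x"
  have q: "q absolutely_integrable_on {0..pi}" and s: "solution q L u u'" and nz: "\<forall>x\<in>{0..pi}. u x \<noteq> 0"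
    and ac: "abs_cont_deriv ?v g"
    using d by (auto simp: darboux_def)
  have du: "((\<lambda>x. 1 / u x) has_real_derivative - ?v x / u x) (at x within {0..pi})" if x: "x \<in> {0..pi}" for x
  proof -
    have ux: "u x \<noteq> 0" using nz x by blast
    show ?thesis
      by (rule DERIV_cong[OF DERIV_divide[OF DERIV_const solution_deriv[OF s x] ux]]) (use ux in simp)
  qed
  let ?R = "potential (\<lambda>x. q x - 2 * g x)"
  have R: "?R x = ?Q x - 2 * (?v x - ?v 0)" if "x \<in> {0..pi}" for x
    by (rule darboux_potential(2)[OF d that])
  have "solution (\<lambda>x. q x - 2 * g x) L (\<lambda>x. 1 / u x) (\<lambda>x. - ?v x / u x)"
    unfolding solution_iff[OF darboux_potential(1)[OF d]]
  proof (intro conjI ballI)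
    fix x assume x: "x \<in> {0..pi}"
    then have ux: "u x \<noteq> 0" using nz by blast
    show "((\<lambda>x. 1 / u x) has_vector_derivative - ?v x / u x) (at x within {0..pi})"
      using du[OF x] unfolding has_real_derivative_iff_has_vector_derivative .
    have "((\<lambda>x. (?v x - ?Q x) * (1 / u x) - 2 * ?v 0 * (1 / u x)) has_real_derivative
        ((- L - (?v x)\<^sup>2) * (1 / u x) + (- ?v x / u x) * (?v x - ?Q x)) - 2 * ?v 0 * (- ?v x / u x)) (at x within {0..pi})"
      by (intro DERIV_diff DERIV_mult DERIV_cmult riccati[OF q s nz] du x)
    then have der: "((\<lambda>x. (?v x - ?Q x) * (1 / u x) - 2 * ?v 0 * (1 / u x)) has_vector_derivative
        - (L * (1 / u x)) - ?R x * (- ?v x / u x)) (at x within {0..pi})"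
      unfolding has_real_derivative_iff_has_vector_derivative[symmetric] R[OF x]
      by (rule DERIV_cong) (use ux in \<open>simp add: field_simps power2_eq_square\<close>)
    have eq: "- ?v t / u t - ?R t * (1 / u t) = (?v t - ?Q t) * (1 / u t) - 2 * ?v 0 * (1 / u t)"
      if "t \<in> {0..pi}" for t
      unfolding R[OF that] by (simp add: algebra_simps)
    show "((\<lambda>x. - ?v x / u x - of_real (?R x) * (1 / u x)) has_vector_derivative
        - (L * (1 / u x)) - of_real (?R x) * (- ?v x / u x)) (at x within {0..pi})"
      unfolding of_real_eq_id id_apply
      by (rule has_vector_derivative_transform[OF x _ der]) (rule eq)
  qed
  moreover have "abs_cont_deriv (\<lambda>x. (- ?v x / u x) / (1 / u x)) (\<lambda>x. - g x)"
  proof -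
    have g: "g absolutely_integrable_on {0..pi}" and v: "\<And>x. x \<in> {0..pi} \<Longrightarrow> ?v x = ?v 0 + integral {0..x} g"
      using ac unfolding abs_cont_deriv_def by blast+
    have *: "(- ?v x / u x) / (1 / u x) = - ?v x" if "x \<in> {0..pi}" for x using nz that by simp
    have "(- ?v x / u x) / (1 / u x) = (- ?v 0 / u 0) / (1 / u 0) + integral {0..x} (\<lambda>x. - g x)"
      if x: "x \<in> {0..pi}" for x
    proof -
      have z: "(0::real) \<in> {0..pi}" by simp
      have "integral {0..x} (\<lambda>x. - g x) = - integral {0..x} g" by simp
      then show ?thesis unfolding *[OF x] *[OF z] using v[OF x] by linarith
    qed
    moreover have "(\<lambda>x. - g x) absolutely_integrable_on {0..pi}"
      using set_integrable_mult_right[OF g, of "-1"] by simp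
    ultimately show ?thesis unfolding abs_cont_deriv_def by blast
  qed
  ultimately show ?thesis
    using darboux_potential(1)[OF d] nz unfolding darboux_def by simp
qed

section \<open>Transformation of the boundary conditions and of the spectral data\<close>

text \<open>
  The vector \<open>(down f, - up f)\<close> is mapped by the Darboux transformation to a multiple of the
  corresponding vector for \<open>Theta L \<tau> f\<close>; the factor is \<open>L - \<lambda>\<close> if \<open>f\<close> is the constant \<open>\<tau>\<close>.
\<close>

definition theta_link :: "real \<Rightarrow> real \<Rightarrow> ratfun \<Rightarrow> ratfun \<Rightarrow> real poly \<Rightarrow> bool" where
  "theta_link L \<tau> f f1 a \<longleftrightarrow> f \<in> herglotz \<and> f1 \<in> herglotz \<and>
     smult \<tau> (down f) - up f = a * down f1 \<and>
     smult \<tau> (up f) - smult (\<tau>\<^sup>2 + L) (down f) + pCons 0 (down f) = a * up f1 \<and>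
     a * a * deriv_down_sq f1 = [:- L, 1:] * deriv_down_sq f + (smult \<tau> (down f) - up f) * down f \<and>
     (a = 1 \<and> ind f1 = ind f + 1 \<or> a = [:L, -1:] \<and> ind f1 = ind f - 1)"

lemma theta_link_generic:
  assumes "f \<in> herglotz" "below_poles f L" "\<tau> * poly (down f) L - poly (up f) L > 0"
  shows "theta_link L \<tau> f (Theta L \<tau> f) 1"
proof -
  note T = Theta_generic[OF assms]
  have "deriv_down_sq (Theta L \<tau> f) = [:- L, 1:] * deriv_down_sq f + (smult \<tau> (down f) - up f) * down f"
    unfolding deriv_down_sq_def T
    by (simp add: pderiv_add pderiv_diff pderiv_smult pderiv_pCons fun_eq_iff power2_eq_square algebra_simps
        flip: poly_eq_poly_eq_iff)
  then show ?thesis unfolding theta_link_def using assms(1) T by simp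
qed

text \<open>For \<open>f\<close> constantly \<tau> both sides of the identity for
  \<open>down\<close> are zero, and the one for \<open>up\<close> is
  \<open>\<lambda> - L = (L - \<lambda>) * (-1)\<close>, with -1 the value of \<open>up\<close> for
  the Dirichlet condition.\<close>

lemma theta_link_constant:
  assumes "f \<in> herglotz_of_index 0" "\<tau> * poly (down f) L = poly (up f) L"
  shows "theta_link L \<tau> f (Theta L \<tau> f) [:L, -1:]" "Theta L \<tau> f = None"
proof -
  obtain h where h: "f = Some (pfract [:h:])" "down f = 1" "up f = [:h:]" "f \<in> herglotz"
    using herglotz_of_index_0[OF assms(1)] by blast
  have "\<tau> = h" using assms(2) unfolding h(2,3) by simp
  then show T: "Theta L \<tau> f = None" using h(1) by simp
  have "ind f = 0" using assms(1) by (simp add: herglotz_of_index_def)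
  moreover have "(None :: ratfun) \<in> herglotz" by (simp add: herglotz_def)
  moreover have "deriv_down_sq f = 0" unfolding deriv_down_sq_def h(2,3) by (simp add: pderiv_pCons)
  moreover have "deriv_down_sq None = 0" by (simp add: deriv_down_sq_def)
  moreover have "smult \<tau> [:h:] - smult (\<tau>\<^sup>2 + L) 1 + pCons 0 1 = - [:L, -1:]"
    using \<open>\<tau> = h\<close> by (simp add: power2_eq_square one_pCons)
  ultimately show "theta_link L \<tau> f (Theta L \<tau> f) [:L, -1:]"
    unfolding T theta_link_def h(2,3) using h(4) \<open>\<tau> = h\<close> by simp
qed

lemma theta_link_ind:
  "theta_link L \<tau> f f1 1 \<Longrightarrow> ind f1 = ind f + 1"
  "theta_link L \<tau> f f1 [:L, -1:] \<Longrightarrow> ind f1 = ind f - 1"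
  by (auto simp: theta_link_def one_pCons)

lemma theta_link_values:
  assumes "theta_link L \<tau> f f1 a"
  shows "\<tau> * poly (down f) x - poly (up f) x = poly a x * poly (down f1) x"
    and "\<tau> * poly (up f) x - (\<tau>\<^sup>2 + L - x) * poly (down f) x = poly a x * poly (up f1) x"
    and "(poly a x)\<^sup>2 * poly (deriv_down_sq f1) x =
      (x - L) * poly (deriv_down_sq f) x + (\<tau> * poly (down f) x - poly (up f) x) * poly (down f) x"
    and "x \<noteq> L \<Longrightarrow> poly a x \<noteq> 0"
proof -
  have 1: "smult \<tau> (down f) - up f = a * down f1"
    and 2: "smult \<tau> (up f) - smult (\<tau>\<^sup>2 + L) (down f) + pCons 0 (down f) = a * up f1"
    and 3: "a * a * deriv_down_sq f1 = [:- L, 1:] * deriv_down_sq f + (smult \<tau> (down f) - up f) * down f"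
    and 4: "a = 1 \<or> a = [:L, -1:]"
    using assms by (auto simp: theta_link_def)
  show "\<tau> * poly (down f) x - poly (up f) x = poly a x * poly (down f1) x"
    using arg_cong[OF 1, of "\<lambda>p. poly p x"] by simp
  show "\<tau> * poly (up f) x - (\<tau>\<^sup>2 + L - x) * poly (down f) x = poly a x * poly (up f1) x"
    using arg_cong[OF 2, of "\<lambda>p. poly p x"] by (simp add: algebra_simps)
  have "poly (a * a * deriv_down_sq f1) x =
      poly ([:- L, 1:] * deriv_down_sq f + (smult \<tau> (down f) - up f) * down f) x"
    by (simp only: 3)
  then show "(poly a x)\<^sup>2 * poly (deriv_down_sq f1) x =
      (x - L) * poly (deriv_down_sq f) x + (\<tau> * poly (down f) x - poly (up f) x) * poly (down f) x"
    by (simp add: power2_eq_square algebra_simps)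
  show "x \<noteq> L \<Longrightarrow> poly a x \<noteq> 0" using 4 by auto
qed

text \<open>At \<open>L\<close> the transformed numerator is \<open>-\<tau>\<close> times the
  transformed denominator. With factor 1 this says that \<open>1 / u\<close> satisfies the new
  boundary condition.\<close>

lemma theta_link_at_L:
  assumes "theta_link L \<tau> f f1 a"
  shows "poly a L * poly (up f1) L = - \<tau> * (poly a L * poly (down f1) L)"
  unfolding theta_link_values(1,2)[OF assms, symmetric] by (simp add: power2_eq_square algebra_simps)

lemma theta_link_cvalues:
  assumes "theta_link L \<tau> f f1 a"
  shows "of_real \<tau> * cpoly (down f) z - cpoly (up f) z = cpoly a z * cpoly (down f1) z"
    and "of_real \<tau> * cpoly (up f) z - (of_real (\<tau>\<^sup>2 + L) - z) * cpoly (down f) z = cpoly a z * cpoly (up f1) z"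
    and "z \<noteq> of_real L \<Longrightarrow> cpoly a z \<noteq> 0"
proof -
  have 1: "smult \<tau> (down f) - up f = a * down f1"
    and 2: "smult \<tau> (up f) - smult (\<tau>\<^sup>2 + L) (down f) + pCons 0 (down f) = a * up f1"
    and 4: "a = 1 \<or> a = [:L, -1:]"
    using assms by (auto simp: theta_link_def)
  show "of_real \<tau> * cpoly (down f) z - cpoly (up f) z = cpoly a z * cpoly (down f1) z"
    using arg_cong[OF 1, of "\<lambda>p. cpoly p z"] by simp
  show "of_real \<tau> * cpoly (up f) z - (of_real (\<tau>\<^sup>2 + L) - z) * cpoly (down f) z = cpoly a z * cpoly (up f1) z"
    using arg_cong[OF 2, of "\<lambda>p. cpoly p z"] by (simp add: algebra_simps)
  show "z \<noteq> of_real L \<Longrightarrow> cpoly a z \<noteq> 0" using 4 by auto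
qed

lemma solution_scale:
  fixes l :: real
  assumes "q absolutely_integrable_on {0..pi}" "solution q l y y'"
  shows "solution q l (\<lambda>x. c * y x) (\<lambda>x. c * y' x)"
  using solution_linear[OF assms assms(2), of c 0] by simp

section \<open>One transformation step with both boundary conditions\<close>

text \<open>One step independently of how \<open>u\<close> was chosen. The polynomials
  \<open>a\<close> and \<open>b\<close> record which case of \<open>theta_link\<close> holds at each
  end, so the three domains share everything proved here.\<close>

locale darboux_problem =
  fixes q :: "real \<Rightarrow> real" and L :: real and u u' g :: "real \<Rightarrow> real"
    and f F f1 F1 :: ratfun and a b :: "real poly"
  assumes d: "darboux q L u u' g"
    and link0: "theta_link L (- (u' 0 / u 0)) f f1 a"
    and link1: "theta_link L (u' pi / u pi) F F1 b"
begin

abbreviation q1 :: "real \<Rightarrow> real" where "q1 \<equiv> \<lambda>x. q x - 2 * g x"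
abbreviation v :: "real \<Rightarrow> real" where "v \<equiv> \<lambda>x. u' x / u x"

lemma q: "q absolutely_integrable_on {0..pi}" and sol_u: "solution q L u u'"
  and u_nz: "\<And>x. x \<in> {0..pi} \<Longrightarrow> u x \<noteq> 0"
  using d by (auto simp: darboux_def)

lemma q1: "q1 absolutely_integrable_on {0..pi}"
  using d by (rule darboux_potential(1))

lemma herglotz: "f \<in> herglotz" "F \<in> herglotz" "f1 \<in> herglotz" "F1 \<in> herglotz"
  using link0 link1 by (auto simp: theta_link_def)

lemma ends: "(0::real) \<in> {0..pi}" "pi \<in> {0..pi}"
  by simp_all

lemma darboux_real:
  fixes l :: real
  assumes "solution q l y y'"
  shows "solution q1 l (\<lambda>x. y' x - v x * y x) (\<lambda>x. (L - l) * y x - v x * (y' x - v x * y x))"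
  using darboux_solution[OF d assms] by simp

lemma darboux_phi:
  assumes x: "x \<in> {0..pi}"
  shows "snd (phi q f l) x - v x * fst (phi q f l) x = poly a l * fst (phi q1 f1 l) x"
proof -
  let ?y = "fst (phi q f l)" and ?y' = "snd (phi q f l)"
  note y = phi_spec[OF q, where f = f and l = l] and z = phi_spec[OF q1, where f = f1 and l = l]
  have "?y' 0 - v 0 * ?y 0 = poly a l * poly (down f1) l"
    unfolding y(2,3) theta_link_values(1)[OF link0, symmetric] by simp
  moreover have "(L - l) * ?y 0 - v 0 * (?y' 0 - v 0 * ?y 0) = poly a l * (- poly (up f1) l)"
    unfolding y(2,3) mult_minus_right theta_link_values(2)[OF link0, symmetric]
    by (simp add: power2_eq_square algebra_simps)
  ultimately show ?thesis
    using solution_unique(1)[OF q1 darboux_real[OF y(1)] solution_scale[OF q1 z(1), of "poly a l"] ends(1) _ _ x]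
      z(2,3) by simp
qed

text \<open>The sign differs from \<open>darboux_phi\<close> because \<psi> starts from
  \<open>(down F, up F)\<close> and not from \<open>(down, - up)\<close>.\<close>

lemma darboux_psi:
  assumes x: "x \<in> {0..pi}"
  shows "snd (psi q F l) x - v x * fst (psi q F l) x = - poly b l * fst (psi q1 F1 l) x"
proof -
  let ?y = "fst (psi q F l)" and ?y' = "snd (psi q F l)"
  note y = psi_spec[OF q, where F = F and l = l] and z = psi_spec[OF q1, where F = F1 and l = l]
  have "?y' pi - v pi * ?y pi = - poly b l * poly (down F1) l"
    unfolding y(2,3) mult_minus_left theta_link_values(1)[OF link1, symmetric] by simp
  moreover have "(L - l) * ?y pi - v pi * (?y' pi - v pi * ?y pi) = - poly b l * poly (up F1) l"
    unfolding y(2,3) mult_minus_left theta_link_values(2)[OF link1, symmetric]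
    by (simp add: power2_eq_square algebra_simps)
  ultimately show ?thesis
    using solution_unique(1)[OF q1 darboux_real[OF y(1)] solution_scale[OF q1 z(1), of "- poly b l"] ends(2) _ _ x]
      z(2,3) by simp
qed

text \<open>If \<open>z\<close> vanished, so would its derivative, which is then
  \<open>(L - l) y\<close>; hence \<open>z\<close> is non-trivial. The boundary expressions of
  \<open>z\<close>, multiplied by \<open>a\<close> or \<open>b\<close>, are multiples of those of
  \<open>y\<close>, and for \<open>l \<noteq> L\<close> these factors can be divided out.\<close>

lemma eigenvalue_forward:
  assumes ne: "l \<noteq> of_real L" and ev: "is_eigenvalue q f F l"
  shows "is_eigenvalue q1 f1 F1 l"
proof -
  obtain y y' where s: "solution q l y y'" and nz: "\<exists>x\<in>{0..pi}. y x \<noteq> 0"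
    and b0: "cpoly (down f) l * y' 0 + cpoly (up f) l * y 0 = 0"
    and b1: "cpoly (down F) l * y' pi - cpoly (up F) l * y pi = 0"
    using ev unfolding is_eigenvalue_def by blast
  define V where "V x = complex_of_real (v x)" for x
  define z where "z x = y' x - V x * y x" for x
  define z' where "z' x = (of_real L - l) * y x - V x * z x" for x
  have e0: "cpoly a l * cpoly (down f1) l = - V 0 * cpoly (down f) l - cpoly (up f) l"
      "cpoly a l * cpoly (up f1) l = - V 0 * cpoly (up f) l - ((V 0)\<^sup>2 + of_real L - l) * cpoly (down f) l"
    using theta_link_cvalues(1,2)[OF link0, of l] by (simp_all add: V_def)
  have e1: "cpoly b l * cpoly (down F1) l = V pi * cpoly (down F) l - cpoly (up F) l"
      "cpoly b l * cpoly (up F1) l = V pi * cpoly (up F) l - ((V pi)\<^sup>2 + of_real L - l) * cpoly (down F) l"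
    using theta_link_cvalues(1,2)[OF link1, of l] by (simp_all add: V_def)
  have sz: "solution q1 l z z'"
    using darboux_solution[OF d s] unfolding z_def z'_def V_def .
  have "\<exists>x\<in>{0..pi}. z x \<noteq> 0"
  proof (rule ccontr)
    assume "\<not> ?thesis"
    then have z0: "\<And>x. x \<in> {0..pi} \<Longrightarrow> z x = 0" by blast
    have "y x = 0" if x: "x \<in> {0..pi}" for x
      using solution_vanishing[OF sz z0 x] z0[OF x] ne by (simp add: z'_def)
    then show False using nz by blast
  qed
  moreover have "cpoly (down f1) l * z' 0 + cpoly (up f1) l * z 0 = 0"
  proof -
    have "cpoly a l * (cpoly (down f1) l * z' 0 + cpoly (up f1) l * z 0) =
        (cpoly a l * cpoly (down f1) l) * z' 0 + (cpoly a l * cpoly (up f1) l) * z 0"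
      by (simp add: algebra_simps)
    also have "\<dots> = - ((of_real L - l) * (cpoly (down f) l * y' 0 + cpoly (up f) l * y 0))"
      unfolding e0 z'_def z_def
      by (simp add: power2_eq_square algebra_simps)
    also have "\<dots> = 0" unfolding b0 by simp
    finally show ?thesis using theta_link_cvalues(3)[OF link0 ne] by simp
  qed
  moreover have "cpoly (down F1) l * z' pi - cpoly (up F1) l * z pi = 0"
  proof -
    have "cpoly b l * (cpoly (down F1) l * z' pi - cpoly (up F1) l * z pi) =
        (cpoly b l * cpoly (down F1) l) * z' pi - (cpoly b l * cpoly (up F1) l) * z pi"
      by (simp add: algebra_simps)
    also have "\<dots> = (of_real L - l) * (cpoly (down F) l * y' pi - cpoly (up F) l * y pi)"
      unfolding e1 z'_def z_def
      by (simp add: power2_eq_square algebra_simps)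
    also have "\<dots> = 0" unfolding b1 by simp
    finally show ?thesis using theta_link_cvalues(3)[OF link1 ne] by simp
  qed
  ultimately show ?thesis using sz unfolding is_eigenvalue_def by blast
qed

text \<open>The dual transformation with \<open>1 / u\<close> brings \<open>z\<close> back to the
  old potential; here the boundary expressions of \<open>y\<close> are \<open>- a\<close> and
  \<open>b\<close> times those of \<open>z\<close>.\<close>

lemma eigenvalue_backward:
  assumes ne: "l \<noteq> of_real L" and ev: "is_eigenvalue q1 f1 F1 l"
  shows "is_eigenvalue q f F l"
proof -
  obtain z z' where s: "solution q1 l z z'" and nz: "\<exists>x\<in>{0..pi}. z x \<noteq> 0"
    and b0: "cpoly (down f1) l * z' 0 + cpoly (up f1) l * z 0 = 0"
    and b1: "cpoly (down F1) l * z' pi - cpoly (up F1) l * z pi = 0"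
    using ev unfolding is_eigenvalue_def by blast
  define V where "V x = complex_of_real ((- v x / u x) / (1 / u x))" for x
  have V: "V x = - of_real (v x)" if "x \<in> {0..pi}" for x
    using u_nz[OF that] by (simp add: V_def)
  have e0: "cpoly a l * cpoly (down f1) l = V 0 * cpoly (down f) l - cpoly (up f) l"
      "cpoly a l * cpoly (up f1) l = V 0 * cpoly (up f) l - ((V 0)\<^sup>2 + of_real L - l) * cpoly (down f) l"
    using theta_link_cvalues(1,2)[OF link0, of l] unfolding V[OF ends(1)] by simp_all
  have e1: "cpoly b l * cpoly (down F1) l = - V pi * cpoly (down F) l - cpoly (up F) l"
      "cpoly b l * cpoly (up F1) l = - V pi * cpoly (up F) l - ((V pi)\<^sup>2 + of_real L - l) * cpoly (down F) l"
    using theta_link_cvalues(1,2)[OF link1, of l] unfolding V[OF ends(2)] by simp_all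
  define y where "y x = z' x - V x * z x" for x
  define y' where "y' x = (of_real L - l) * z x - V x * y x" for x
  have "solution (\<lambda>x. q1 x - 2 * (- g x)) l y y'"
    using darboux_solution[OF darboux_dual[OF d] s] unfolding y_def y'_def V_def .
  then have sy: "solution q l y y'" by simp
  have "\<exists>x\<in>{0..pi}. y x \<noteq> 0"
  proof (rule ccontr)
    assume "\<not> ?thesis"
    then have y0: "\<And>x. x \<in> {0..pi} \<Longrightarrow> y x = 0" by blast
    have "z x = 0" if x: "x \<in> {0..pi}" for x
      using solution_vanishing[OF sy y0 x] y0[OF x] ne by (simp add: y'_def)
    then show False using nz by blast
  qed
  moreover have "cpoly (down f) l * y' 0 + cpoly (up f) l * y 0 = 0"
  proof -
    have "cpoly (down f) l * y' 0 + cpoly (up f) l * y 0 =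
        - (cpoly a l * cpoly (down f1) l) * z' 0 - (cpoly a l * cpoly (up f1) l) * z 0"
      unfolding e0 y'_def y_def
      by (simp add: power2_eq_square algebra_simps)
    also have "\<dots> = - cpoly a l * (cpoly (down f1) l * z' 0 + cpoly (up f1) l * z 0)"
      by (simp add: algebra_simps)
    also have "\<dots> = 0" unfolding b0 by simp
    finally show ?thesis .
  qed
  moreover have "cpoly (down F) l * y' pi - cpoly (up F) l * y pi = 0"
  proof -
    have "cpoly (down F) l * y' pi - cpoly (up F) l * y pi =
        (cpoly b l * cpoly (down F1) l) * z' pi - (cpoly b l * cpoly (up F1) l) * z pi"
      unfolding e1 y'_def y_def
      by (simp add: power2_eq_square algebra_simps)
    also have "\<dots> = cpoly b l * (cpoly (down F1) l * z' pi - cpoly (up F1) l * z pi)"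
      by (simp add: algebra_simps)
    also have "\<dots> = 0" unfolding b1 by simp
    finally show ?thesis .
  qed
  ultimately show ?thesis using sy unfolding is_eigenvalue_def by blast
qed

lemma eigenvalue_iff:
  "l \<noteq> of_real L \<Longrightarrow> is_eigenvalue q1 f1 F1 l \<longleftrightarrow> is_eigenvalue q f F l"
  using eigenvalue_forward eigenvalue_backward by blast

text \<open>The boundary terms \<open>z * y\<close> from the integration are exactly what the
  identity for \<open>deriv_down_sq\<close> in \<open>theta_link\<close> contributes at the two
  ends, with opposite sign, so everything but the factor \<open>l - L\<close> cancels.\<close>

lemma norming_constant_transformed:
  assumes ne: "l \<noteq> L" and chi: "chi q f F l = 0"
  shows "(poly a l)\<^sup>2 * norming_constant q1 f1 F1 l = (l - L) * norming_constant q f F l"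
proof -
  define y y' where "y = fst (phi q f l)" and "y' = snd (phi q f l)"
  define z where "z x = y' x - v x * y x" for x
  define \<beta> where "\<beta> = beta q f F l"
  note B = psi_eq_beta_phi[OF q herglotz(1,2) chi, folded \<beta>_def]
  have a0: "poly a l \<noteq> 0" and b0: "poly b l \<noteq> 0"
    using theta_link_values(4)[OF link0 ne] theta_link_values(4)[OF link1 ne] by auto
  have sy: "solution q l y y'" using phi_spec(1)[OF q] by (simp add: y_def y'_def)
  have sz: "solution q1 l z (\<lambda>x. (L - l) * y x - v x * z x)"
    using darboux_real[OF sy] unfolding z_def .
  have z_phi: "z x = poly a l * fst (phi q1 f1 l) x" if "x \<in> {0..pi}" for x
    using darboux_phi[OF that] by (simp add: z_def y_def y'_def)
  have "is_eigenvalue q f F (of_real l)" using is_eigenvalue_of_real_iff[OF q herglotz(1)] chi by simp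
  then have "is_eigenvalue q1 f1 F1 (of_real l)" using eigenvalue_forward ne by simp
  then have chi1: "chi q1 f1 F1 l = 0" using is_eigenvalue_of_real_iff[OF q1 herglotz(3)] by simp
  define \<beta>1 where "\<beta>1 = beta q1 f1 F1 l"
  note B1 = psi_eq_beta_phi[OF q1 herglotz(3,4) chi1, folded \<beta>1_def]
  obtain x0 where x0: "x0 \<in> {0..pi}" "fst (phi q1 f1 l) x0 \<noteq> 0"
    using phi_not_identically_zero[OF q1 herglotz(3)] by blast
  have "- poly b l * (\<beta>1 * fst (phi q1 f1 l) x0) = snd (psi q F l) x0 - v x0 * fst (psi q F l) x0"
    using darboux_psi[OF x0(1)] B1(2)[OF x0(1)] by simp
  also have "\<dots> = \<beta> * z x0" using B(2,3)[OF x0(1)] by (simp add: z_def y_def y'_def algebra_simps)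
  also have "\<dots> = \<beta> * poly a l * fst (phi q1 f1 l) x0" by (simp add: z_phi[OF x0(1)])
  finally have "(- poly b l * \<beta>1) * fst (phi q1 f1 l) x0 = (\<beta> * poly a l) * fst (phi q1 f1 l) x0"
    by (simp only: mult.assoc)
  \<comment> \<open>Two ways of transforming the relation between \<psi> and \<phi>. Squared, this
    converts the weight of the right boundary term from \<open>\<beta>1\<close> to
    \<open>\<beta>\<close>.\<close>
  then have bb: "- poly b l * \<beta>1 = \<beta> * poly a l" unfolding mult_right_cancel[OF x0(2)] .
  have coef: "(poly a l)\<^sup>2 * (1 / \<beta>1\<^sup>2) = (poly b l)\<^sup>2 * (1 / \<beta>\<^sup>2)"
  proof -
    have "(poly b l * \<beta>1)\<^sup>2 = (\<beta> * poly a l)\<^sup>2" unfolding bb[symmetric] by simp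
    then show ?thesis using B(1) B1(1) by (simp add: field_simps power_mult_distrib)
  qed
  have cy: "continuous_on {0..pi} (\<lambda>x. (y x)\<^sup>2)" and cz: "continuous_on {0..pi} (\<lambda>x. (z x)\<^sup>2)"
    using solution_continuous[OF sy] solution_continuous[OF sz] by (auto intro: continuous_on_power)
  have iy: "((\<lambda>x. (y x)\<^sup>2) has_integral integral {0..pi} (\<lambda>x. (y x)\<^sup>2)) {0..pi}"
    and iz: "((\<lambda>x. (z x)\<^sup>2) has_integral integral {0..pi} (\<lambda>x. (z x)\<^sup>2)) {0..pi}"
    using integrable_continuous_real[OF cy] integrable_continuous_real[OF cz] by (auto intro: integrable_integral)
  have der: "((\<lambda>x. z x * y x) has_vector_derivative (z x)\<^sup>2 + (L - l) * (y x)\<^sup>2) (at x within {0..pi})"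
    if x: "x \<in> {0..pi}" for x
    unfolding has_real_derivative_iff_has_vector_derivative[symmetric]
    by (rule DERIV_cong[OF DERIV_mult[OF solution_deriv[OF sz x] solution_deriv[OF sy x]]])
       (simp add: z_def power2_eq_square algebra_simps)
  have "((\<lambda>x. (z x)\<^sup>2 + (L - l) * (y x)\<^sup>2) has_integral z pi * y pi - z 0 * y 0) {0..pi}"
    by (rule fundamental_theorem_of_calculus) (use der in auto)
  moreover have "((\<lambda>x. (z x)\<^sup>2 + (L - l) * (y x)\<^sup>2) has_integral
      integral {0..pi} (\<lambda>x. (z x)\<^sup>2) + (L - l) * integral {0..pi} (\<lambda>x. (y x)\<^sup>2)) {0..pi}"
    by (intro has_integral_add has_integral_mult_right iy iz)
  ultimately have main: "integral {0..pi} (\<lambda>x. (z x)\<^sup>2) + (L - l) * integral {0..pi} (\<lambda>x. (y x)\<^sup>2) =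
      z pi * y pi - z 0 * y 0"
    using has_integral_unique by blast
  have "integral {0..pi} (\<lambda>x. (z x)\<^sup>2) = integral {0..pi} (\<lambda>x. (poly a l)\<^sup>2 * (fst (phi q1 f1 l) x)\<^sup>2)"
    by (rule integral_cong) (simp add: z_phi power_mult_distrib)
  then have int_z: "integral {0..pi} (\<lambda>x. (z x)\<^sup>2) = (poly a l)\<^sup>2 * integral {0..pi} (\<lambda>x. (fst (phi q1 f1 l) x)\<^sup>2)"
    by (simp only: integral_mult_right)
  have zy0: "z 0 * y 0 = (- v 0 * poly (down f) l - poly (up f) l) * poly (down f) l"
    unfolding z_def y_def y'_def phi_spec[OF q] by simp
  have ypi: "y pi = poly (down F) l / \<beta>" "y' pi = poly (up F) l / \<beta>"
    using B(1) B(2,3)[OF ends(2)] psi_spec(2,3)[OF q, where F = F and l = l] by (simp_all add: y_def y'_def)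
  have zypi: "z pi * y pi = - (1 / \<beta>\<^sup>2) * ((v pi * poly (down F) l - poly (up F) l) * poly (down F) l)"
  proof -
    have "(U / r - V * (D / r)) * (D / r) = - (1 / r\<^sup>2) * ((V * D - U) * D)" if "r \<noteq> 0" for U V D r :: real
      using that by (simp add: power2_eq_square field_simps)
    from this[OF B(1)] show ?thesis unfolding z_def ypi .
  qed
  have "(poly a l)\<^sup>2 * norming_constant q1 f1 F1 l =
      (poly a l)\<^sup>2 * integral {0..pi} (\<lambda>x. (fst (phi q1 f1 l) x)\<^sup>2) + (poly a l)\<^sup>2 * poly (deriv_down_sq f1) l
      + ((poly a l)\<^sup>2 * (1 / \<beta>1\<^sup>2)) * poly (deriv_down_sq F1) l"
    unfolding norming_constant_def \<beta>1_def by (simp add: algebra_simps)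
  also have "\<dots> = integral {0..pi} (\<lambda>x. (z x)\<^sup>2) + (poly a l)\<^sup>2 * poly (deriv_down_sq f1) l
      + (1 / \<beta>\<^sup>2) * ((poly b l)\<^sup>2 * poly (deriv_down_sq F1) l)"
    unfolding coef int_z by (simp only: mult_ac)
  also have "\<dots> = (l - L) * integral {0..pi} (\<lambda>x. (y x)\<^sup>2) + z pi * y pi - z 0 * y 0
      + (poly a l)\<^sup>2 * poly (deriv_down_sq f1) l + (1 / \<beta>\<^sup>2) * ((poly b l)\<^sup>2 * poly (deriv_down_sq F1) l)"
    using main by (simp add: algebra_simps)
  also have "\<dots> = (l - L) * (integral {0..pi} (\<lambda>x. (y x)\<^sup>2) + poly (deriv_down_sq f) l
      + 1 / \<beta>\<^sup>2 * poly (deriv_down_sq F) l)"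
    unfolding zy0 zypi theta_link_values(3)[OF link0] theta_link_values(3)[OF link1]
    by (simp add: algebra_simps add_divide_distrib diff_divide_distrib)
  also have "\<dots> = (l - L) * norming_constant q f F l"
    unfolding norming_constant_def \<beta>_def y_def ..
  finally show ?thesis .
qed

section \<open>The point \<open>L\<close> in the transformed problem\<close>

text \<open>With left factor 1, \<open>1 / u\<close> meets the new left condition at
  \<open>L\<close>, so \<phi> is a multiple of it, fixed by the value at 0.\<close>

lemma phi_at_L:
  assumes x: "x \<in> {0..pi}" and a: "a = 1"
  shows "fst (phi q1 f1 L) x = poly (down f1) L * u 0 / u x"
    and "snd (phi q1 f1 L) x = poly (down f1) L * u 0 * (- v x / u x)"
proof -
  let ?c = "poly (down f1) L * u 0"
  have s: "solution q1 L (\<lambda>x. 1 / u x) (\<lambda>x. - v x / u x)"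
    using darboux_dual[OF d] by (simp add: darboux_def)
  have "poly (up f1) L = - (- v 0) * poly (down f1) L"
    using theta_link_at_L[OF link0] a by simp
  then show "fst (phi q1 f1 L) x = poly (down f1) L * u 0 / u x"
    and "snd (phi q1 f1 L) x = poly (down f1) L * u 0 * (- v x / u x)"
    using solution_unique[OF q1 phi_spec(1)[OF q1] solution_scale[OF q1 s, of ?c] ends(1) _ _ x]
      phi_spec(2,3)[OF q1, where f = f1 and l = L] u_nz[OF ends(1)] by simp_all
qed

lemma up_F1_at_L: "b = 1 \<Longrightarrow> poly (up F1) L = - v pi * poly (down F1) L"
  using theta_link_at_L[OF link1] by simp

lemma psi_at_L:
  assumes x: "x \<in> {0..pi}" and b: "b = 1"
  shows "fst (psi q1 F1 L) x = poly (down F1) L * u pi / u x"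
proof -
  let ?c = "poly (down F1) L * u pi"
  have s: "solution q1 L (\<lambda>x. 1 / u x) (\<lambda>x. - v x / u x)"
    using darboux_dual[OF d] by (simp add: darboux_def)
  show ?thesis
    using solution_unique(1)[OF q1 psi_spec(1)[OF q1] solution_scale[OF q1 s, of ?c] ends(2) _ _ x]
      psi_spec(2,3)[OF q1, where F = F1 and l = L] u_nz[OF ends(2)] up_F1_at_L[OF b] by simp
qed

lemma chi_at_L:
  assumes "a = 1" "b = 1"
  shows "chi q1 f1 F1 L = 0"
  unfolding chi_def phi_at_L[OF ends(2) assms(1)] up_F1_at_L[OF assms(2)] by simp

text \<open>The squared eigenfunction is a multiple of \<open>1 / u\<^sup>2\<close>, and with
  \<open>p\<close> the old \<psi> the quotient \<open>p / u\<close> has derivative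
  \<open>W / u\<^sup>2\<close>, so the integral is explicit. Taking \<psi> makes its boundary term
  at \<open>pi\<close> a multiple of \<open>down F\<close>, which cancels the contribution of
  \<open>F1\<close>; only data at 0 remain.\<close>

lemma norming_constant_at_L:
  assumes a: "a = 1" and b: "b = 1" and D: "poly (down f1) L \<noteq> 0" and E: "poly (down F1) L \<noteq> 0"
  shows "norming_constant q1 f1 F1 L = poly (down f1) L * poly (down f) L -
    (poly (down f1) L)\<^sup>2 * u 0 * fst (psi q F L) 0 / (u 0 * snd (psi q F L) 0 - u' 0 * fst (psi q F L) 0)"
proof -
  define D E where "D = poly (down f1) L" and "E = poly (down F1) L"
  have D0: "D \<noteq> 0" and E0: "E \<noteq> 0" using assms by (auto simp: D_def E_def)
  define p p' where "p = fst (psi q F L)" and "p' = snd (psi q F L)"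
  \<comment> \<open>The constant Wronskian of \<open>u\<close> and \<psi>. Its value at
    \<open>pi\<close> is \<open>- u pi * E\<close>, non-zero by assumption, so it may be divided
    by.\<close>
  define W where "W = u 0 * p' 0 - p 0 * u' 0"
  have sp: "solution q L p p'" using psi_spec(1)[OF q] by (simp add: p_def p'_def)
  have u0: "u 0 \<noteq> 0" and upi: "u pi \<noteq> 0" using u_nz ends by auto
  have WE: "W = - (u pi * E)"
  proof -
    have "W = u pi * p' pi - p pi * u' pi"
      using wronskian_constant[OF q sol_u sp ends(2)] by (simp add: wronskian_def W_def)
    also have "\<dots> = - (u pi * (v pi * poly (down F) L - poly (up F) L))"
      using upi psi_spec(2,3)[OF q, where F = F and l = L] by (simp add: p_def p'_def field_simps)
    also have "v pi * poly (down F) L - poly (up F) L = E"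
      using theta_link_values(1)[OF link1, of L] b by (simp add: E_def)
    finally show ?thesis .
  qed
  then have W0: "W \<noteq> 0" using upi E0 by simp
  have "((\<lambda>x. W / (u x)\<^sup>2) has_integral p pi / u pi - p 0 / u 0) {0..pi}"
  proof (rule fundamental_theorem_of_calculus)
    fix x assume x: "x \<in> {0..pi}"
    have "u x * p' x - p x * u' x = W"
      using wronskian_constant[OF q sol_u sp x] by (simp add: wronskian_def W_def)
    then have eq: "(p' x * u x - p x * u' x) / (u x * u x) = W / (u x)\<^sup>2"
      by (simp add: power2_eq_square mult.commute)
    show "((\<lambda>x. p x / u x) has_vector_derivative W / (u x)\<^sup>2) (at x within {0..pi})"
      unfolding has_real_derivative_iff_has_vector_derivative[symmetric]
      by (rule DERIV_cong[OF DERIV_divide[OF solution_deriv[OF sp x] solution_deriv[OF sol_u x] u_nz[OF x]] eq])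
  qed simp
  from has_integral_mult_right[OF this, of "(D * u 0)\<^sup>2 / W"]
  have "((\<lambda>x. (D * u 0)\<^sup>2 / W * (W / (u x)\<^sup>2)) has_integral (D * u 0)\<^sup>2 / W * (p pi / u pi - p 0 / u 0)) {0..pi}" .
  moreover have "integral {0..pi} (\<lambda>x. (fst (phi q1 f1 L) x)\<^sup>2) = integral {0..pi} (\<lambda>x. (D * u 0)\<^sup>2 / W * (W / (u x)\<^sup>2))"
    by (rule integral_cong) (use W0 in \<open>simp add: phi_at_L(1)[OF _ a] D_def power_divide\<close>)
  ultimately have int: "integral {0..pi} (\<lambda>x. (fst (phi q1 f1 L) x)\<^sup>2) = (D * u 0)\<^sup>2 / W * (p pi / u pi - p 0 / u 0)"
    by (simp only: integral_unique)
  have chi1: "chi q1 f1 F1 L = 0" using a b by (rule chi_at_L)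
  have "E * u pi / u 0 = beta q1 f1 F1 L * D"
    using psi_eq_beta_phi(2)[OF q1 herglotz(3,4) chi1 ends(1)] psi_at_L[OF ends(1) b] phi_at_L(1)[OF ends(1) a] u0
    by (simp add: D_def E_def)
  then have "beta q1 f1 F1 L = (E * u pi / u 0) / D" using D0 by simp
  then have beta: "1 / (beta q1 f1 F1 L)\<^sup>2 = (D * u 0)\<^sup>2 / (E * u pi)\<^sup>2"
    by (simp add: power_divide field_simps)
  have f1: "poly (deriv_down_sq f1) L = D * poly (down f) L"
    using theta_link_values(1,3)[OF link0, of L] a by (simp add: D_def)
  have F1: "poly (deriv_down_sq F1) L = E * poly (down F) L"
    using theta_link_values(1,3)[OF link1, of L] b by (simp add: E_def)
  have ppi: "p pi = poly (down F) L" using psi_spec(2)[OF q] by (simp add: p_def)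
  have "norming_constant q1 f1 F1 L = (D * u 0)\<^sup>2 / W * (poly (down F) L / u pi - p 0 / u 0) + D * poly (down f) L
      + (D * u 0)\<^sup>2 / (E * u pi)\<^sup>2 * (E * poly (down F) L)"
    unfolding norming_constant_def int beta f1 F1 ppi ..
  also have "(D * u 0)\<^sup>2 / (E * u pi)\<^sup>2 * (E * poly (down F) L) = - ((D * u 0)\<^sup>2 / W * (poly (down F) L / u pi))"
    unfolding WE using E0 upi by (simp add: field_simps power2_eq_square)
  also have "(D * u 0)\<^sup>2 / W * (poly (down F) L / u pi - p 0 / u 0) + D * poly (down f) L
      + - ((D * u 0)\<^sup>2 / W * (poly (down F) L / u pi)) = D * poly (down f) L - D\<^sup>2 * u 0 * p 0 / W"
    using u0 W0 by (simp add: field_simps power2_eq_square)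
  finally show ?thesis unfolding D_def p_def p'_def W_def by (simp only: mult.commute)
qed

text \<open>\<open>chi\<close> is a non-zero multiple of the Wronskian of \<open>1 / u\<close> with
  \<phi>, which equals \<open>1 / u 0\<close>.\<close>

lemma chi_at_L_left_Dirichlet:
  assumes f1: "f1 = None" and b: "b = 1" and E: "poly (down F1) L \<noteq> 0"
  shows "chi q1 f1 F1 L \<noteq> 0"
proof -
  define z z' where "z = fst (phi q1 f1 L)" and "z' = snd (phi q1 f1 L)"
  have sz: "solution q1 L z z'" and z0: "z 0 = 0" "z' 0 = 1"
    using phi_spec[OF q1, where f = f1 and l = L] f1 by (simp_all add: z_def z'_def)
  have "wronskian (\<lambda>x. 1 / u x, \<lambda>x. - v x / u x) (z, z') pi = wronskian (\<lambda>x. 1 / u x, \<lambda>x. - v x / u x) (z, z') 0"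
    using darboux_dual[OF d] sz by (intro wronskian_constant[OF q1 _ _ ends(2), where l = L]) (auto simp: darboux_def)
  then have "(z' pi + v pi * z pi) / u pi = 1 / u 0"
    using z0 by (simp add: wronskian_def add_divide_distrib mult.commute)
  then have "z' pi + v pi * z pi \<noteq> 0" using u_nz[OF ends(1)] by auto
  moreover have "chi q1 f1 F1 L = poly (down F1) L * (z' pi + v pi * z pi)"
    unfolding chi_def up_F1_at_L[OF b] z_def z'_def by (simp add: algebra_simps)
  ultimately show ?thesis using E by simp
qed

text \<open>Here \<open>chi\<close> is the value of \<phi> at \<open>pi\<close>, and \<phi> is a
  non-zero multiple of \<open>1 / u\<close>.\<close>

lemma chi_at_L_right_Dirichlet:
  assumes F1: "F1 = None" and a: "a = 1" and D: "poly (down f1) L \<noteq> 0"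
  shows "chi q1 f1 F1 L \<noteq> 0"
  using D u_nz[OF ends(1)] u_nz[OF ends(2)] by (simp add: chi_def F1 phi_at_L(1)[OF ends(2) a])

end

context darboux_problem
begin

lemma norming_constant_powi:
  assumes "l > L" "chi q f F l = 0"
  shows "norming_constant q1 f1 F1 l = norming_constant q f F l * (l - L) powi (ind f1 - ind f)"
proof -
  have *: "(poly a l)\<^sup>2 * norming_constant q1 f1 F1 l = (l - L) * norming_constant q f F l"
    using assms by (intro norming_constant_transformed) auto
  consider "a = 1" "ind f1 - ind f = 1" | "a = [:L, -1:]" "ind f1 - ind f = -1"
    using link0 unfolding theta_link_def by fastforce
  then show ?thesis
  proof cases
    case 1
    then show ?thesis using * by (simp add: mult.commute)
  next
    case 2
    \<comment> \<open>The square exceeds the single factor \<open>l - L\<close> on the other side by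
      one power, which survives as an inverse.\<close>
    have "(poly a l)\<^sup>2 = (l - L) * (l - L)" unfolding 2(1) by (simp add: power2_eq_square algebra_simps)
    then have "(l - L) * norming_constant q1 f1 F1 l = norming_constant q f F l"
      using * assms(1) by (simp add: mult.assoc)
    then have "norming_constant q1 f1 F1 l = norming_constant q f F l / (l - L)"
      using assms(1) by (simp add: field_simps)
    then show ?thesis unfolding 2(2) by (simp add: power_int_minus divide_inverse)
  qed
qed

text \<open>Away from \<open>L\<close> the eigenvalues agree, so the only question is whether
  \<open>L\<close> joins them. Lying below \<open>lam 0\<close>, it then takes the number
  -1.\<close>

lemma spectral_data_transformed:
  assumes sd: "spectral_data q f F {0..} lam gam" and below: "L < lam 0"
    and gam1: "\<And>n. n \<ge> 0 \<Longrightarrow> gam1 n = gam n * (lam n - L) powi (ind f1 - ind f)"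
    and N: "N = {0..} \<and> chi q1 f1 F1 L \<noteq> 0 \<or>
      N = {-1..} \<and> chi q1 f1 F1 L = 0 \<and> lam (-1) = L \<and> gam1 (-1) = norming_constant q1 f1 F1 L"
  shows "spectral_data q1 f1 F1 N lam gam1"
proof -
  have mono: "strict_mono_on {0..} lam"
    and eig: "{l. is_eigenvalue q f F l} = (\<lambda>n. complex_of_real (lam n)) ` {0..}"
    and gam: "\<And>n. n \<ge> 0 \<Longrightarrow> gam n = norming_constant q f F (lam n)"
    using sd unfolding spectral_data_def by auto
  have gt: "L < lam n" if "n \<ge> 0" for n
    using strict_mono_onD[OF mono, of 0 n] below that by (cases "n = 0") auto
  have adm: "admissible q1 f1 F1" using q1 herglotz(3,4) by (simp add: admissible_def)
  have L_eig: "is_eigenvalue q1 f1 F1 (of_real L) \<longleftrightarrow> chi q1 f1 F1 L = 0"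
    using q1 herglotz(3) by (rule is_eigenvalue_of_real_iff)
  have gam1': "gam1 n = norming_constant q1 f1 F1 (lam n)" if n: "n \<ge> 0" for n
  proof -
    have "is_eigenvalue q f F (of_real (lam n))" using eig n by blast
    then have "chi q f F (lam n) = 0" using is_eigenvalue_of_real_iff[OF q herglotz(1)] by simp
    from norming_constant_powi[OF gt[OF n] this] show ?thesis using gam1[OF n] gam[OF n] by simp
  qed
  have not_L: "complex_of_real L \<notin> (\<lambda>n. complex_of_real (lam n)) ` {0..}" using gt by force
  from N show ?thesis
  proof
    assume N: "N = {0..} \<and> chi q1 f1 F1 L \<noteq> 0"
    have "is_eigenvalue q1 f1 F1 l \<longleftrightarrow> is_eigenvalue q f F l" for l
      using eigenvalue_iff[of l] L_eig N not_L eig by (cases "l = of_real L") auto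
    then have "{l. is_eigenvalue q1 f1 F1 l} = (\<lambda>n. complex_of_real (lam n)) ` {0..}"
      unfolding eig[symmetric] by (rule Collect_cong)
    then show ?thesis using N adm mono gam1' unfolding spectral_data_def by (simp only: atLeast_iff) blast
  next
    assume N: "N = {-1..} \<and> chi q1 f1 F1 L = 0 \<and> lam (-1) = L \<and> gam1 (-1) = norming_constant q1 f1 F1 L"
    have "{-1..} = insert (-1) {0::int..}" by auto
    then have N': "N = insert (-1) {0..}" using N by simp
    have "is_eigenvalue q1 f1 F1 l \<longleftrightarrow> l = of_real L \<or> is_eigenvalue q f F l" for l
      using eigenvalue_iff[of l] L_eig N by (cases "l = of_real L") auto
    then have "{l. is_eigenvalue q1 f1 F1 l} = insert (of_real L) {l. is_eigenvalue q f F l}" by auto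
    also have "\<dots> = (\<lambda>n. complex_of_real (lam n)) ` N" unfolding eig N' using N by simp
    finally have 1: "{l. is_eigenvalue q1 f1 F1 l} = (\<lambda>n. complex_of_real (lam n)) ` N" .
    have 2: "strict_mono_on N lam"
    proof (rule strict_mono_onI)
      fix m n assume mn: "m \<in> N" "n \<in> N" "m < n"
      then have "n \<ge> 0" by (auto simp: N')
      then show "lam m < lam n"
        using mn gt[of n] strict_mono_onD[OF mono, of m n] N by (cases "m = -1") (auto simp: N')
    qed
    have "gam1 n = norming_constant q1 f1 F1 (lam n)" if "n \<in> N" for n
      using that gam1' N by (auto simp: N')
    then show ?thesis using adm 1 2 unfolding spectral_data_def by blast
  qed
qed

end

section \<open>Positivity of \<psi> and the choice of \<tau>\<close>

text \<open>The quotient of \<psi> by \<phi> has derivative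
  \<open>- chi / \<phi>\<^sup>2 < 0\<close> and is non-negative at \<open>pi\<close>, hence positive
  before. Where \<phi> vanishes, at 0 under a Dirichlet condition, the Wronskian gives the value
  \<open>chi\<close> directly.\<close>

lemma psi_nonnegative:
  assumes q: "q absolutely_integrable_on {0..pi}" and f: "f \<in> herglotz" and F: "F \<in> herglotz"
    and osc: "oscillation_free q f F l"
  shows "x \<in> {0..<pi} \<Longrightarrow> fst (psi q F l) x > 0" "fst (psi q F l) pi \<ge> 0"
proof -
  define y y' p p' where "y = fst (phi q f l)" and "y' = snd (phi q f l)"
    and "p = fst (psi q F l)" and "p' = snd (psi q F l)"
  have sy: "solution q l y y'" and sp: "solution q l p p'"
    using phi_spec(1)[OF q] psi_spec(1)[OF q] by (simp_all add: y_def y'_def p_def p'_def)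
  have bf: "below_poles f l" and bF: "below_poles F l" and chi: "chi q f F l > 0"
    and pos: "\<And>x. x \<in> {0<..pi} \<Longrightarrow> y x > 0"
    using osc by (auto simp: oscillation_free_def y_def)
  have W: "y x * p' x - p x * y' x = - chi q f F l" if "x \<in> {0..pi}" for x
    using wronskian_phi_psi[OF q that] by (simp add: wronskian_def y_def y'_def p_def p'_def)
  have "poly (down F) l \<ge> 0" using down_pos[OF F _ bF] by (cases F) (auto intro: less_imp_le simp del: down.simps(2))
  then show ppi: "fst (psi q F l) pi \<ge> 0" using psi_spec(2)[OF q] by simp
  assume x: "x \<in> {0..<pi}"
  show "fst (psi q F l) x > 0"
  proof (cases "y x > 0")
    case True
    have yt: "y t > 0" if "t \<in> {x..pi}" for t using that True pos[of t] x by (cases "t = x") auto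
    have der: "((\<lambda>t. p t / y t) has_real_derivative - chi q f F l / (y t * y t)) (at t within {0..pi})"
      if t: "t \<in> {x..pi}" for t
    proof -
      have t': "t \<in> {0..pi}" using t x by auto
      have eq: "(p' t * y t - p t * y' t) / (y t * y t) = - chi q f F l / (y t * y t)"
        using W[OF t'] by (simp add: mult.commute)
      show ?thesis
        using DERIV_cong[OF DERIV_divide[OF solution_deriv[OF sp t'] solution_deriv[OF sy t']] eq] yt[OF t] by simp
    qed
    have "continuous_on {x..pi} (\<lambda>t. p t / y t)"
      by (rule DERIV_continuous_on) (rule DERIV_subset[OF der], use x in auto)
    moreover have der_at: "((\<lambda>t. p t / y t) has_real_derivative - chi q f F l / (y t * y t)) (at t)"
      if "x < t" "t < pi" for t
      using der[of t] x that by (simp add: at_within_Icc_at)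
    moreover have "x < pi" using x by simp
    ultimately obtain c t where t: "x < t" "t < pi" "((\<lambda>t. p t / y t) has_real_derivative c) (at t)"
      "p pi / y pi - p x / y x = (pi - x) * c"
      using MVT[of x pi "\<lambda>t. p t / y t"] real_differentiable_def by blast
    have c: "c = - chi q f F l / (y t * y t)" using DERIV_unique[OF t(3) der_at[OF t(1,2)]] .
    have "(pi - x) * (- chi q f F l / (y t * y t)) < 0"
      using t x chi yt[of t] by (intro mult_pos_neg divide_neg_pos) auto
    moreover have "p pi / y pi \<ge> 0" using ppi yt[of pi] x by (simp add: p_def)
    ultimately have "p x / y x > 0" using t(4) unfolding c by linarith
    then show ?thesis using True by (simp add: p_def zero_less_divide_iff)
  next
    case False
    then have "x = 0" using pos[of x] x by (cases "x = 0") auto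
    have "f = None"
    proof (rule ccontr)
      assume "f \<noteq> None"
      then have "poly (down f) l > 0" using down_pos[OF f _ bf] by blast
      then show False using False \<open>x = 0\<close> phi_spec(2)[OF q] by (simp add: y_def)
    qed
    then have "y 0 = 0" "y' 0 = 1" using phi_spec(2,3)[OF q] by (simp_all add: y_def y'_def)
    then show ?thesis using W[of 0] chi \<open>x = 0\<close> by (simp add: p_def)
  qed
qed

text \<open>Up to a common factor, numerator and denominator are the Wronskians of \<open>C\<close>
  and \<open>S\<close> with \<psi> at \<open>pi\<close>; constancy moves them to 0, where they are
  read off.\<close>

lemma kappa_eq:
  assumes q: "q absolutely_integrable_on {0..pi}" and F: "F \<in> herglotz"
    and bF: "below_poles F \<mu>" and p0: "fst (psi q F \<mu>) 0 \<noteq> 0"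
  shows "kappa \<mu> q F = - snd (psi q F \<mu>) 0 / fst (psi q F \<mu>) 0"
proof -
  define C C' S S' where "C = fst (cauchy_solution q \<mu> 0 1 0)" and "C' = snd (cauchy_solution q \<mu> 0 1 0)"
    and "S = fst (cauchy_solution q \<mu> 0 0 1)" and "S' = snd (cauchy_solution q \<mu> 0 0 1)"
  define p p' where "p = fst (psi q F \<mu>)" and "p' = snd (psi q F \<mu>)"
  have C: "solution q \<mu> C C'" "C 0 = 1" "C' 0 = 0" and S: "solution q \<mu> S S'" "S 0 = 0" "S' 0 = 1"
    using cauchy_solution_spec[OF q, of 0] by (simp_all add: C_def C'_def S_def S'_def)
  have p: "solution q \<mu> p p'" "p pi = poly (down F) \<mu>" "p' pi = poly (up F) \<mu>"
    using psi_spec[OF q] by (simp_all add: p_def p'_def)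
  have pi: "pi \<in> {0..pi}" by simp
  have WC: "C pi * poly (up F) \<mu> - poly (down F) \<mu> * C' pi = p' 0"
    using wronskian_constant[OF q C(1) p(1) pi] C p by (simp add: wronskian_def)
  have WS: "S pi * poly (up F) \<mu> - poly (down F) \<mu> * S' pi = - p 0"
    using wronskian_constant[OF q S(1) p(1) pi] S p by (simp add: wronskian_def)
  have k: "kappa \<mu> q F = (if F = None then C pi / S pi
         else (C' pi - C pi * rf_value F \<mu>) / (S' pi - S pi * rf_value F \<mu>))"
    by (simp add: kappa_def C_def C'_def S_def S'_def case_prod_beta Let_def)
  show ?thesis
  proof (cases "F = None")
    case True
    then show ?thesis using k WC WS p0 by (simp add: p_def p'_def field_simps)
  next
    case False
    define D U where "D = poly (down F) \<mu>" and "U = poly (up F) \<mu>"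
    have D: "D > 0" using down_pos[OF F False bF] by (simp add: D_def)
    have "C' pi - C pi * rf_value F \<mu> = - p' 0 / D" "S' pi - S pi * rf_value F \<mu> = p 0 / D"
      using WC WS D unfolding rf_value_def D_def[symmetric] U_def[symmetric] by (auto simp: field_simps)
    then show ?thesis using k False D p0 by (simp add: p_def p'_def)
  qed
qed

text \<open>
  With \<open>s = \<kappa> + t\<close> and \<open>k = \<kappa> f\<^sub>\<down> - f\<^sub>\<up>\<close> at \<open>\<mu>\<close>, \<open>\<gamma> t = k\<^sup>2 / s - k f\<^sub>\<down>\<close>; so
  \<open>\<tau>\<close> is found explicitly.
\<close>

lemma tau_spec:
  fixes \<mu> \<nu> :: real and q :: "real \<Rightarrow> real" and f F :: ratfun
  defines "D \<equiv> poly (down f) \<mu>" and "U \<equiv> poly (up f) \<mu>" and "\<kappa> \<equiv> kappa \<mu> q F" and "t \<equiv> tau \<mu> \<nu> q f F"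
  assumes f: "f \<in> herglotz" and bf: "below_poles f \<mu>" and k: "\<kappa> * D - U > 0" and \<nu>: "\<nu> > 0"
  shows "\<kappa> + t > 0" "U + t * D < 0" "(\<kappa> * D - U)\<^sup>2 / (\<kappa> + t) - (\<kappa> * D - U) * D = \<nu>"
proof -
  define k where "k = \<kappa> * D - U"
  have k0: "k > 0" using k by (simp add: k_def)
  have D0: "D \<ge> 0" using down_pos[OF f _ bf] unfolding D_def
    by (cases f) (auto intro: less_imp_le simp del: down.simps(2))
  have cond: "(f \<noteq> None \<longrightarrow> t < - rf_value f \<mu>) \<longleftrightarrow> U + t * D < 0" for t
  proof (cases "f = None")
    case False
    then have "D > 0" using down_pos[OF f _ bf] by (simp add: D_def)
    then have "t < - (U / D) \<longleftrightarrow> t * D < - U" using pos_less_divide_eq[of D t "- U"] by simp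
    then have "t < - (U / D) \<longleftrightarrow> U + t * D < 0" by linarith
    then show ?thesis using False unfolding rf_value_def D_def[symmetric] U_def[symmetric] by simp
  qed (simp add: D_def U_def)
  have gam: "gamma_fun \<mu> q f F t = k\<^sup>2 / (\<kappa> + t) - k * D" if "\<kappa> + t > 0" for t
  proof -
    have "U + t * D = (\<kappa> + t) * D - k" by (simp add: k_def algebra_simps)
    then have "gamma_fun \<mu> q f F t = - k * (((\<kappa> + t) * D - k) / (\<kappa> + t))"
      unfolding gamma_fun_def D_def[symmetric] U_def[symmetric] \<kappa>_def[symmetric] by (simp add: k_def)
    then show ?thesis using that by (simp add: field_simps power2_eq_square)
  qed
  have den: "\<nu> + k * D > 0" using \<nu> k0 D0 by (intro add_pos_nonneg) auto
  define t0 where "t0 = k\<^sup>2 / (\<nu> + k * D) - \<kappa>"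
  have s0: "\<kappa> + t0 = k\<^sup>2 / (\<nu> + k * D)" by (simp add: t0_def)
  have s0_pos: "\<kappa> + t0 > 0" unfolding s0 using den k0 by simp
  have g0: "gamma_fun \<mu> q f F t0 = \<nu>"
    unfolding gam[OF s0_pos] s0 using k0 den by (simp add: field_simps)
  \<comment> \<open>As \<open>U + t * D = (\<kappa> + t) * D - k\<close>, this is the upper end of
    the interval for \<tau>.\<close>
  have "(\<kappa> + t0) * D < k"
  proof -
    have "k\<^sup>2 * D < k * (\<nu> + k * D)" using \<nu> k0 by (simp add: power2_eq_square algebra_simps)
    then show ?thesis unfolding s0 using den by (simp add: field_simps)
  qed
  then have c0: "U + t0 * D < 0" by (simp add: k_def algebra_simps)
  have "t = t0" unfolding t_def tau_def \<kappa>_def[symmetric]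
  proof (rule the_equality)
    show "- \<kappa> < t0 \<and> (f \<noteq> None \<longrightarrow> t0 < - rf_value f \<mu>) \<and> gamma_fun \<mu> q f F t0 = \<nu>"
      using s0_pos c0 g0 cond[of t0] by simp
  next
    fix t assume t: "- \<kappa> < t \<and> (f \<noteq> None \<longrightarrow> t < - rf_value f \<mu>) \<and> gamma_fun \<mu> q f F t = \<nu>"
    then have s: "\<kappa> + t > 0" by simp
    have "k\<^sup>2 / (\<kappa> + t) - k * D = \<nu>" using t unfolding gam[OF s] by blast
    then have "k\<^sup>2 = (\<kappa> + t) * (\<nu> + k * D)" using s by (simp add: field_simps)
    then have "\<kappa> + t = k\<^sup>2 / (\<nu> + k * D)" using den by (simp add: field_simps)
    then show "t = t0" by (simp add: t0_def)
  qed
  then show "\<kappa> + t > 0" "U + t * D < 0" "(\<kappa> * D - U)\<^sup>2 / (\<kappa> + t) - (\<kappa> * D - U) * D = \<nu>"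
    using s0_pos c0 g0 gam[OF s0_pos] by (simp_all add: k_def)
qed

section \<open>The three domains put together\<close>

lemma min_eigenvalue_eq:
  assumes "spectral_data q f F {0..} lam gam"
  shows "min_eigenvalue q f F = lam 0"
    and "l < lam 0 \<Longrightarrow> \<not> is_eigenvalue q f F (complex_of_real l)"
proof -
  have mono: "strict_mono_on {0..} lam"
    and eig: "{l. is_eigenvalue q f F l} = (\<lambda>n. complex_of_real (lam n)) ` {0..}"
    using assms unfolding spectral_data_def by auto
  have iff: "is_eigenvalue q f F (complex_of_real l) \<longleftrightarrow> (\<exists>n\<ge>0. l = lam n)" for l
  proof -
    have "is_eigenvalue q f F (complex_of_real l) \<longleftrightarrow> complex_of_real l \<in> (\<lambda>n. complex_of_real (lam n)) ` {0..}"
      unfolding eig[symmetric] by simp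
    then show ?thesis by auto
  qed
  have le: "lam 0 \<le> lam n" if "n \<ge> 0" for n
    using strict_mono_onD[OF mono, of 0 n] that by (cases "n = 0") auto
  show "min_eigenvalue q f F = lam 0"
    unfolding min_eigenvalue_def iff by (rule Least_equality) (use le in auto)
  show "\<not> is_eigenvalue q f F (complex_of_real l)" if "l < lam 0"
    unfolding iff using le that by force
qed

lemma transform_eq:
  assumes "(u, u') = transform_solution (\<mu>, \<nu>, q, f, F)" and "L = transform_point (\<mu>, \<nu>, q, f, F)"
    and tr: "(q', f', F') = transform (\<mu>, \<nu>, q, f, F)"
    and q: "q absolutely_integrable_on {0..pi}" and u: "solution q L u u'" "\<And>x. x \<in> {0..pi} \<Longrightarrow> u x \<noteq> 0"
  shows "\<exists>g. darboux q L u u' g \<and> q' = (\<lambda>x. q x - 2 * g x) \<and>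
    f' = Theta L (- (u' 0 / u 0)) f \<and> F' = Theta L (u' pi / u pi) F"
proof -
  define g where "g = (SOME g. abs_cont_deriv (\<lambda>x. u' x / u x) g)"
  have "\<exists>g. abs_cont_deriv (\<lambda>x. u' x / u x) g"
    using log_derivative_absolutely_continuous[OF q u(1)] u(2) by blast
  then have "abs_cont_deriv (\<lambda>x. u' x / u x) g" unfolding g_def by (rule someI_ex)
  then have "darboux q L u u' g" using q u unfolding darboux_def by blast
  moreover have "transform (\<mu>, \<nu>, q, f, F) =
      (\<lambda>x. q x - 2 * g x, Theta L (- (u' 0 / u 0)) f, Theta L (u' pi / u pi) F)"
    unfolding transform_def g_def by (simp add: assms(1,2)[symmetric])
  ultimately show ?thesis using tr by auto
qed

theorem theorem3p6:
  fixes \<mu> \<nu> \<Lambda> J :: real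
    and I :: int
    and q q' :: "real \<Rightarrow> real"
    and f F f' F' :: ratfun
    and lam gam gam' :: "int \<Rightarrow> real"
  assumes "(\<mu>, \<nu>, q, f, F) \<in> transform_dom"
    and "spectral_data q f F {0..} lam gam"
    and "(q', f', F') = transform (\<mu>, \<nu>, q, f, F)"
    and "I = ind f' - ind f"
    and "J = real_of_int (ind f' + ind F') / 2 - real_of_int (ind f + ind F) / 2"
    and "lam (-1) = \<mu>"
    and "\<Lambda> = (if \<mu> < min_eigenvalue q f F then \<mu> else \<mu> - 2)"
    and "\<And>n. n \<ge> 0 \<Longrightarrow> gam' n = gam n * (lam n - \<Lambda>) powi I"
    and "gam' (-1) = \<nu>"
  shows "spectral_data q' f' F' {n. real_of_int n \<ge> - J} lam gam'"
proof -
  let ?arg = "(\<mu>, \<nu>, q, f, F)"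
  have adm: "admissible q f F" using assms(2) by (simp add: spectral_data_def)
  then have q: "q absolutely_integrable_on {0..pi}" and f: "f \<in> herglotz" and F: "F \<in> herglotz"
    by (auto simp: admissible_def)
  note lam0 = min_eigenvalue_eq[OF assms(2)]
  have gam': "\<And>n. n \<ge> 0 \<Longrightarrow> gam' n = gam n * (lam n - \<Lambda>) powi (ind f' - ind f)"
    using assms(8) unfolding assms(4) .
  have dom: "?arg \<in> dom1 \<or> ?arg \<in> dom2 \<or> ?arg \<in> dom3"
    using assms(1) by (auto simp: transform_dom_def)
  have in_dom1: "?arg \<in> dom1 \<longleftrightarrow> \<mu> < lam 0 \<and> \<nu> > 0"
    using adm lam0 by (auto simp: dom1_def)
  have not_dom1: "\<mu> = lam 0" if "?arg \<notin> dom1"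
    using dom that lam0 by (auto simp: dom2_def dom3_def)
  \<comment> \<open>\<open>transform_point\<close> tests membership in \<open>dom1\<close>, while
    \<Lambda> depends on the inequality alone. Outside \<open>dom1\<close> the number \<mu> is the
    smallest eigenvalue, so both give \<open>\<mu> - 2\<close>.\<close>
  have \<Lambda>: "\<Lambda> = transform_point ?arg" and below: "\<Lambda> < lam 0"
  proof -
    have "\<Lambda> = transform_point ?arg \<and> \<Lambda> < lam 0"
    proof (cases "?arg \<in> dom1")
      case True
      moreover from this have "\<mu> < lam 0" using in_dom1 by blast
      ultimately show ?thesis unfolding assms(7) lam0(1) transform_point_def by simp
    next
      case False
      moreover from not_dom1[OF this] have "\<not> \<mu> < lam 0" "\<mu> - 2 < lam 0" by linarith+
      ultimately show ?thesis unfolding assms(7) lam0(1) transform_point_def by simp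
    qed
    then show "\<Lambda> = transform_point ?arg" "\<Lambda> < lam 0" by blast+
  qed
  have osc: "oscillation_free q f F \<Lambda>"
  proof (rule oscillation_free_below_spectrum[OF q f F])
    show "\<not> is_eigenvalue q f F (complex_of_real l)" if "l \<le> \<Lambda>" for l
      using below that by (intro lam0(2)) linarith
  qed
  then have bf: "below_poles f \<Lambda>" and bF: "below_poles F \<Lambda>" and chi: "chi q f F \<Lambda> > 0"
    and phi_pos: "\<And>x. x \<in> {0<..pi} \<Longrightarrow> fst (phi q f \<Lambda>) x > 0"
    by (auto simp: oscillation_free_def)
  note psi_pos = psi_nonnegative[OF q f F osc]
  define D U where "D = poly (down f) \<Lambda>" and "U = poly (up f) \<Lambda>"
  define y y' p p' where "y = fst (phi q f \<Lambda>)" and "y' = snd (phi q f \<Lambda>)"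
    and "p = fst (psi q F \<Lambda>)" and "p' = snd (psi q F \<Lambda>)"
  have sy: "solution q \<Lambda> y y'" and y0: "y 0 = D" "y' 0 = - U"
    using phi_spec[OF q, where f = f and l = \<Lambda>] by (simp_all add: y_def y'_def D_def U_def)
  have sp: "solution q \<Lambda> p p'" and ppi: "p pi = poly (down F) \<Lambda>" "p' pi = poly (up F) \<Lambda>"
    using psi_spec[OF q, where F = F and l = \<Lambda>] by (simp_all add: p_def p'_def)
  have p0: "p 0 > 0" using psi_pos(1)[of 0] by (simp add: p_def)
  have ends: "(0::real) \<in> {0..pi}" "pi \<in> {0..pi}" by simp_all
  have W0: "D * p' 0 + U * p 0 = - chi q f F \<Lambda>"
    using wronskian_phi_psi[OF q ends(1), of f \<Lambda> F] y0 by (simp add: wronskian_def y_def y'_def p_def p'_def mult.commute)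
  obtain u u' where uu: "(u, u') = transform_solution ?arg" by (metis surj_pair)
  \<comment> \<open>The cases follow the nested conditionals of
    \<open>transform_solution\<close>.\<close>
  consider "?arg \<in> dom1" | "?arg \<notin> dom1" "?arg \<in> dom2" | "?arg \<notin> dom1" "?arg \<notin> dom2" "?arg \<in> dom3"
    using dom by blast
  then show ?thesis
  proof cases
    case 1
    then have \<mu>: "\<mu> = \<Lambda>" and \<nu>: "\<nu> > 0" using \<Lambda> in_dom1 by (auto simp: transform_point_def)
    define \<kappa> t where "\<kappa> = kappa \<Lambda> q F" and "t = tau \<Lambda> \<nu> q f F"
    have kap: "\<kappa> = - p' 0 / p 0"
      using kappa_eq[OF q F bF] p0 by (simp add: \<kappa>_def p_def p'_def)
    have k: "\<kappa> * D - U = chi q f F \<Lambda> / p 0"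
      using W0 p0 unfolding kap by (simp add: field_simps)
    then have k_pos: "\<kappa> * D - U > 0" using chi p0 by simp
    note T = tau_spec[OF f bf k_pos[unfolded \<kappa>_def D_def U_def] \<nu>, folded \<kappa>_def D_def U_def t_def]
    have u_eq: "u = fst (cauchy_solution q \<Lambda> 0 1 t)" "u' = snd (cauchy_solution q \<Lambda> 0 1 t)"
      using uu 1 \<mu> by (auto simp: transform_solution_def t_def prod_eq_iff)
    have su: "solution q \<Lambda> u u'" and u0: "u 0 = 1" "u' 0 = t"
      using cauchy_solution_spec[OF q, of 0] by (simp_all add: u_eq)
    have kap': "p' 0 = - \<kappa> * p 0" using p0 kap by simp
    \<comment> \<open>The coefficients of \<open>u\<close> in terms of \<phi> and \<psi>, as
      quotients of Wronskians at 0. They are positive exactly because \<tau> lies above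
      \<open>-\<kappa>\<close> and satisfies \<open>U + t * D < 0\<close>; hence \<open>u\<close>
      has no zeros.\<close>
    define c \<alpha> \<beta> where "c = chi q f F \<Lambda>" and "\<alpha> = p 0 * (\<kappa> + t) / c" and "\<beta> = - (U + t * D) / c"
    have c: "c > 0" "c = p 0 * (\<kappa> * D - U)" using chi k p0 by (simp_all add: c_def)
    have \<alpha>\<beta>: "\<alpha> > 0" "\<beta> > 0" using T c(1) p0 by (auto simp: \<alpha>_def \<beta>_def)
    have 1: "\<alpha> * y 0 + \<beta> * p 0 = u 0" "\<alpha> * y' 0 + \<beta> * p' 0 = u' 0"
    proof -
      have "\<alpha> * y 0 + \<beta> * p 0 = (p 0 * (\<kappa> * D - U)) / c"
        unfolding \<alpha>_def \<beta>_def y0 by (simp add: algebra_simps add_divide_distrib[symmetric] diff_divide_distrib[symmetric])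
      then show "\<alpha> * y 0 + \<beta> * p 0 = u 0" unfolding c(2)[symmetric] u0 using c(1) by simp
      have "\<alpha> * y' 0 + \<beta> * p' 0 = t * (p 0 * (\<kappa> * D - U)) / c"
        unfolding \<alpha>_def \<beta>_def y0 kap' by (simp add: algebra_simps add_divide_distrib[symmetric] diff_divide_distrib[symmetric])
      then show "\<alpha> * y' 0 + \<beta> * p' 0 = u' 0" unfolding c(2)[symmetric] u0 using c(1) by simp
    qed
    have comb: "u x = \<alpha> * y x + \<beta> * p x" if "x \<in> {0..pi}" for x
      using solution_unique(1)[OF q su solution_linear[OF q sy sp, of \<alpha> \<beta>] ends(1) _ _ that] 1 by simp
    have u_pos: "u x > 0" if x: "x \<in> {0..pi}" for x
    proof (cases "x = 0")
      case True
      then show ?thesis using u0 by simp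
    next
      case False
      then have "y x > 0" using phi_pos x by (simp add: y_def)
      moreover have "p x \<ge> 0" using psi_pos(1)[of x] psi_pos(2) x by (cases "x = pi") (auto simp: p_def less_imp_le)
      ultimately show ?thesis unfolding comb[OF x] using \<alpha>\<beta> by (intro add_pos_nonneg) auto
    qed
    then have u_nz: "\<And>x. x \<in> {0..pi} \<Longrightarrow> u x \<noteq> 0" by force
    obtain g where g: "darboux q \<Lambda> u u' g" "q' = (\<lambda>x. q x - 2 * g x)"
      "f' = Theta \<Lambda> (- (u' 0 / u 0)) f" "F' = Theta \<Lambda> (u' pi / u pi) F"
      using transform_eq[OF uu \<Lambda> assms(3) q su u_nz] by blast
    have D1: "- (u' 0 / u 0) * poly (down f) \<Lambda> - poly (up f) \<Lambda> > 0"
      using T(2) u0 by (simp add: D_def U_def)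
    \<comment> \<open>The Wronskian of \<open>u\<close> and \<psi> carries the lower bound
      \<open>t > -\<kappa>\<close> from 0 to \<open>pi\<close>, where it becomes the sign condition
      for \<open>F\<close>; the upper bound was the one for \<open>f\<close>.\<close>
    have "u pi * p' pi - p pi * u' pi = - (p 0 * (\<kappa> + t))"
      using wronskian_constant[OF q su sp ends(2)] u0 kap' by (simp add: wronskian_def algebra_simps)
    moreover have "u pi * (u' pi / u pi * poly (down F) \<Lambda> - poly (up F) \<Lambda>) =
        - (u pi * p' pi - p pi * u' pi)"
      using u_pos[OF ends(2)] unfolding ppi by (simp add: field_simps)
    ultimately have "u pi * (u' pi / u pi * poly (down F) \<Lambda> - poly (up F) \<Lambda>) = p 0 * (\<kappa> + t)"
      by linarith
    moreover have "p 0 * (\<kappa> + t) > 0" using p0 T(1) by simp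
    ultimately have E1: "u' pi / u pi * poly (down F) \<Lambda> - poly (up F) \<Lambda> > 0"
      using u_pos[OF ends(2)] by (metis zero_less_mult_pos)
    have link0: "theta_link \<Lambda> (- (u' 0 / u 0)) f f' 1"
      unfolding g(3) by (rule theta_link_generic[OF f bf D1])
    have link1: "theta_link \<Lambda> (u' pi / u pi) F F' 1"
      unfolding g(4) by (rule theta_link_generic[OF F bF E1])
    interpret darboux_problem q \<Lambda> u u' g f F f' F' 1 1
      using g(1) link0 link1 by unfold_locales
    have down1: "poly (down f') \<Lambda> = - t * D - U" "poly (down F') \<Lambda> \<noteq> 0"
      using theta_link_values(1)[OF link0, of \<Lambda>] theta_link_values(1)[OF link1, of \<Lambda>] E1 u0
      by (auto simp: D_def U_def)
    \<comment> \<open>Both indices grow by one, so the numbering starts at -1.\<close>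
    have "J = 1"
      unfolding assms(5) theta_link_ind(1)[OF link0] theta_link_ind(1)[OF link1]
      by (simp add: field_simps)
    moreover have "norming_constant q1 f' F' \<Lambda> = \<nu>"
    proof -
      define s where "s = \<kappa> + t"
      define k where "k = \<kappa> * D - U"
      have s: "s > 0" using T(1) by (simp add: s_def)
      have D': "- t * D - U = k - s * D" by (simp add: k_def s_def algebra_simps)
      have den: "u 0 * p' 0 - u' 0 * p 0 = - (p 0 * s)"
        unfolding u0 kap' by (simp add: s_def algebra_simps)
      have "poly (down f') \<Lambda> \<noteq> 0" using down1(1) T(2) by linarith
      from norming_constant_at_L[OF refl refl this down1(2)]
      have "norming_constant q1 f' F' \<Lambda> = (k - s * D) * D - (k - s * D)\<^sup>2 * u 0 * p 0 / (u 0 * p' 0 - u' 0 * p 0)"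
        unfolding down1(1) D' D_def[symmetric] p_def[symmetric] p'_def[symmetric] .
      \<comment> \<open>The expression is \<open>(k - s * D) * (D + (k - s * D) / s)\<close>, and
        the second factor is \<open>k / s\<close>.\<close>
      also have "\<dots> = k\<^sup>2 / s - k * D"
        unfolding den unfolding u0 using s p0 by (simp add: field_simps power2_eq_square)
      also have "\<dots> = \<nu>" using T(3) by (simp add: s_def k_def)
      finally show ?thesis .
    qed
    moreover have "chi q1 f' F' \<Lambda> = 0" by (rule chi_at_L) simp_all
    moreover have "{n. real_of_int n \<ge> - 1} = {-1..}" by auto
    ultimately show ?thesis
      unfolding g(2) using assms(6,9) \<mu> by (intro spectral_data_transformed[OF assms(2) below gam']) auto
  next
    case 2
    then have f0: "f \<in> herglotz_of_index 0" by (simp add: dom2_def)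
    have \<mu>: "\<mu> - 2 = \<Lambda>" using \<Lambda> 2(1) by (simp add: transform_point_def)
    have u_eq: "u = y" "u' = y'"
      using uu 2 \<mu> by (auto simp: transform_solution_def y_def y'_def prod_eq_iff)
    \<comment> \<open>For constant \<open>f\<close> the solution \<phi> starts from 1, which extends
      its positivity to the left end.\<close>
    have D: "D = 1" using herglotz_of_index_0[OF f0] unfolding D_def by (metis poly_1)
    have u_pos: "u x > 0" if "x \<in> {0..pi}" for x
      using phi_pos[of x] that y0(1) D by (cases "x = 0") (auto simp: u_eq y_def)
    then have u_nz: "\<And>x. x \<in> {0..pi} \<Longrightarrow> u x \<noteq> 0" by force
    obtain g where g: "darboux q \<Lambda> u u' g" "q' = (\<lambda>x. q x - 2 * g x)"
      "f' = Theta \<Lambda> (- (u' 0 / u 0)) f" "F' = Theta \<Lambda> (u' pi / u pi) F"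
      using transform_eq[OF uu \<Lambda> assms(3) q sy[folded u_eq] u_nz] by blast
    \<comment> \<open>With \<open>u\<close> equal to \<phi> the parameter \<tau> at 0 is the
      constant \<open>f\<close> itself, so \<Theta> produces the Dirichlet condition there.\<close>
    have "- (u' 0 / u 0) * poly (down f) \<Lambda> = poly (up f) \<Lambda>"
      using y0 D by (simp add: u_eq D_def U_def)
    from theta_link_constant[OF f0 this]
    have link0: "theta_link \<Lambda> (- (u' 0 / u 0)) f f' [:\<Lambda>, -1:]" and f': "f' = None"
      unfolding g(3) by blast+
    have "u' pi / u pi * poly (down F) \<Lambda> - poly (up F) \<Lambda> = chi q f F \<Lambda> / u pi"
      using u_nz[OF ends(2)] by (simp add: chi_def u_eq y_def y'_def field_simps)
    then have E1: "u' pi / u pi * poly (down F) \<Lambda> - poly (up F) \<Lambda> > 0"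
      using chi u_pos[OF ends(2)] by simp
    have link1: "theta_link \<Lambda> (u' pi / u pi) F F' 1"
      unfolding g(4) by (rule theta_link_generic[OF F bF E1])
    interpret darboux_problem q \<Lambda> u u' g f F f' F' "[:\<Lambda>, -1:]" 1
      using g(1) link0 link1 by unfold_locales
    have "poly (down F') \<Lambda> \<noteq> 0"
      using theta_link_values(1)[OF link1, of \<Lambda>] E1 by auto
    then have "chi q1 f' F' \<Lambda> \<noteq> 0" using f' by (intro chi_at_L_left_Dirichlet) auto
    \<comment> \<open>One index falls and the other grows, so no eigenvalue is added.\<close>
    moreover have "J = 0"
      unfolding assms(5) theta_link_ind(2)[OF link0] theta_link_ind(1)[OF link1]
      by (simp add: field_simps)
    moreover have "{n. real_of_int n \<ge> - 0} = {0..}" by auto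
    ultimately show ?thesis
      unfolding g(2) by (intro spectral_data_transformed[OF assms(2) below gam']) auto
  next
    case 3
    then have F0: "F \<in> herglotz_of_index 0" by (simp add: dom3_def)
    have \<mu>: "\<mu> - 2 = \<Lambda>" using \<Lambda> 3(1) by (simp add: transform_point_def)
    have u_eq: "u = p" "u' = p'"
      using uu 3 \<mu> by (auto simp: transform_solution_def p_def p'_def prod_eq_iff)
    have DF: "poly (down F) \<Lambda> = 1" using herglotz_of_index_0[OF F0] by (metis poly_1)
    have u_pos: "u x > 0" if "x \<in> {0..pi}" for x
      using psi_pos(1)[of x] that ppi(1) DF by (cases "x = pi") (auto simp: u_eq p_def)
    then have u_nz: "\<And>x. x \<in> {0..pi} \<Longrightarrow> u x \<noteq> 0" by force
    obtain g where g: "darboux q \<Lambda> u u' g" "q' = (\<lambda>x. q x - 2 * g x)"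
      "f' = Theta \<Lambda> (- (u' 0 / u 0)) f" "F' = Theta \<Lambda> (u' pi / u pi) F"
      using transform_eq[OF uu \<Lambda> assms(3) q sp[folded u_eq] u_nz] by blast
    have "u' pi / u pi * poly (down F) \<Lambda> = poly (up F) \<Lambda>"
      using ppi DF by (simp add: u_eq)
    from theta_link_constant[OF F0 this]
    have link1: "theta_link \<Lambda> (u' pi / u pi) F F' [:\<Lambda>, -1:]" and F': "F' = None"
      unfolding g(4) by blast+
    \<comment> \<open>The numerator is minus the boundary form of \<psi> at 0, that is
      \<open>chi\<close>; this gives the sign condition at 0.\<close>
    have "- (u' 0 / u 0) * D - U = - (D * p' 0 + U * p 0) / u 0"
      using u_nz[OF ends(1)] by (simp add: u_eq field_simps)
    then have D1: "- (u' 0 / u 0) * poly (down f) \<Lambda> - poly (up f) \<Lambda> > 0"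
      using chi u_pos[OF ends(1)] unfolding W0 by (simp add: D_def U_def)
    have link0: "theta_link \<Lambda> (- (u' 0 / u 0)) f f' 1"
      unfolding g(3) by (rule theta_link_generic[OF f bf D1])
    interpret darboux_problem q \<Lambda> u u' g f F f' F' 1 "[:\<Lambda>, -1:]"
      using g(1) link0 link1 by unfold_locales
    have "poly (down f') \<Lambda> \<noteq> 0"
      using theta_link_values(1)[OF link0, of \<Lambda>] D1 by auto
    then have "chi q1 f' F' \<Lambda> \<noteq> 0" using F' by (intro chi_at_L_right_Dirichlet) auto
    moreover have "J = 0"
      unfolding assms(5) theta_link_ind(1)[OF link0] theta_link_ind(2)[OF link1]
      by (simp add: field_simps)
    moreover have "{n. real_of_int n \<ge> - 0} = {0..}" by auto
    ultimately show ?thesis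
      unfolding g(2) by (intro spectral_data_transformed[OF assms(2) below gam']) auto
  qed
qed

end
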